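(* Let $A$ be an Artin algebra, let $B:=T(A/\mathrm{rad}(A))$ be the trivial extension algebra of $A/\mathrm{rad}(A)$ with respect to the bimodule $A/\mathrm{rad}(A)$, and let $$\Lambda:=\begin{pmatrix} A & {}_A(A/\mathrm{rad}(A))_B\\ 0 & B\end{pmatrix}.$$ Then $\mathrm{del}(A)\le \mathrm{del}(\Lambda)\le \mathrm{del}(A)+1$ and $\mathrm{del}(\Lambda^{\mathrm{op}})=0$.
   Context: All algebras are Artin algebras over a commutative Artin ring $k$, and all modules are finitely generated right modules unless stated otherwise. $\mathrm{rad}(A)$ is the Jacobson radical of $A$, and $\Lambda^{\mathrm{op}}$ is the opposite algebra of $\Lambda$. Trivial extension: for an algebra $R$, $T(R):=R\ltimes R^\natural$ with $R^\natural:={}_RR_R$, i.e. $T(R)=R\oplus R^\natural$ as an abelian group with multiplication $(x,y)(x',y')=(xx',xy'+yx')$. $R^\natural$ is a two-sided ideal and $T(R)/R^\natural\cong R$; the resulting surjection $T(R)\to R$ is the canonical epimorphism. Bimodule structure: $A/\mathrm{rad}(A)$ is viewed as an $A$-$B$-bimodule with its natural left $A$-action, and with right $B$-action via the canonical epimorphism $B=T(A/\mathrm{rad}(A))\to A/\mathrm{rad}(A)$. $\Lambda$ is the corresponding triangular matrix algebra. Delooping level: for a finitely generated right $A$-module $X$, let $\Omega^d(X)$ denote the $d$-th syzygy of $X$ (taken via projective covers, $\Omega^0(X)=X$). Put $$\mathrm{del}(X):=\min\{d\ge 0\mid \Omega^d(X)\text{ is (isomorphic to) a direct summand of }P\oplus\Omega^{d+1}(M)\text{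 for some finitely generated projective right }A\text{-module }P\text{ and some finitely generated right }A\text{-module }M\},$$ and $\mathrm{del}(X):=\infty$ if no such $d$ exists. The delooping level of the algebra is $\mathrm{del}(A):=\max\{\mathrm{del}(S)\mid S\text{ a simple right }A\text{-module}\}$ (equivalently, $\mathrm{del}$ of the top of $A_A$). The inequalities are in $\mathbb{Z}_{\ge 0}\cup\{\infty\}$ with $\infty+1=\infty$. *)

theory Defs
  imports "HOL-Algebra.QuotRing" "HOL-Library.Extended_Nat" "HOL-Library.FuncSet"
begin

section \<open>Artin algebras and the Jacobson radical\<close>

definition artinian_ring :: "('a, 'c) ring_scheme \<Rightarrow> bool" where
  "artinian_ring k \<longleftrightarrow> cring k \<and>
     (\<forall>I :: nat \<Rightarrow> 'a set. (\<forall>n. ideal (I n) k) \<and> (\<forall>n. I (Suc n) \<subseteq> I n)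
        \<longrightarrow> (\<exists>N. \<forall>n\<ge>N. I n = I N))"

text \<open>The \<open>k\<close>-algebra structure of \<open>A\<close> is given by its structure map \<open>\<phi>\<close> into the centre;
  \<open>k\<close> acts by \<open>c a = \<phi> c \<otimes> a\<close>.\<close>

locale artin_algebra = k: cring k + A: ring A
  for k :: "('k, 'c) ring_scheme" and \<phi> :: "'k \<Rightarrow> 'a" and A :: "('a, 'd) ring_scheme" +
  assumes artinian_base: "artinian_ring k"
    and structure_hom: "\<phi> \<in> ring_hom k A"
    and structure_central:
      "\<lbrakk>c \<in> carrier k; a \<in> carrier A\<rbrakk> \<Longrightarrow> \<phi> c \<otimes>\<^bsub>A\<^esub> a = a \<otimes>\<^bsub>A\<^esub> \<phi> c"
    and finitely_generated_over_base:
      "\<exists>S. finite S \<and> S \<subseteq> carrier A \<and>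
         (\<forall>a\<in>carrier A. \<exists>c \<in> S \<rightarrow> carrier k. a = (\<Oplus>\<^bsub>A\<^esub>s\<in>S. \<phi> (c s) \<otimes>\<^bsub>A\<^esub> s))"

definition right_ideal :: "'a set \<Rightarrow> ('a, 'c) ring_scheme \<Rightarrow> bool" where
  "right_ideal I R \<longleftrightarrow> additive_subgroup I R \<and>
     (\<forall>x\<in>I. \<forall>a\<in>carrier R. x \<otimes>\<^bsub>R\<^esub> a \<in> I)"

definition maximal_right_ideal :: "'a set \<Rightarrow> ('a, 'c) ring_scheme \<Rightarrow> bool" where
  "maximal_right_ideal I R \<longleftrightarrow> right_ideal I R \<and> I \<noteq> carrier R \<and>
     (\<forall>J. right_ideal J R \<and> I \<subseteq> J \<longrightarrow> J = I \<or> J = carrier R)"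

definition jacobson_radical :: "('a, 'c) ring_scheme \<Rightarrow> 'a set" where
  "jacobson_radical R = {a \<in> carrier R. \<forall>I. maximal_right_ideal I R \<longrightarrow> a \<in> I}"

section \<open>Constructions of rings\<close>

definition opposite_ring :: "('a, 'c) ring_scheme \<Rightarrow> ('a, 'c) ring_scheme" where
  "opposite_ring R = R\<lparr>mult := (\<lambda>x y. y \<otimes>\<^bsub>R\<^esub> x)\<rparr>"

definition trivial_extension :: "('a, 'c) ring_scheme \<Rightarrow> ('a \<times> 'a) ring" where
  "trivial_extension R =
     \<lparr>carrier = carrier R \<times> carrier R,
      mult = (\<lambda>(x, y) (x', y'). (x \<otimes>\<^bsub>R\<^esub> x', x \<otimes>\<^bsub>R\<^esub> y' \<oplus>\<^bsub>R\<^esub> y \<otimes>\<^bsub>R\<^esub> x')),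
      one = (\<one>\<^bsub>R\<^esub>, \<zero>\<^bsub>R\<^esub>),
      zero = (\<zero>\<^bsub>R\<^esub>, \<zero>\<^bsub>R\<^esub>),
      add = (\<lambda>(x, y) (x', y'). (x \<oplus>\<^bsub>R\<^esub> x', y \<oplus>\<^bsub>R\<^esub> y'))\<rparr>"

definition canonical_epi :: "'a \<times> 'a \<Rightarrow> 'a" where
  "canonical_epi = fst"

text \<open>The triple \<open>(a, m, b)\<close> stands for the upper triangular matrix with diagonal \<open>a\<close>, \<open>b\<close> and
  off-diagonal entry \<open>m\<close>. Of the record \<open>M\<close> only the additive group is used; \<open>lact\<close> and
  \<open>ract\<close> are the left \<open>A\<close>-action and the right \<open>B\<close>-action on it.\<close>

definition triangular_matrix_ring ::
  "('a, 'c) ring_scheme \<Rightarrow> ('m, 'd) ring_scheme \<Rightarrow> ('a \<Rightarrow> 'm \<Rightarrow> 'm) \<Rightarrow> ('m \<Rightarrow> 'b \<Rightarrow> 'm)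
     \<Rightarrow> ('b, 'e) ring_scheme \<Rightarrow> ('a \<times> 'm \<times> 'b) ring" where
  "triangular_matrix_ring A M lact ract B =
     \<lparr>carrier = carrier A \<times> carrier M \<times> carrier B,
      mult = (\<lambda>(a, m, b) (a', m', b').
                (a \<otimes>\<^bsub>A\<^esub> a', lact a m' \<oplus>\<^bsub>M\<^esub> ract m b', b \<otimes>\<^bsub>B\<^esub> b')),
      one = (\<one>\<^bsub>A\<^esub>, \<zero>\<^bsub>M\<^esub>, \<one>\<^bsub>B\<^esub>),
      zero = (\<zero>\<^bsub>A\<^esub>, \<zero>\<^bsub>M\<^esub>, \<zero>\<^bsub>B\<^esub>),
      add = (\<lambda>(a, m, b) (a', m', b'). (a \<oplus>\<^bsub>A\<^esub> a', m \<oplus>\<^bsub>M\<^esub> m', b \<oplus>\<^bsub>B\<^esub> b'))\<rparr>"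

section \<open>Right modules\<close>

text \<open>The library's modules are over commutative rings, so right modules over arbitrary rings are
  introduced here. As there, the record extends \<open>ring\<close> only to inherit the additive notation and
  theory; its fields \<open>mult\<close> and \<open>one\<close> carry no meaning.\<close>

record ('a, 'b) rmodule = "'b ring" +
  act :: "'b \<Rightarrow> 'a \<Rightarrow> 'b" (infixl \<open>\<bullet>\<index>\<close> 70)

locale right_module = R: ring R + abelian_group M
  for R :: "('a, 'c) ring_scheme" and M :: "('a, 'b) rmodule" (structure) +
  assumes act_closed: "\<lbrakk>x \<in> carrier M; a \<in> carrier R\<rbrakk> \<Longrightarrow> x \<bullet> a \<in> carrier M"
    and act_add_left: "\<lbrakk>x \<in> carrier M; y \<in> carrier M; a \<in> carrier R\<rbrakk>
      \<Longrightarrow> (x \<oplus> y) \<bullet> a = x \<bullet> a \<oplus> y \<bullet> a"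
    and act_add_right: "\<lbrakk>x \<in> carrier M; a \<in> carrier R; b \<in> carrier R\<rbrakk>
      \<Longrightarrow> x \<bullet> (a \<oplus>\<^bsub>R\<^esub> b) = x \<bullet> a \<oplus> x \<bullet> b"
    and act_assoc: "\<lbrakk>x \<in> carrier M; a \<in> carrier R; b \<in> carrier R\<rbrakk>
      \<Longrightarrow> x \<bullet> (a \<otimes>\<^bsub>R\<^esub> b) = (x \<bullet> a) \<bullet> b"
    and act_one: "x \<in> carrier M \<Longrightarrow> x \<bullet> \<one>\<^bsub>R\<^esub> = x"

definition rsubmodule :: "('a, 'c) ring_scheme \<Rightarrow> 'b set \<Rightarrow> ('a, 'b) rmodule \<Rightarrow> bool" where
  "rsubmodule R N M \<longleftrightarrow> additive_subgroup N M \<and>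
     (\<forall>x\<in>N. \<forall>a\<in>carrier R. x \<bullet>\<^bsub>M\<^esub> a \<in> N)"

definition restrict_module :: "('a, 'b) rmodule \<Rightarrow> 'b set \<Rightarrow> ('a, 'b) rmodule" where
  "restrict_module M N = M\<lparr>carrier := N\<rparr>"

definition fg_module :: "('a, 'c) ring_scheme \<Rightarrow> ('a, 'b) rmodule \<Rightarrow> bool" where
  "fg_module R M \<longleftrightarrow> right_module R M \<and>
     (\<exists>S. finite S \<and> S \<subseteq> carrier M \<and>
        (\<forall>N. rsubmodule R N M \<and> S \<subseteq> N \<longrightarrow> N = carrier M))"

definition simple_module :: "('a, 'c) ring_scheme \<Rightarrow> ('a, 'b) rmodule \<Rightarrow> bool" where
  "simple_module R M \<longleftrightarrow> right_module R M \<and> carrier M \<noteq> {\<zero>\<^bsub>M\<^esub>} \<and>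
     (\<forall>N. rsubmodule R N M \<longrightarrow> N = {\<zero>\<^bsub>M\<^esub>} \<or> N = carrier M)"

definition rmodule_hom ::
  "('a, 'c) ring_scheme \<Rightarrow> ('a, 'b) rmodule \<Rightarrow> ('a, 'd) rmodule \<Rightarrow> ('b \<Rightarrow> 'd) set" where
  "rmodule_hom R M N = {f \<in> carrier M \<rightarrow> carrier N.
     (\<forall>x\<in>carrier M. \<forall>y\<in>carrier M. f (x \<oplus>\<^bsub>M\<^esub> y) = f x \<oplus>\<^bsub>N\<^esub> f y) \<and>
     (\<forall>x\<in>carrier M. \<forall>a\<in>carrier R. f (x \<bullet>\<^bsub>M\<^esub> a) = f x \<bullet>\<^bsub>N\<^esub> a)}"

definition rmodule_iso ::
  "('a, 'c) ring_scheme \<Rightarrow> ('a, 'b) rmodule \<Rightarrow> ('a, 'd) rmodule \<Rightarrow> bool" where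
  "rmodule_iso R M N \<longleftrightarrow> (\<exists>f\<in>rmodule_hom R M N. bij_betw f (carrier M) (carrier N))"

definition rmodule_sum ::
  "('a, 'b) rmodule \<Rightarrow> ('a, 'd) rmodule \<Rightarrow> ('a, 'b \<times> 'd) rmodule" where
  "rmodule_sum M N =
     \<lparr>carrier = carrier M \<times> carrier N, mult = undefined, one = undefined,
      zero = (\<zero>\<^bsub>M\<^esub>, \<zero>\<^bsub>N\<^esub>),
      add = (\<lambda>(x, y) (x', y'). (x \<oplus>\<^bsub>M\<^esub> x', y \<oplus>\<^bsub>N\<^esub> y')),
      act = (\<lambda>(x, y) a. (x \<bullet>\<^bsub>M\<^esub> a, y \<bullet>\<^bsub>N\<^esub> a))\<rparr>"

text \<open>\<open>X\<close> is isomorphic to a direct summand of \<open>W\<close>.\<close>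

definition iso_summand ::
  "('a, 'c) ring_scheme \<Rightarrow> ('a, 'b) rmodule \<Rightarrow> ('a, 'd) rmodule \<Rightarrow> bool" where
  "iso_summand R X W \<longleftrightarrow>
     (\<exists>N N'. rsubmodule R N W \<and> rsubmodule R N' W \<and> N \<inter> N' = {\<zero>\<^bsub>W\<^esub>} \<and>
        N <+>\<^bsub>W\<^esub> N' = carrier W \<and> rmodule_iso R X (restrict_module W N))"

definition free_module :: "('a, 'c) ring_scheme \<Rightarrow> nat \<Rightarrow> ('a, nat \<Rightarrow> 'a) rmodule" where
  "free_module R n =
     \<lparr>carrier = {..<n} \<rightarrow>\<^sub>E carrier R, mult = undefined, one = undefined,
      zero = (\<lambda>i\<in>{..<n}. \<zero>\<^bsub>R\<^esub>),
      add = (\<lambda>f g. \<lambda>i\<in>{..<n}. f i \<oplus>\<^bsub>R\<^esub> g i),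
      act = (\<lambda>f a. \<lambda>i\<in>{..<n}. f i \<otimes>\<^bsub>R\<^esub> a)\<rparr>"

definition fg_projective :: "('a, 'c) ring_scheme \<Rightarrow> ('a, 'b) rmodule \<Rightarrow> bool" where
  "fg_projective R P \<longleftrightarrow> right_module R P \<and> (\<exists>n. iso_summand R P (free_module R n))"

definition superfluous ::
  "('a, 'c) ring_scheme \<Rightarrow> 'b set \<Rightarrow> ('a, 'b) rmodule \<Rightarrow> bool" where
  "superfluous R K P \<longleftrightarrow> rsubmodule R K P \<and>
     (\<forall>N. rsubmodule R N P \<and> N <+>\<^bsub>P\<^esub> K = carrier P \<longrightarrow> N = carrier P)"

definition projective_cover ::
  "('a, 'c) ring_scheme \<Rightarrow> ('a, 'b) rmodule \<Rightarrow> ('b \<Rightarrow> 'd) \<Rightarrow> ('a, 'd) rmodule \<Rightarrow> bool" where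
  "projective_cover R P p X \<longleftrightarrow> fg_projective R P \<and> p \<in> rmodule_hom R P X \<and>
     p ` carrier P = carrier X \<and> superfluous R (a_kernel P X p) P"

section \<open>Syzygies and the delooping level\<close>

text \<open>Quantification over all finitely generated right modules needs a fixed carrier type. A
  finitely generated right module is a quotient of some \<open>free_module R n\<close>, so up to isomorphism it
  lives on sets of functions \<open>nat \<Rightarrow> 'a\<close>; this is shown in \<open>fg_module_iso_umodule\<close> below.\<close>

type_synonym 'a umodule = "('a, (nat \<Rightarrow> 'a) set) rmodule"

lemma fg_module_iso_umodule:
  fixes R :: "('a, 'c) ring_scheme" and M :: "('a, 'b) rmodule"
  assumes "fg_module R M"
  shows "\<exists>M' :: 'a umodule. fg_module R M' \<and> rmodule_iso R M M'"
proof -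
  interpret right_module R M using assms by (simp add: fg_module_def)
  obtain S where S: "finite S" "S \<subseteq> carrier M"
    "\<And>N. rsubmodule R N M \<Longrightarrow> S \<subseteq> N \<Longrightarrow> N = carrier M"
    using assms by (auto simp: fg_module_def)
  obtain n and s :: "nat \<Rightarrow> 'b" where s: "S = s ` {i. i < n}"
    using finite_imp_nat_seg_image_inj_on[OF S(1)] by blast
  define comb where "comb = (\<lambda>f. \<Oplus>\<^bsub>M\<^esub>i\<in>{i. i < n}. s i \<bullet>\<^bsub>M\<^esub> f i)"
  define N where "N = comb ` ({i. i < n} \<rightarrow> carrier R)"
  have sM: "s i \<in> carrier M" if "i < n" for i using that S(2) s by auto
  have act0: "x \<bullet>\<^bsub>M\<^esub> \<zero>\<^bsub>R\<^esub> = \<zero>\<^bsub>M\<^esub>" if "x \<in> carrier M" for x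
    using act_add_right[OF that, of "\<zero>\<^bsub>R\<^esub>" "\<zero>\<^bsub>R\<^esub>"] act_closed[OF that R.zero_closed]
    by (metis R.l_zero R.zero_closed add.r_cancel_one')
  have zact: "\<zero>\<^bsub>M\<^esub> \<bullet>\<^bsub>M\<^esub> a = \<zero>\<^bsub>M\<^esub>" if "a \<in> carrier R" for a
    using act_add_left[OF zero_closed zero_closed that] act_closed[OF zero_closed that]
    by (metis l_zero zero_closed add.r_cancel_one')
  have comb_add: "comb (\<lambda>i. f i \<oplus>\<^bsub>R\<^esub> g i) = comb f \<oplus>\<^bsub>M\<^esub> comb g"
    if "f \<in> {i. i < n} \<rightarrow> carrier R" "g \<in> {i. i < n} \<rightarrow> carrier R" for f g
  proof -
    have "comb (\<lambda>i. f i \<oplus>\<^bsub>R\<^esub> g i) = (\<Oplus>\<^bsub>M\<^esub>i\<in>{i. i < n}. s i \<bullet>\<^bsub>M\<^esub> f i \<oplus>\<^bsub>M\<^esub> s i \<bullet>\<^bsub>M\<^esub> g i)"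
      unfolding comb_def
      by (rule finsum_cong') (use that in \<open>auto simp: Pi_def sM act_closed act_add_right\<close>)
    also have "\<dots> = comb f \<oplus>\<^bsub>M\<^esub> comb g"
      unfolding comb_def
      by (rule finsum_addf) (use that in \<open>auto simp: Pi_def sM act_closed\<close>)
    finally show ?thesis .
  qed
  have fin_act: "(\<Oplus>\<^bsub>M\<^esub>i\<in>I. h i) \<bullet>\<^bsub>M\<^esub> a = (\<Oplus>\<^bsub>M\<^esub>i\<in>I. h i \<bullet>\<^bsub>M\<^esub> a)"
    if "finite I" "h \<in> I \<rightarrow> carrier M" "a \<in> carrier R" for I :: "nat set" and h a
    using that
    by (induction I rule: finite_induct) (auto simp: zact act_add_left act_closed Pi_def)
  have comb_act: "comb (\<lambda>i. f i \<otimes>\<^bsub>R\<^esub> a) = comb f \<bullet>\<^bsub>M\<^esub> a"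
    if "f \<in> {i. i < n} \<rightarrow> carrier R" "a \<in> carrier R" for f a
  proof -
    have "comb f \<bullet>\<^bsub>M\<^esub> a = (\<Oplus>\<^bsub>M\<^esub>i\<in>{i. i < n}. (s i \<bullet>\<^bsub>M\<^esub> f i) \<bullet>\<^bsub>M\<^esub> a)"
      unfolding comb_def by (rule fin_act) (use that in \<open>auto simp: Pi_def sM act_closed\<close>)
    also have "\<dots> = comb (\<lambda>i. f i \<otimes>\<^bsub>R\<^esub> a)"
      unfolding comb_def
      by (rule finsum_cong') (use that in \<open>auto simp: Pi_def sM act_closed act_assoc\<close>)
    finally show ?thesis by simp
  qed
  have comb_closed: "comb f \<in> carrier M" if "f \<in> {i. i < n} \<rightarrow> carrier R" for f
    unfolding comb_def by (rule finsum_closed) (use that in \<open>auto simp: Pi_def sM act_closed\<close>)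
  have comb0: "comb (\<lambda>i. \<zero>\<^bsub>R\<^esub>) = \<zero>\<^bsub>M\<^esub>"
  proof -
    have "comb (\<lambda>i. \<zero>\<^bsub>R\<^esub>) = (\<Oplus>\<^bsub>M\<^esub>i\<in>{i. i < n}. \<zero>\<^bsub>M\<^esub>)"
      unfolding comb_def by (rule finsum_cong') (auto simp: sM act0)
    then show ?thesis by simp
  qed
  have "s j \<in> N" if "j < n" for j
  proof -
    have "comb (\<lambda>i. if i = j then \<one>\<^bsub>R\<^esub> else \<zero>\<^bsub>R\<^esub>)
        = (\<Oplus>\<^bsub>M\<^esub>i\<in>{i. i < n}. if j = i then s i else \<zero>\<^bsub>M\<^esub>)"
      unfolding comb_def by (rule finsum_cong') (auto simp: Pi_def sM act0 act_one)
    also have "\<dots> = s j"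
      using finsum_singleton[of j "{i. i < n}" s] that by (auto simp: Pi_def sM)
    finally have "s j = comb (\<lambda>i. if i = j then \<one>\<^bsub>R\<^esub> else \<zero>\<^bsub>R\<^esub>)" by (rule sym)
    then show ?thesis unfolding N_def by (rule image_eqI[where f = comb]) simp
  qed
  then have SN: "S \<subseteq> N" using s by auto
  have NM: "N \<subseteq> carrier M" using comb_closed unfolding N_def by blast
  have Nadd: "x \<oplus>\<^bsub>M\<^esub> y \<in> N" if "x \<in> N" "y \<in> N" for x y
  proof -
    from that(1) obtain f where f: "x = comb f" "f \<in> {i. i < n} \<rightarrow> carrier R"
      unfolding N_def by (rule imageE)
    from that(2) obtain g where g: "y = comb g" "g \<in> {i. i < n} \<rightarrow> carrier R"
      unfolding N_def by (rule imageE)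
    have "x \<oplus>\<^bsub>M\<^esub> y = comb (\<lambda>i. f i \<oplus>\<^bsub>R\<^esub> g i)"
      unfolding f(1) g(1) by (rule comb_add[OF f(2) g(2), symmetric])
    moreover have "(\<lambda>i. f i \<oplus>\<^bsub>R\<^esub> g i) \<in> {i. i < n} \<rightarrow> carrier R"
      using f(2) g(2) by (auto simp: Pi_def)
    ultimately show ?thesis unfolding N_def by (rule image_eqI[where f = comb])
  qed
  have Nact: "x \<bullet>\<^bsub>M\<^esub> a \<in> N" if "x \<in> N" "a \<in> carrier R" for x a
  proof -
    from that(1) obtain f where f: "x = comb f" "f \<in> {i. i < n} \<rightarrow> carrier R"
      unfolding N_def by (rule imageE)
    have "x \<bullet>\<^bsub>M\<^esub> a = comb (\<lambda>i. f i \<otimes>\<^bsub>R\<^esub> a)"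
      unfolding f(1) by (rule comb_act[OF f(2) that(2), symmetric])
    moreover have "(\<lambda>i. f i \<otimes>\<^bsub>R\<^esub> a) \<in> {i. i < n} \<rightarrow> carrier R"
      using f(2) that(2) by (auto simp: Pi_def)
    ultimately show ?thesis unfolding N_def by (rule image_eqI[where f = comb])
  qed
  have inv: "\<ominus>\<^bsub>M\<^esub> x = x \<bullet>\<^bsub>M\<^esub> (\<ominus>\<^bsub>R\<^esub> \<one>\<^bsub>R\<^esub>)" if "x \<in> carrier M" for x
  proof -
    have "x \<oplus>\<^bsub>M\<^esub> x \<bullet>\<^bsub>M\<^esub> (\<ominus>\<^bsub>R\<^esub> \<one>\<^bsub>R\<^esub>) = \<zero>\<^bsub>M\<^esub>"
      using act_add_right[OF that, of "\<one>\<^bsub>R\<^esub>" "\<ominus>\<^bsub>R\<^esub> \<one>\<^bsub>R\<^esub>"] that by (simp add: act_one R.r_neg act0)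
    then show ?thesis using that act_closed[OF that]
      by (intro minus_equality) (simp_all add: a_comm)
  qed
  have "additive_subgroup N M"
  proof (rule additive_subgroup.intro, rule subgroup.intro)
    show "N \<subseteq> carrier (add_monoid M)" using NM by simp
    show "x \<otimes>\<^bsub>add_monoid M\<^esub> y \<in> N" if "x \<in> N" "y \<in> N" for x y using Nadd that by simp
    show "\<one>\<^bsub>add_monoid M\<^esub> \<in> N" 
      unfolding N_def by (rule image_eqI[where f = comb, of _ "\<lambda>i. \<zero>\<^bsub>R\<^esub>"]) (simp_all add: comb0)
    show "inv\<^bsub>add_monoid M\<^esub> x \<in> N" if "x \<in> N" for x
    proof -
      have "\<ominus>\<^bsub>M\<^esub> x \<in> N" using inv[of x] Nact[OF that, of "\<ominus>\<^bsub>R\<^esub> \<one>\<^bsub>R\<^esub>"] NM that by auto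
      then show ?thesis by (simp only: a_inv_def)
    qed
  qed
  then have "rsubmodule R N M" using Nact by (auto simp: rsubmodule_def)
  then have N: "N = carrier M" using S(3) SN by blast
  define e :: "'b \<Rightarrow> (nat \<Rightarrow> 'a) set" where "e x = {f \<in> {i. i < n} \<rightarrow> carrier R. comb f = x}" for x
  have "inj_on e (carrier M)"
  proof (rule inj_onI)
    fix x y assume x: "x \<in> carrier M" and "y \<in> carrier M" and eq: "e x = e y"
    from x obtain f where f: "x = comb f" "f \<in> {i. i < n} \<rightarrow> carrier R"
      unfolding N[symmetric] N_def by (rule imageE)
    then have "f \<in> e x" by (simp only: e_def mem_Collect_eq)
    then have "f \<in> e y" by (simp only: eq)
    then show "x = y" using f(1) by (simp only: e_def mem_Collect_eq)
  qed
  note e = this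
  define d where "d = inv_into (carrier M) e"
  define M' :: "'a umodule" where "M' = \<lparr>carrier = e ` carrier M, mult = undefined, one = undefined,
      zero = e \<zero>\<^bsub>M\<^esub>, add = (\<lambda>x y. e (d x \<oplus>\<^bsub>M\<^esub> d y)), act = (\<lambda>x a. e (d x \<bullet>\<^bsub>M\<^esub> a))\<rparr>"
  have de: "d (e x) = x" if "x \<in> carrier M" for x using e that by (simp add: d_def)
  have car: "carrier M' = e ` carrier M" and zer: "\<zero>\<^bsub>M'\<^esub> = e \<zero>\<^bsub>M\<^esub>" by (simp_all add: M'_def)
  have add: "e x \<oplus>\<^bsub>M'\<^esub> e y = e (x \<oplus>\<^bsub>M\<^esub> y)" if "x \<in> carrier M" "y \<in> carrier M" for x y
    using that by (simp add: M'_def de)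
  have act: "e x \<bullet>\<^bsub>M'\<^esub> a = e (x \<bullet>\<^bsub>M\<^esub> a)" if "x \<in> carrier M" for x a
    using that by (simp add: M'_def de)
  have ab: "abelian_group M'"
  proof (rule abelian_groupI; (unfold car zer)?; (elim imageE)?; hypsubst?)
    fix x assume x: "x \<in> carrier M"
    show "\<exists>y\<in>e ` carrier M. y \<oplus>\<^bsub>M'\<^esub> e x = e \<zero>\<^bsub>M\<^esub>"
      by (rule bexI[of _ "e (\<ominus>\<^bsub>M\<^esub> x)"]) (use x in \<open>simp_all add: add l_neg\<close>)
  qed (simp_all add: add a_assoc, simp_all add: a_comm)
  have rm: "right_module R M'"
  proof (rule right_module.intro[OF R.ring_axioms ab], rule right_module_axioms.intro;
      (unfold car zer)?; (elim imageE)?; hypsubst?)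
  qed (simp_all add: add act act_closed act_add_left act_add_right act_assoc act_one)
  have iso: "rmodule_iso R M M'"
    unfolding rmodule_iso_def
  proof (rule bexI[of _ e])
    show "bij_betw e (carrier M) (carrier M')" using e by (simp add: bij_betw_def car)
    show "e \<in> rmodule_hom R M M'" by (simp add: rmodule_hom_def car add act)
  qed
  have "K = carrier M'" if K: "rsubmodule R K M'" "e ` S \<subseteq> K" for K
  proof -
    interpret K: additive_subgroup K M' using K by (simp add: rsubmodule_def)
    define L where "L = {x \<in> carrier M. e x \<in> K}"
    have Ladd: "x \<oplus>\<^bsub>M\<^esub> y \<in> L" if "x \<in> L" "y \<in> L" for x y
      using that K.a_closed[of "e x" "e y"] by (simp add: L_def add)
    have Lact: "x \<bullet>\<^bsub>M\<^esub> a \<in> L" if "x \<in> L" "a \<in> carrier R" for x a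
    proof -
      have "e x \<bullet>\<^bsub>M'\<^esub> a \<in> K" using that K(1) by (simp add: L_def rsubmodule_def)
      then show ?thesis using that by (simp add: L_def act act_closed)
    qed
    have "additive_subgroup L M"
    proof (rule additive_subgroup.intro, rule subgroup.intro)
      show "L \<subseteq> carrier (add_monoid M)" by (auto simp: L_def)
      show "x \<otimes>\<^bsub>add_monoid M\<^esub> y \<in> L" if "x \<in> L" "y \<in> L" for x y using Ladd that by simp
      show "\<one>\<^bsub>add_monoid M\<^esub> \<in> L" using K.zero_closed by (simp add: L_def zer)
      show "inv\<^bsub>add_monoid M\<^esub> x \<in> L" if "x \<in> L" for x
      proof -
        have "x \<in> carrier M" using that by (simp add: L_def)
        then have "\<ominus>\<^bsub>M\<^esub> x \<in> L" using inv[of x] Lact[OF that, of "\<ominus>\<^bsub>R\<^esub> \<one>\<^bsub>R\<^esub>"] by simp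
        then show ?thesis by (simp only: a_inv_def)
      qed
    qed
    then have "rsubmodule R L M" using Lact by (auto simp: rsubmodule_def)
    moreover have "S \<subseteq> L" using K(2) S(2) by (auto simp: L_def)
    ultimately have "L = carrier M" using S(3) by blast
    then show ?thesis using K.a_subset by (auto simp: L_def car)
  qed
  then have "fg_module R M'"
    unfolding fg_module_def using rm S(1,2)
    by (intro conjI exI[of _ "e ` S"]) (auto simp: car)
  then show ?thesis using iso by blast
qed

text \<open>Projective covers are unique only up to isomorphism, so the syzygy is rendered as a relation:
  \<open>syzygy R d X Y\<close> says that \<open>Y\<close> is a \<open>d\<close>-th syzygy of \<open>X\<close>, for some choice of the covers.\<close>

inductive syzygy ::
  "('a, 'c) ring_scheme \<Rightarrow> nat \<Rightarrow> 'a umodule \<Rightarrow> 'a umodule \<Rightarrow> bool"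
  for R :: "('a, 'c) ring_scheme" where
  syzygy_0: "syzygy R 0 X X"
| syzygy_Suc: "\<lbrakk>syzygy R d X Y; projective_cover R P p Y\<rbrakk>
    \<Longrightarrow> syzygy R (Suc d) X (restrict_module P (a_kernel P Y p))"

definition deloopable :: "('a, 'c) ring_scheme \<Rightarrow> 'a umodule \<Rightarrow> nat \<Rightarrow> bool" where
  "deloopable R X d \<longleftrightarrow>
     (\<exists>Y (P :: 'a umodule) M Z. syzygy R d X Y \<and> fg_projective R P \<and> fg_module R M \<and>
        syzygy R (Suc d) M Z \<and> iso_summand R Y (rmodule_sum P Z))"

text \<open>The infimum of the empty set is \<open>\<infinity>\<close>.\<close>

definition del_module :: "('a, 'c) ring_scheme \<Rightarrow> 'a umodule \<Rightarrow> enat" where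
  "del_module R X = Inf {enat d | d. deloopable R X d}"

text \<open>Over an Artin algebra there are finitely many simple modules up to isomorphism, so the
  supremum is a maximum (and \<open>0\<close> for the zero ring, which has no simple modules).\<close>

definition del :: "('a, 'c) ring_scheme \<Rightarrow> enat" where
  "del R = Sup {del_module R S | S. simple_module R S}"

end

theory Submission
  imports Defs
begin

text \<open>
  Write \<open>S = A/rad(A)\<close> and view a right \<open>\<Lambda>\<close>-module as a triple consisting of an \<open>A\<close>-module \<open>X\<close>, a
  \<open>B\<close>-module \<open>Y\<close> and a map \<open>X \<otimes> S \<rightarrow> Y\<close>. If \<open>P \<rightarrow> X\<close> is a projective cover over \<open>A\<close> with kernel \<open>K\<close>,
  then \<open>(P, P/rad P)\<close> is a projective cover of \<open>(X, 0)\<close>. Its kernel is \<open>(K, 0) \<oplus> (0, P/rad P)\<close>, because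
  \<open>K\<close> lies in \<open>rad P\<close>. As \<open>B = S[x]/(x\<^sup>2)\<close>, an \<open>S\<close>-module \<open>W\<close> is its own syzygy over \<open>B\<close>. Hence the
  \<open>d\<close>-th syzygy of \<open>(X, 0)\<close> is the one of \<open>X\<close> over \<open>A\<close> plus some \<open>(0, W)\<close>. This gives the upper bound; the
  additional syzygy removes the projective \<open>A\<close>-summand in the definition of the delooping level, which
  is not projective over \<open>\<Lambda>\<close>. The lower bound holds since multiplication with the idempotent of \<open>A\<close>
  preserves projective covers. For left modules, the projective \<open>\<Lambda> e\<close> with \<open>e\<close> the unit of \<open>B\<close> covers
  \<open>(0, S)\<close>, and all simple left modules are direct summands of the kernel \<open>(S, 0) \<oplus> (0, S)\<close>.
\<close>

section \<open>Modules, submodules and homomorphisms\<close>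

text \<open>\<open>syzygy\<close> is a relation, so every claim of deloopability needs actual
  covers. Over \<open>A\<close> the additional syzygy rests on their existence, which is derived
  from the chain conditions that finitely generated modules inherit from the base ring. Over
  \<Lambda> the covers are written down explicitly for the upper bound; for the lower bound they are
  given and cut down to the corner of \<open>A\<close>. The obstacle in the upper bound is the
  summand (0, W) in the syzygies of (X, 0): it must also occur in a syzygy of the delooping module.
  It is planted there beforehand, by passing from M to (M, W) over \<Lambda>, and it survives every
  step because W is its own syzygy over B. A simple right \<Lambda>-module that does not come from
  \<open>A\<close> is a simple S-module; it is a summand of S, which is the kernel of the cover of S
  by B, and so its delooping level is 0. The definitions quantify over modules on one carrier type,
  whereas the constructions live on products and functions. Covers are therefore transported along
  isomorphisms before they count as syzygies.\<close>

lemma (in abelian_group) diff_eq_zero_iff: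
  assumes "x \<in> carrier G" "y \<in> carrier G"
  shows "x \<ominus> y = \<zero> \<longleftrightarrow> x = y"
  using assms minus_equality[of x "\<ominus> y"] by (auto simp: a_minus_def r_neg)

lemma (in right_module) act_zero [simp]: "x \<in> carrier M \<Longrightarrow> x \<bullet> \<zero>\<^bsub>R\<^esub> = \<zero>"
  using act_add_right[of x "\<zero>\<^bsub>R\<^esub>" "\<zero>\<^bsub>R\<^esub>"] act_closed[of x "\<zero>\<^bsub>R\<^esub>"]
  by (metis R.l_zero R.zero_closed add.r_cancel_one')

lemma (in right_module) zero_act [simp]: "a \<in> carrier R \<Longrightarrow> \<zero> \<bullet> a = \<zero>"
  using act_add_left[OF zero_closed zero_closed] act_closed[OF zero_closed]
  by (metis l_zero zero_closed add.r_cancel_one')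

lemma (in right_module) act_minus_one:
  assumes "x \<in> carrier M"
  shows "x \<bullet> (\<ominus>\<^bsub>R\<^esub> \<one>\<^bsub>R\<^esub>) = \<ominus> x"
proof -
  have "x \<oplus> x \<bullet> (\<ominus>\<^bsub>R\<^esub> \<one>\<^bsub>R\<^esub>) = \<zero>"
    using act_add_right[OF assms, of "\<one>\<^bsub>R\<^esub>" "\<ominus>\<^bsub>R\<^esub> \<one>\<^bsub>R\<^esub>"] assms by (simp add: act_one R.r_neg)
  then show ?thesis using assms act_closed
    by (intro minus_equality[symmetric]) (simp_all add: a_comm)
qed

lemma (in right_module) act_neg_right:
  assumes "x \<in> carrier M" "a \<in> carrier R"
  shows "x \<bullet> (\<ominus>\<^bsub>R\<^esub> a) = \<ominus> (x \<bullet> a)"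
proof -
  have "\<ominus>\<^bsub>R\<^esub> a = a \<otimes>\<^bsub>R\<^esub> (\<ominus>\<^bsub>R\<^esub> \<one>\<^bsub>R\<^esub>)" using assms by (simp add: R.r_minus)
  then show ?thesis using assms by (simp add: act_assoc act_minus_one act_closed)
qed

lemma (in right_module) act_neg_left:
  assumes "x \<in> carrier M" "a \<in> carrier R"
  shows "(\<ominus> x) \<bullet> a = \<ominus> (x \<bullet> a)"
  using act_add_left[of x "\<ominus> x" a] assms act_closed
  by (metis a_comm minus_equality a_inv_closed r_neg zero_act)

lemma (in right_module) finsum_act:
  assumes "finite I" "h \<in> I \<rightarrow> carrier M" "a \<in> carrier R"
  shows "(\<Oplus>i\<in>I. h i) \<bullet> a = (\<Oplus>i\<in>I. h i \<bullet> a)"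
  using assms by (induction I rule: finite_induct) (auto simp: act_add_left act_closed Pi_def)

text \<open>Closure under negation is automatic, since the negative of an element is its product
  with the scalar -1.\<close>

lemma (in right_module) rsubmoduleI:
  assumes "N \<subseteq> carrier M" "\<zero> \<in> N" "\<And>x y. x \<in> N \<Longrightarrow> y \<in> N \<Longrightarrow> x \<oplus> y \<in> N"
    and act: "\<And>x a. x \<in> N \<Longrightarrow> a \<in> carrier R \<Longrightarrow> x \<bullet> a \<in> N"
  shows "rsubmodule R N M"
proof -
  have "inv\<^bsub>add_monoid M\<^esub> x \<in> N" if "x \<in> N" for x
  proof -
    have "\<ominus> x \<in> N" using act[OF that, of "\<ominus>\<^bsub>R\<^esub> \<one>\<^bsub>R\<^esub>"] act_minus_one[of x] assms(1) that by auto
    then show ?thesis by (simp only: a_inv_def)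
  qed
  then have "additive_subgroup N M"
    using assms by (intro additive_subgroup.intro subgroup.intro) auto
  then show ?thesis using act by (auto simp: rsubmodule_def)
qed

context
  fixes R :: "('a, 'c) ring_scheme" and N :: "'b set" and M :: "('a, 'b) rmodule"
  assumes N: "rsubmodule R N M"
begin

interpretation additive_subgroup N M using N by (simp add: rsubmodule_def)

lemma rsub_subset: "N \<subseteq> carrier M" by (rule a_subset)
lemma rsub_in: "x \<in> N \<Longrightarrow> x \<in> carrier M" using a_subset by blast
lemma rsub_zero: "\<zero>\<^bsub>M\<^esub> \<in> N" by (rule zero_closed)
lemma rsub_add: "x \<in> N \<Longrightarrow> y \<in> N \<Longrightarrow> x \<oplus>\<^bsub>M\<^esub> y \<in> N" by (rule a_closed)
lemma rsub_act: "x \<in> N \<Longrightarrow> a \<in> carrier R \<Longrightarrow> x \<bullet>\<^bsub>M\<^esub> a \<in> N" using N by (simp add: rsubmodule_def)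

end

lemma (in right_module) rsub_neg:
  assumes "rsubmodule R N M" "x \<in> N"
  shows "\<ominus> x \<in> N"
  using rsub_act[OF assms, of "\<ominus>\<^bsub>R\<^esub> \<one>\<^bsub>R\<^esub>"] act_minus_one rsub_in[OF assms] by simp

lemma (in right_module) rsub_diff:
  assumes "rsubmodule R N M" "x \<in> N" "y \<in> N"
  shows "x \<ominus> y \<in> N"
  using rsub_add[OF assms(1,2) rsub_neg[OF assms(1,3)]] by (simp add: a_minus_def)

lemma (in right_module) rsub_finsum:
  assumes "rsubmodule R N M" "finite I" "h \<in> I \<rightarrow> N"
  shows "(\<Oplus>i\<in>I. h i) \<in> N"
proof -
  have *: "h i \<in> carrier M" if "i \<in> I" for i using assms rsub_in that by (metis Pi_iff)
  show ?thesis using assms(2,3) *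
    by (induction I rule: finite_induct) (auto simp: rsub_zero[OF assms(1)] rsub_add[OF assms(1)] Pi_def)
qed

lemma (in right_module) rsub_add_cancel:
  assumes "rsubmodule R N M" "x \<oplus> y \<in> N" "x \<in> carrier M" "y \<in> N"
  shows "x \<in> N"
proof -
  have "y \<in> carrier M" using rsub_in[OF assms(1,4)] .
  then have "x = (x \<oplus> y) \<ominus> y" using assms by (simp add: a_minus_def a_assoc r_neg)
  then show ?thesis using rsub_diff[OF assms(1,2,4)] by simp
qed

lemma (in right_module) rsub_carrier: "rsubmodule R (carrier M) M"
  by (rule rsubmoduleI) (auto simp: act_closed)

lemma (in right_module) rsub_triv: "rsubmodule R {\<zero>} M"
  by (rule rsubmoduleI) auto

lemma mem_set_add: "x \<in> N <+>\<^bsub>M\<^esub> K \<longleftrightarrow> (\<exists>n\<in>N. \<exists>k\<in>K. x = n \<oplus>\<^bsub>M\<^esub> k)"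
  by (auto simp: set_add_def')

lemma (in right_module) rsub_set_add:
  assumes N: "rsubmodule R N M" and K: "rsubmodule R K M"
  shows "rsubmodule R (N <+>\<^bsub>M\<^esub> K) M"
proof (rule rsubmoduleI)
  show "N <+>\<^bsub>M\<^esub> K \<subseteq> carrier M" using rsub_in[OF N] rsub_in[OF K] by (auto simp: mem_set_add)
  show "\<zero> \<in> N <+>\<^bsub>M\<^esub> K" using rsub_zero[OF N] rsub_zero[OF K]
    by (force simp: mem_set_add)
  show "x \<oplus> y \<in> N <+>\<^bsub>M\<^esub> K" if xy: "x \<in> N <+>\<^bsub>M\<^esub> K" "y \<in> N <+>\<^bsub>M\<^esub> K" for x y
  proof -
    obtain n k n' k' where *: "n \<in> N" "k \<in> K" "n' \<in> N" "k' \<in> K" "x = n \<oplus> k" "y = n' \<oplus> k'"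
      using xy unfolding mem_set_add by blast
    then have "x \<oplus> y = (n \<oplus> n') \<oplus> (k \<oplus> k')"
      using rsub_in[OF N] rsub_in[OF K] by (simp add: a_ac)
    then show ?thesis using * rsub_add[OF N] rsub_add[OF K] unfolding mem_set_add by blast
  qed
  show "x \<bullet> a \<in> N <+>\<^bsub>M\<^esub> K" if "x \<in> N <+>\<^bsub>M\<^esub> K" "a \<in> carrier R" for x a
    using that rsub_in[OF N] rsub_in[OF K] rsub_act[OF N] rsub_act[OF K]
    by (force simp: mem_set_add act_add_left)
qed

lemma (in right_module) rsub_Int:
  assumes N: "rsubmodule R N M" and K: "rsubmodule R K M"
  shows "rsubmodule R (N \<inter> K) M"
  using rsub_in[OF N] rsub_zero[OF N] rsub_zero[OF K] rsub_add[OF N] rsub_add[OF K]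
    rsub_act[OF N] rsub_act[OF K]
  by (intro rsubmoduleI) auto

lemma (in right_module) rsub_cyclic:
  assumes x: "x \<in> carrier M"
  shows "rsubmodule R ((\<lambda>a. x \<bullet> a) ` carrier R) M"
proof (rule rsubmoduleI)
  show "\<zero> \<in> (\<lambda>a. x \<bullet> a) ` carrier R" using x by (intro image_eqI[of _ _ "\<zero>\<^bsub>R\<^esub>"]) auto
qed (use x act_closed in \<open>auto simp flip: act_add_right act_assoc\<close>)

lemma (in right_module) cyclic_self: "x \<in> carrier M \<Longrightarrow> x \<in> (\<lambda>a. x \<bullet> a) ` carrier R"
  by (intro image_eqI[of _ _ "\<one>\<^bsub>R\<^esub>"]) (auto simp: act_one)

lemma restrict_module_simps [simp]:
  "carrier (restrict_module M N) = N" "\<zero>\<^bsub>restrict_module M N\<^esub> = \<zero>\<^bsub>M\<^esub>"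
  "x \<oplus>\<^bsub>restrict_module M N\<^esub> y = x \<oplus>\<^bsub>M\<^esub> y" "x \<bullet>\<^bsub>restrict_module M N\<^esub> a = x \<bullet>\<^bsub>M\<^esub> a"
  by (simp_all add: restrict_module_def)

lemma right_moduleI:
  assumes "ring R" "\<zero>\<^bsub>M\<^esub> \<in> carrier M"
    "\<And>x y. x \<in> carrier M \<Longrightarrow> y \<in> carrier M \<Longrightarrow> x \<oplus>\<^bsub>M\<^esub> y \<in> carrier M"
    "\<And>x y z. x \<in> carrier M \<Longrightarrow> y \<in> carrier M \<Longrightarrow> z \<in> carrier M \<Longrightarrow>
      (x \<oplus>\<^bsub>M\<^esub> y) \<oplus>\<^bsub>M\<^esub> z = x \<oplus>\<^bsub>M\<^esub> (y \<oplus>\<^bsub>M\<^esub> z)"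
    "\<And>x y. x \<in> carrier M \<Longrightarrow> y \<in> carrier M \<Longrightarrow> x \<oplus>\<^bsub>M\<^esub> y = y \<oplus>\<^bsub>M\<^esub> x"
    "\<And>x. x \<in> carrier M \<Longrightarrow> \<zero>\<^bsub>M\<^esub> \<oplus>\<^bsub>M\<^esub> x = x"
    "\<And>x. x \<in> carrier M \<Longrightarrow> \<exists>y\<in>carrier M. y \<oplus>\<^bsub>M\<^esub> x = \<zero>\<^bsub>M\<^esub>"
    "\<And>x a. x \<in> carrier M \<Longrightarrow> a \<in> carrier R \<Longrightarrow> x \<bullet>\<^bsub>M\<^esub> a \<in> carrier M"
    "\<And>x y a. x \<in> carrier M \<Longrightarrow> y \<in> carrier M \<Longrightarrow> a \<in> carrier R \<Longrightarrow>
      (x \<oplus>\<^bsub>M\<^esub> y) \<bullet>\<^bsub>M\<^esub> a = x \<bullet>\<^bsub>M\<^esub> a \<oplus>\<^bsub>M\<^esub> y \<bullet>\<^bsub>M\<^esub> a"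
    "\<And>x a b. x \<in> carrier M \<Longrightarrow> a \<in> carrier R \<Longrightarrow> b \<in> carrier R \<Longrightarrow>
      x \<bullet>\<^bsub>M\<^esub> (a \<oplus>\<^bsub>R\<^esub> b) = x \<bullet>\<^bsub>M\<^esub> a \<oplus>\<^bsub>M\<^esub> x \<bullet>\<^bsub>M\<^esub> b"
    "\<And>x a b. x \<in> carrier M \<Longrightarrow> a \<in> carrier R \<Longrightarrow> b \<in> carrier R \<Longrightarrow>
      x \<bullet>\<^bsub>M\<^esub> (a \<otimes>\<^bsub>R\<^esub> b) = (x \<bullet>\<^bsub>M\<^esub> a) \<bullet>\<^bsub>M\<^esub> b"
    "\<And>x. x \<in> carrier M \<Longrightarrow> x \<bullet>\<^bsub>M\<^esub> \<one>\<^bsub>R\<^esub> = x"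
  shows "right_module R M"
  using assms by (intro right_module.intro right_module_axioms.intro abelian_groupI) simp_all

lemma (in right_module) right_module_restrict:
  assumes "rsubmodule R N M"
  shows "right_module R (restrict_module M N)"
proof (rule right_moduleI)
  show "\<exists>y\<in>carrier (restrict_module M N). y \<oplus>\<^bsub>restrict_module M N\<^esub> x = \<zero>\<^bsub>restrict_module M N\<^esub>"
    if "x \<in> carrier (restrict_module M N)" for x
    using that rsub_neg[OF assms, of x] rsub_in[OF assms] by (auto simp: l_neg intro!: bexI[of _ "\<ominus> x"])
qed (use rsub_in[OF assms] rsub_zero[OF assms] rsub_add[OF assms] rsub_act[OF assms] in
  \<open>auto simp: R.ring_axioms a_ac act_add_left act_add_right act_assoc act_one\<close>)

lemma (in right_module) rsub_restrict_iff:
  assumes "rsubmodule R N M"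
  shows "rsubmodule R K (restrict_module M N) \<longleftrightarrow> rsubmodule R K M \<and> K \<subseteq> N"
proof
  interpret N: right_module R "restrict_module M N" by (rule right_module_restrict[OF assms])
  show "rsubmodule R K M \<and> K \<subseteq> N" if "rsubmodule R K (restrict_module M N)"
    using that rsub_subset[OF that] rsub_zero[OF that] rsub_add[OF that] rsub_act[OF that]
      rsub_subset[OF assms]
    by (auto intro!: rsubmoduleI)
  show "rsubmodule R K (restrict_module M N)" if K: "rsubmodule R K M \<and> K \<subseteq> N"
    using K rsub_zero[of R K M] rsub_add[of R K M] rsub_act[of R K M]
    by (auto intro!: N.rsubmoduleI)
qed

lemma rmodule_homI:
  assumes "\<And>x. x \<in> carrier M \<Longrightarrow> f x \<in> carrier N"
    "\<And>x y. x \<in> carrier M \<Longrightarrow> y \<in> carrier M \<Longrightarrow> f (x \<oplus>\<^bsub>M\<^esub> y) = f x \<oplus>\<^bsub>N\<^esub> f y"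
    "\<And>x a. x \<in> carrier M \<Longrightarrow> a \<in> carrier R \<Longrightarrow> f (x \<bullet>\<^bsub>M\<^esub> a) = f x \<bullet>\<^bsub>N\<^esub> a"
  shows "f \<in> rmodule_hom R M N"
  using assms by (auto simp: rmodule_hom_def)

context
  fixes R :: "('a, 'c) ring_scheme" and M :: "('a, 'b) rmodule" and N :: "('a, 'd) rmodule" and f
  assumes f: "f \<in> rmodule_hom R M N"
begin

lemma hom_closed: "x \<in> carrier M \<Longrightarrow> f x \<in> carrier N" using f by (auto simp: rmodule_hom_def)
lemma hom_add: "x \<in> carrier M \<Longrightarrow> y \<in> carrier M \<Longrightarrow> f (x \<oplus>\<^bsub>M\<^esub> y) = f x \<oplus>\<^bsub>N\<^esub> f y"
  using f by (auto simp: rmodule_hom_def)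
lemma hom_act: "x \<in> carrier M \<Longrightarrow> a \<in> carrier R \<Longrightarrow> f (x \<bullet>\<^bsub>M\<^esub> a) = f x \<bullet>\<^bsub>N\<^esub> a"
  using f by (auto simp: rmodule_hom_def)

end

lemma additive_zero:
  assumes "abelian_group M" "abelian_group N" "f \<in> carrier M \<rightarrow> carrier N"
    and "\<And>x y. x \<in> carrier M \<Longrightarrow> y \<in> carrier M \<Longrightarrow> f (x \<oplus>\<^bsub>M\<^esub> y) = f x \<oplus>\<^bsub>N\<^esub> f y"
  shows "f \<zero>\<^bsub>M\<^esub> = \<zero>\<^bsub>N\<^esub>"
proof -
  interpret M: abelian_group M by fact
  interpret N: abelian_group N by fact
  have "f \<zero>\<^bsub>M\<^esub> \<in> carrier N" using assms(3) by auto
  then show ?thesis using assms(4)[of "\<zero>\<^bsub>M\<^esub>" "\<zero>\<^bsub>M\<^esub>"]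
    by (metis M.l_zero M.zero_closed N.add.r_cancel_one')
qed

lemma additive_neg:
  assumes "abelian_group M" "abelian_group N" "f \<in> carrier M \<rightarrow> carrier N"
    and "\<And>x y. x \<in> carrier M \<Longrightarrow> y \<in> carrier M \<Longrightarrow> f (x \<oplus>\<^bsub>M\<^esub> y) = f x \<oplus>\<^bsub>N\<^esub> f y"
    and x: "x \<in> carrier M"
  shows "f (\<ominus>\<^bsub>M\<^esub> x) = \<ominus>\<^bsub>N\<^esub> f x"
proof -
  interpret M: abelian_group M by fact
  interpret N: abelian_group N by fact
  have "f (\<ominus>\<^bsub>M\<^esub> x) \<oplus>\<^bsub>N\<^esub> f x = \<zero>\<^bsub>N\<^esub>"
    using assms(4)[of "\<ominus>\<^bsub>M\<^esub> x" x] x additive_zero[OF assms(1-4)] by (simp add: M.l_neg)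
  then show ?thesis using x assms(3) by (intro N.minus_equality[symmetric]) auto
qed

text \<open>Stated for additive maps between groups, because it is also applied when the two sides
  are modules over different rings, as for the projections of \<open>double W\<close> and the map
  onto the top of a projective module, or when the target is the ring itself.\<close>

lemma additive_finsum:
  assumes "abelian_group M" "abelian_group N" "f \<in> carrier M \<rightarrow> carrier N"
    and "\<And>x y. x \<in> carrier M \<Longrightarrow> y \<in> carrier M \<Longrightarrow> f (x \<oplus>\<^bsub>M\<^esub> y) = f x \<oplus>\<^bsub>N\<^esub> f y"
    and "finite I" "h \<in> I \<rightarrow> carrier M"
  shows "f (\<Oplus>\<^bsub>M\<^esub>i\<in>I. h i) = (\<Oplus>\<^bsub>N\<^esub>i\<in>I. f (h i))"
proof -
  interpret M: abelian_group M by fact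
  interpret N: abelian_group N by fact
  show ?thesis using assms(5,6)
  proof (induction I rule: finite_induct)
    case empty
    then show ?case using additive_zero[OF assms(1-4)] by simp
  next
    case (insert i I)
    then have "h \<in> I \<rightarrow> carrier M" "h i \<in> carrier M" "f \<circ> h \<in> I \<rightarrow> carrier N"
      using assms(3) by auto
    then show ?case using insert assms(3) by (auto simp: assms(4) Pi_def)
  qed
qed

locale rmod_hom = M: right_module R M + N: right_module R N
  for R :: "('a, 'c) ring_scheme" and M :: "('a, 'b) rmodule" and N :: "('a, 'd) rmodule" +
  fixes f :: "'b \<Rightarrow> 'd"
  assumes hom: "f \<in> rmodule_hom R M N"
begin

lemmas closed [simp] = hom_closed[OF hom]
lemmas add [simp] = hom_add[OF hom]
lemmas act [simp] = hom_act[OF hom]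

lemma zero [simp]: "f \<zero>\<^bsub>M\<^esub> = \<zero>\<^bsub>N\<^esub>"
  by (rule additive_zero) (auto intro: M.abelian_group_axioms N.abelian_group_axioms)

lemma neg [simp]: "x \<in> carrier M \<Longrightarrow> f (\<ominus>\<^bsub>M\<^esub> x) = \<ominus>\<^bsub>N\<^esub> f x"
  by (rule additive_neg) (auto intro: M.abelian_group_axioms N.abelian_group_axioms)

lemma diff [simp]: "x \<in> carrier M \<Longrightarrow> y \<in> carrier M \<Longrightarrow> f (x \<ominus>\<^bsub>M\<^esub> y) = f x \<ominus>\<^bsub>N\<^esub> f y"
  by (simp add: a_minus_def)

lemma lincomb:
  assumes "finite I" "x \<in> I \<rightarrow> carrier M" "c \<in> I \<rightarrow> carrier R"
  shows "f (\<Oplus>\<^bsub>M\<^esub>i\<in>I. x i \<bullet>\<^bsub>M\<^esub> c i) = (\<Oplus>\<^bsub>N\<^esub>i\<in>I. f (x i) \<bullet>\<^bsub>N\<^esub> c i)"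
proof -
  have "f (\<Oplus>\<^bsub>M\<^esub>i\<in>I. x i \<bullet>\<^bsub>M\<^esub> c i) = (\<Oplus>\<^bsub>N\<^esub>i\<in>I. f (x i \<bullet>\<^bsub>M\<^esub> c i))"
    using assms
    by (intro additive_finsum M.abelian_group_axioms N.abelian_group_axioms) (auto simp: M.act_closed Pi_def)
  also have "\<dots> = (\<Oplus>\<^bsub>N\<^esub>i\<in>I. f (x i) \<bullet>\<^bsub>N\<^esub> c i)"
    using assms by (intro N.finsum_cong') (auto simp: N.act_closed Pi_def)
  finally show ?thesis .
qed

lemma rsub_image:
  assumes "rsubmodule R K M"
  shows "rsubmodule R (f ` K) N"
proof (rule N.rsubmoduleI)
  show "f ` K \<subseteq> carrier N" using rsub_in[OF assms] by auto
  show "\<zero>\<^bsub>N\<^esub> \<in> f ` K" using rsub_zero[OF assms] zero by (metis image_eqI)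
  show "x \<oplus>\<^bsub>N\<^esub> y \<in> f ` K" if "x \<in> f ` K" "y \<in> f ` K" for x y
    using that rsub_in[OF assms] rsub_add[OF assms] by (auto simp flip: add)
  show "x \<bullet>\<^bsub>N\<^esub> a \<in> f ` K" if "x \<in> f ` K" "a \<in> carrier R" for x a
    using that rsub_in[OF assms] rsub_act[OF assms] by (auto simp flip: act)
qed

lemma rsub_vimage:
  assumes "rsubmodule R K N"
  shows "rsubmodule R {x \<in> carrier M. f x \<in> K} M"
  using rsub_zero[OF assms] rsub_add[OF assms] rsub_act[OF assms]
  by (intro M.rsubmoduleI) (auto simp: M.act_closed)

lemma kernel_eq: "a_kernel M N f = {x \<in> carrier M. f x = \<zero>\<^bsub>N\<^esub>}"
  by (simp add: a_kernel_def')

lemma rsub_kernel: "rsubmodule R (a_kernel M N f) M"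
  using rsub_vimage[OF N.rsub_triv] by (simp add: kernel_eq)

end

lemma rmod_homI:
  assumes "right_module R M" "right_module R N" "f \<in> rmodule_hom R M N"
  shows "rmod_hom R M N f"
  using assms by (simp add: rmod_hom_def rmod_hom_axioms_def)

lemma hom_comp:
  assumes "f \<in> rmodule_hom R M N" "g \<in> rmodule_hom R N L"
  shows "(\<lambda>x. g (f x)) \<in> rmodule_hom R M L"
  using assms by (intro rmodule_homI) (simp_all add: hom_closed[OF assms(1)] hom_closed[OF assms(2)]
    hom_add[OF assms(1)] hom_add[OF assms(2)] hom_act[OF assms(1)] hom_act[OF assms(2)])

lemma hom_id: "(\<lambda>x. x) \<in> rmodule_hom R M M"
  by (intro rmodule_homI) auto

lemma hom_restrict_dom:
  assumes "f \<in> rmodule_hom R M N" "K \<subseteq> carrier M"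
  shows "f \<in> rmodule_hom R (restrict_module M K) N"
  using hom_closed[OF assms(1)] hom_add[OF assms(1)] hom_act[OF assms(1)] subsetD[OF assms(2)]
  by (intro rmodule_homI) simp_all

lemma hom_restrict_cod:
  assumes "f \<in> rmodule_hom R M N" "\<And>x. x \<in> carrier M \<Longrightarrow> f x \<in> K"
  shows "f \<in> rmodule_hom R M (restrict_module N K)"
  using assms hom_add[OF assms(1)] hom_act[OF assms(1)] by (intro rmodule_homI) auto

section \<open>Isomorphisms, retracts and direct sums\<close>

lemma rmodule_isoI:
  assumes "f \<in> rmodule_hom R M N" "\<And>y. y \<in> carrier N \<Longrightarrow> g y \<in> carrier M"
    "\<And>x. x \<in> carrier M \<Longrightarrow> g (f x) = x" "\<And>y. y \<in> carrier N \<Longrightarrow> f (g y) = y"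
  shows "rmodule_iso R M N"
  using assms hom_closed[OF assms(1)]
  by (auto simp: rmodule_iso_def intro!: bexI[of _ f] bij_betw_byWitness[where f' = g])

lemma rmodule_isoE:
  assumes "right_module R M" "rmodule_iso R M N"
  obtains f g where "f \<in> rmodule_hom R M N" "g \<in> rmodule_hom R N M"
    "\<And>x. x \<in> carrier M \<Longrightarrow> g (f x) = x" "\<And>y. y \<in> carrier N \<Longrightarrow> f (g y) = y"
proof -
  interpret M: right_module R M by fact
  obtain f where f: "f \<in> rmodule_hom R M N" and b: "bij_betw f (carrier M) (carrier N)"
    using assms by (auto simp: rmodule_iso_def)
  define g where "g = inv_into (carrier M) f"
  have gc: "g y \<in> carrier M" and fg: "f (g y) = y" if "y \<in> carrier N" for y
    using that b by (auto simp: g_def bij_betw_def inv_into_into f_inv_into_f)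
  have gf: "g (f x) = x" if "x \<in> carrier M" for x
    using that b by (simp add: g_def bij_betw_inv_into_left)
  have "g \<in> rmodule_hom R N M"
  proof (rule rmodule_homI)
    show "g (x \<oplus>\<^bsub>N\<^esub> y) = g x \<oplus>\<^bsub>M\<^esub> g y" if "x \<in> carrier N" "y \<in> carrier N" for x y
      using that hom_add[OF f, of "g x" "g y"] gf[of "g x \<oplus>\<^bsub>M\<^esub> g y"] by (simp add: gc fg)
    show "g (x \<bullet>\<^bsub>N\<^esub> a) = g x \<bullet>\<^bsub>M\<^esub> a" if "x \<in> carrier N" "a \<in> carrier R" for x a
      using that hom_act[OF f, of "g x" a] gf[of "g x \<bullet>\<^bsub>M\<^esub> a"] by (simp add: gc fg M.act_closed)
  qed (rule gc)
  with f gf fg show ?thesis using that by blast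
qed

lemma rmodule_iso_refl: "rmodule_iso R M M"
  by (rule rmodule_isoI[OF hom_id, of _ "\<lambda>x. x"]) auto

lemma rmodule_iso_sym:
  assumes "right_module R M" "rmodule_iso R M N"
  shows "rmodule_iso R N M"
proof -
  obtain f g where *: "f \<in> rmodule_hom R M N" "g \<in> rmodule_hom R N M"
    "\<And>x. x \<in> carrier M \<Longrightarrow> g (f x) = x" "\<And>y. y \<in> carrier N \<Longrightarrow> f (g y) = y"
    by (rule rmodule_isoE[OF assms]) blast
  show ?thesis by (rule rmodule_isoI[OF *(2) hom_closed[OF *(1)] *(4,3)])
qed

lemma rmodule_iso_trans:
  assumes "rmodule_iso R M N" "rmodule_iso R N L"
  shows "rmodule_iso R M L"
proof -
  obtain f g where "f \<in> rmodule_hom R M N" "bij_betw f (carrier M) (carrier N)"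
    "g \<in> rmodule_hom R N L" "bij_betw g (carrier N) (carrier L)"
    using assms by (auto simp: rmodule_iso_def)
  then show ?thesis
    unfolding rmodule_iso_def
    by (intro bexI[of _ "\<lambda>x. g (f x)"]) (auto simp: hom_comp bij_betw_trans[unfolded o_def])
qed

text \<open>A direct summand as a split pair of maps. In this form it is transitive and passes to
  sums, to restricted scalars and to corners by mere composition; \<open>iso_summand\<close> is
  translated where \<open>deloopable\<close> and \<open>fg_projective\<close> are unfolded.\<close>

definition retract ::
  "('a, 'c) ring_scheme \<Rightarrow> ('a, 'b) rmodule \<Rightarrow> ('a, 'd) rmodule \<Rightarrow> bool" where
  "retract R X W \<longleftrightarrow> (\<exists>i\<in>rmodule_hom R X W. \<exists>r\<in>rmodule_hom R W X. \<forall>x\<in>carrier X. r (i x) = x)"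

lemma retractI:
  assumes "i \<in> rmodule_hom R X W" "r \<in> rmodule_hom R W X" "\<And>x. x \<in> carrier X \<Longrightarrow> r (i x) = x"
  shows "retract R X W"
  using assms by (auto simp: retract_def)

lemma retractE:
  assumes "retract R X W"
  obtains i r where "i \<in> rmodule_hom R X W" "r \<in> rmodule_hom R W X" "\<And>x. x \<in> carrier X \<Longrightarrow> r (i x) = x"
  using assms by (auto simp: retract_def)

lemma retract_refl: "retract R M M"
  by (rule retractI[OF hom_id hom_id]) simp

lemma retract_trans:
  assumes "retract R X W" "retract R W V"
  shows "retract R X V"
proof -
  obtain i r j s where *: "i \<in> rmodule_hom R X W" "r \<in> rmodule_hom R W X"
    "\<And>x. x \<in> carrier X \<Longrightarrow> r (i x) = x" "j \<in> rmodule_hom R W V" "s \<in> rmodule_hom R V W"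
    "\<And>x. x \<in> carrier W \<Longrightarrow> s (j x) = x"
    using assms unfolding retract_def by metis
  then show ?thesis
    by (intro retractI[OF hom_comp[OF *(1,4)] hom_comp[OF *(5,2)]]) (simp add: hom_closed[OF *(1)])
qed

lemma iso_imp_retract:
  assumes "right_module R M" "rmodule_iso R M N"
  shows "retract R M N" "retract R N M"
  using rmodule_isoE[OF assms] retractI by metis+

text \<open>A decomposition gives the projection along the complement; conversely the image of the
  section and the kernel of the retraction are complements.\<close>

lemma iso_summand_iff_retract:
  assumes "right_module R X" "right_module R W"
  shows "iso_summand R X W \<longleftrightarrow> retract R X W"
proof
  interpret X: right_module R X by fact
  interpret W: right_module R W by fact
  {
    assume "iso_summand R X W"
    then obtain N N' where N: "rsubmodule R N W" "rsubmodule R N' W" "N \<inter> N' = {\<zero>\<^bsub>W\<^esub>}"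
      "N <+>\<^bsub>W\<^esub> N' = carrier W" "rmodule_iso R X (restrict_module W N)"
      by (auto simp: iso_summand_def)
    define q where "q = (\<lambda>w. SOME n. n \<in> N \<and> (\<exists>n'\<in>N'. w = n \<oplus>\<^bsub>W\<^esub> n'))"
    have q: "q w \<in> N \<and> (\<exists>n'\<in>N'. w = q w \<oplus>\<^bsub>W\<^esub> n')" if "w \<in> carrier W" for w
      unfolding q_def by (rule someI_ex) (use that N(4) mem_set_add[of w W N N'] in blast)
    have uniq: "q (n \<oplus>\<^bsub>W\<^esub> n') = n" if n: "n \<in> N" "n' \<in> N'" for n n'
    proof -
      have c: "n \<in> carrier W" "n' \<in> carrier W" using n rsub_in N by metis+
      obtain m' where m': "m' \<in> N'" "n \<oplus>\<^bsub>W\<^esub> n' = q (n \<oplus>\<^bsub>W\<^esub> n') \<oplus>\<^bsub>W\<^esub> m'"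
        and qn: "q (n \<oplus>\<^bsub>W\<^esub> n') \<in> N"
        using q[of "n \<oplus>\<^bsub>W\<^esub> n'"] c by auto
      define m where "m = q (n \<oplus>\<^bsub>W\<^esub> n')"
      have cm: "m \<in> carrier W" "m' \<in> carrier W" using rsub_in N qn m'(1) m_def by metis+
      have e: "n \<oplus>\<^bsub>W\<^esub> n' = m \<oplus>\<^bsub>W\<^esub> m'" using m'(2) by (simp add: m_def)
      \<comment> \<open>For two decompositions of one element, the difference of the
        \<open>N\<close>-parts is also a difference of \<open>N'\<close>-parts, so it lies in the
        trivial intersection.\<close>
      have "n \<ominus>\<^bsub>W\<^esub> m = (n \<oplus>\<^bsub>W\<^esub> n') \<ominus>\<^bsub>W\<^esub> n' \<ominus>\<^bsub>W\<^esub> m"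
        using c cm by (simp add: a_minus_def W.a_assoc W.r_neg)
      also have "\<dots> = (m \<oplus>\<^bsub>W\<^esub> m') \<ominus>\<^bsub>W\<^esub> n' \<ominus>\<^bsub>W\<^esub> m" by (simp only: e)
      also have "\<dots> = m' \<ominus>\<^bsub>W\<^esub> n'"
        using c cm by (simp add: a_minus_def W.a_ac W.r_neg2 W.r_neg1 W.r_neg)
      finally have "n \<ominus>\<^bsub>W\<^esub> m \<in> N'" using W.rsub_diff[OF N(2) m'(1) n(2)] by simp
      moreover have "n \<ominus>\<^bsub>W\<^esub> m \<in> N" using W.rsub_diff[OF N(1) n(1)] qn m_def by simp
      ultimately have "n \<ominus>\<^bsub>W\<^esub> m = \<zero>\<^bsub>W\<^esub>" using N(3) by blast
      then have "n = m" using c cm by (simp add: W.diff_eq_zero_iff)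
      then show ?thesis by (simp add: m_def)
    qed
    have q_hom: "q \<in> rmodule_hom R W (restrict_module W N)"
    proof (rule rmodule_homI)
      fix x y assume x: "x \<in> carrier W" and y: "y \<in> carrier W"
      obtain x' y' where xy: "x' \<in> N'" "x = q x \<oplus>\<^bsub>W\<^esub> x'" "y' \<in> N'" "y = q y \<oplus>\<^bsub>W\<^esub> y'"
        using q x y by meson
      have c: "x' \<in> carrier W" "y' \<in> carrier W" "q x \<in> carrier W" "q y \<in> carrier W"
        using rsub_in N xy q x y by metis+
      have "x \<oplus>\<^bsub>W\<^esub> y = (q x \<oplus>\<^bsub>W\<^esub> x') \<oplus>\<^bsub>W\<^esub> (q y \<oplus>\<^bsub>W\<^esub> y')" using xy(2,4) by simp
      also have "\<dots> = (q x \<oplus>\<^bsub>W\<^esub> q y) \<oplus>\<^bsub>W\<^esub> (x' \<oplus>\<^bsub>W\<^esub> y')" using c by (simp add: W.a_ac)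
      finally show "q (x \<oplus>\<^bsub>W\<^esub> y) = q x \<oplus>\<^bsub>restrict_module W N\<^esub> q y"
        using uniq rsub_add[OF N(1)] rsub_add[OF N(2)] q x y xy by simp
    next
      fix x a assume x: "x \<in> carrier W" and a: "a \<in> carrier R"
      obtain x' where xy: "x' \<in> N'" "x = q x \<oplus>\<^bsub>W\<^esub> x'" using q x by meson
      have c: "x' \<in> carrier W" "q x \<in> carrier W" using rsub_in N xy q x by metis+
      have "x \<bullet>\<^bsub>W\<^esub> a = (q x \<oplus>\<^bsub>W\<^esub> x') \<bullet>\<^bsub>W\<^esub> a" using xy by simp
      also have "\<dots> = q x \<bullet>\<^bsub>W\<^esub> a \<oplus>\<^bsub>W\<^esub> x' \<bullet>\<^bsub>W\<^esub> a" using c a by (simp add: W.act_add_left)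
      finally show "q (x \<bullet>\<^bsub>W\<^esub> a) = q x \<bullet>\<^bsub>restrict_module W N\<^esub> a"
        using uniq rsub_act[OF N(1)] rsub_act[OF N(2)] q x a xy by simp
    qed (use q in simp)
    have "retract R (restrict_module W N) W"
    proof (rule retractI[OF _ q_hom])
      show "(\<lambda>x. x) \<in> rmodule_hom R (restrict_module W N) W"
        by (rule hom_restrict_dom[OF hom_id rsub_subset[OF N(1)]])
      show "q x = x" if "x \<in> carrier (restrict_module W N)" for x
        using uniq[of x "\<zero>\<^bsub>W\<^esub>"] that rsub_zero[OF N(2)] rsub_in[OF N(1)] by simp
    qed
    then show "retract R X W"
      using iso_imp_retract(1)[OF assms(1) N(5)] retract_trans by blast
  next
    assume "retract R X W"
    then obtain i r where ir: "i \<in> rmodule_hom R X W" "r \<in> rmodule_hom R W X"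
      "\<And>x. x \<in> carrier X \<Longrightarrow> r (i x) = x" by (rule retractE) blast
    interpret i: rmod_hom R X W i using ir assms by (simp add: rmod_homI)
    interpret r: rmod_hom R W X r using ir assms by (simp add: rmod_homI)
    define N where "N = i ` carrier X"
    define N' where "N' = a_kernel W X r"
    have N: "rsubmodule R N W" unfolding N_def by (rule i.rsub_image[OF X.rsub_carrier])
    have N': "rsubmodule R N' W" unfolding N'_def by (rule r.rsub_kernel)
    show "iso_summand R X W"
      unfolding iso_summand_def
    proof (intro exI conjI)
      show "rsubmodule R N W" "rsubmodule R N' W" by fact+
      show "N \<inter> N' = {\<zero>\<^bsub>W\<^esub>}"
        using rsub_zero[OF N] rsub_zero[OF N'] by (auto simp: N_def N'_def r.kernel_eq ir(3)) (metis ir(3) r.zero)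
      show "N <+>\<^bsub>W\<^esub> N' = carrier W"
      proof
        show "N <+>\<^bsub>W\<^esub> N' \<subseteq> carrier W" using rsub_subset[OF W.rsub_set_add[OF N N']] .
        show "carrier W \<subseteq> N <+>\<^bsub>W\<^esub> N'"
        proof
          fix w assume w: "w \<in> carrier W"
          have "w = i (r w) \<oplus>\<^bsub>W\<^esub> (w \<ominus>\<^bsub>W\<^esub> i (r w))" using w by (simp add: a_minus_def W.a_ac W.r_neg)
          moreover have "w \<ominus>\<^bsub>W\<^esub> i (r w) \<in> N'"
            using w by (simp add: N'_def r.kernel_eq ir(3) a_minus_def X.r_neg)
          moreover have "i (r w) \<in> N" using w by (simp add: N_def)
          ultimately show "w \<in> N <+>\<^bsub>W\<^esub> N'" by (auto simp: mem_set_add)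
        qed
      qed
      show "rmodule_iso R X (restrict_module W N)"
        by (rule rmodule_isoI[of _ _ _ _ r]) (auto simp: ir(3) N_def intro!: hom_restrict_cod ir)
    qed
  }
qed

lemma rmodule_sum_simps [simp]:
  "carrier (rmodule_sum M N) = carrier M \<times> carrier N"
  "\<zero>\<^bsub>rmodule_sum M N\<^esub> = (\<zero>\<^bsub>M\<^esub>, \<zero>\<^bsub>N\<^esub>)"
  "(x, y) \<oplus>\<^bsub>rmodule_sum M N\<^esub> (x', y') = (x \<oplus>\<^bsub>M\<^esub> x', y \<oplus>\<^bsub>N\<^esub> y')"
  "(x, y) \<bullet>\<^bsub>rmodule_sum M N\<^esub> a = (x \<bullet>\<^bsub>M\<^esub> a, y \<bullet>\<^bsub>N\<^esub> a)"
  by (simp_all add: rmodule_sum_def)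

lemma right_module_sum:
  assumes "right_module R M" "right_module R N"
  shows "right_module R (rmodule_sum M N)"
proof -
  interpret M: right_module R M by fact
  interpret N: right_module R N by fact
  show ?thesis
  proof (rule right_moduleI)
    show "\<exists>y\<in>carrier (rmodule_sum M N). y \<oplus>\<^bsub>rmodule_sum M N\<^esub> x = \<zero>\<^bsub>rmodule_sum M N\<^esub>"
      if "x \<in> carrier (rmodule_sum M N)" for x
      using that by (auto intro!: bexI[of _ "(\<ominus>\<^bsub>M\<^esub> fst x, \<ominus>\<^bsub>N\<^esub> snd x)"] simp: M.l_neg N.l_neg)
  qed (auto simp: M.R.ring_axioms M.a_ac N.a_ac M.act_closed N.act_closed M.act_add_left
      N.act_add_left M.act_add_right N.act_add_right M.act_assoc N.act_assoc M.act_one N.act_one)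
qed

lemma hom_sum:
  assumes "f \<in> rmodule_hom R M N" "g \<in> rmodule_hom R M' N'"
  shows "(\<lambda>(x, y). (f x, g y)) \<in> rmodule_hom R (rmodule_sum M M') (rmodule_sum N N')"
  by (rule rmodule_homI) (auto simp: hom_closed[OF assms(1)] hom_closed[OF assms(2)]
    hom_add[OF assms(1)] hom_add[OF assms(2)] hom_act[OF assms(1)] hom_act[OF assms(2)])

lemma retract_sum:
  assumes "retract R X W" "retract R X' W'"
  shows "retract R (rmodule_sum X X') (rmodule_sum W W')"
proof -
  obtain i r where 1: "i \<in> rmodule_hom R X W" "r \<in> rmodule_hom R W X"
    "\<And>x. x \<in> carrier X \<Longrightarrow> r (i x) = x" using assms(1) by (rule retractE) blast
  obtain j s where 2: "j \<in> rmodule_hom R X' W'" "s \<in> rmodule_hom R W' X'"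
    "\<And>x. x \<in> carrier X' \<Longrightarrow> s (j x) = x" using assms(2) by (rule retractE) blast
  show ?thesis
    by (rule retractI[OF hom_sum[OF 1(1) 2(1)] hom_sum[OF 1(2) 2(2)]]) (auto simp: 1 2)
qed

lemma rmodule_iso_sum:
  assumes "right_module R X" "right_module R X'" "rmodule_iso R X W" "rmodule_iso R X' W'"
  shows "rmodule_iso R (rmodule_sum X X') (rmodule_sum W W')"
proof -
  obtain f g where 1: "f \<in> rmodule_hom R X W" "g \<in> rmodule_hom R W X"
    "\<And>x. x \<in> carrier X \<Longrightarrow> g (f x) = x" "\<And>y. y \<in> carrier W \<Longrightarrow> f (g y) = y"
    by (rule rmodule_isoE[OF assms(1,3)]) blast
  obtain f' g' where 2: "f' \<in> rmodule_hom R X' W'" "g' \<in> rmodule_hom R W' X'"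
    "\<And>x. x \<in> carrier X' \<Longrightarrow> g' (f' x) = x" "\<And>y. y \<in> carrier W' \<Longrightarrow> f' (g' y) = y"
    by (rule rmodule_isoE[OF assms(2,4)]) blast
  show ?thesis
    by (rule rmodule_isoI[OF hom_sum[OF 1(1) 2(1)], of "\<lambda>(x, y). (g x, g' y)"])
      (auto simp: 1 2 hom_closed[OF 1(2)] hom_closed[OF 2(2)])
qed

lemma retract_sum_right:
  assumes "right_module R M" "right_module R N"
  shows "retract R N (rmodule_sum M N)"
proof -
  interpret M: right_module R M by fact
  interpret N: right_module R N by fact
  show ?thesis
    by (rule retractI[of "\<lambda>x. (\<zero>\<^bsub>M\<^esub>, x)" _ _ _ snd]) (auto intro!: rmodule_homI)
qed

section \<open>Free and projective modules\<close>

definition reg_module :: "('a, 'c) ring_scheme \<Rightarrow> ('a, 'a) rmodule" where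
  "reg_module R = \<lparr>carrier = carrier R, mult = undefined, one = undefined,
     zero = \<zero>\<^bsub>R\<^esub>, add = add R, act = mult R\<rparr>"

lemma reg_module_simps [simp]:
  "carrier (reg_module R) = carrier R" "\<zero>\<^bsub>reg_module R\<^esub> = \<zero>\<^bsub>R\<^esub>"
  "x \<oplus>\<^bsub>reg_module R\<^esub> y = x \<oplus>\<^bsub>R\<^esub> y" "x \<bullet>\<^bsub>reg_module R\<^esub> a = x \<otimes>\<^bsub>R\<^esub> a"
  by (simp_all add: reg_module_def)

lemma (in ring) right_module_reg: "right_module R (reg_module R)"
  by (rule right_moduleI)
    (auto simp: ring_axioms a_ac m_assoc l_distr r_distr intro!: bexI[of _ "\<ominus> x" for x] l_neg)

lemma free_module_simps [simp]:
  "carrier (free_module R n) = {..<n} \<rightarrow>\<^sub>E carrier R"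
  "\<zero>\<^bsub>free_module R n\<^esub> = (\<lambda>i\<in>{..<n}. \<zero>\<^bsub>R\<^esub>)"
  "f \<oplus>\<^bsub>free_module R n\<^esub> g = (\<lambda>i\<in>{..<n}. f i \<oplus>\<^bsub>R\<^esub> g i)"
  "f \<bullet>\<^bsub>free_module R n\<^esub> a = (\<lambda>i\<in>{..<n}. f i \<otimes>\<^bsub>R\<^esub> a)"
  by (simp_all add: free_module_def)

lemma (in ring) right_module_free: "right_module R (free_module R n)"
proof (rule right_moduleI)
  show "\<exists>y\<in>carrier (free_module R n). y \<oplus>\<^bsub>free_module R n\<^esub> x = \<zero>\<^bsub>free_module R n\<^esub>"
    if "x \<in> carrier (free_module R n)" for x
    using that by (intro bexI[of _ "\<lambda>i\<in>{..<n}. \<ominus> x i"]) (auto simp: l_neg fun_eq_iff PiE_iff)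
qed (auto simp: ring_axioms a_ac m_assoc l_distr r_distr PiE_iff fun_eq_iff extensional_def)

lemma coordinate_hom:
  assumes "i < n"
  shows "(\<lambda>v. v i) \<in> rmodule_hom R (free_module R n) (reg_module R)"
  using assms by (intro rmodule_homI) (auto simp: PiE_iff)

definition unit_vec :: "('a, 'c) ring_scheme \<Rightarrow> nat \<Rightarrow> nat \<Rightarrow> nat \<Rightarrow> 'a" where
  "unit_vec R n i = (\<lambda>j\<in>{..<n}. if j = i then \<one>\<^bsub>R\<^esub> else \<zero>\<^bsub>R\<^esub>)"

lemma (in ring) unit_vec_closed [simp]: "unit_vec R n i \<in> carrier (free_module R n)"
  by (simp add: unit_vec_def)

text \<open>Homomorphisms out of free and projective modules are produced in this way: functionals
  on \<open>P\<close> serve as coefficients of prescribed vectors of \<open>Q\<close>.\<close>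

lemma hom_lincomb:
  assumes P: "right_module R P" and Q: "right_module R Q" and "finite I" "y \<in> I \<rightarrow> carrier Q"
    and f: "\<And>i. i \<in> I \<Longrightarrow> f i \<in> rmodule_hom R P (reg_module R)"
  shows "(\<lambda>p. \<Oplus>\<^bsub>Q\<^esub>i\<in>I. y i \<bullet>\<^bsub>Q\<^esub> f i p) \<in> rmodule_hom R P Q"
proof -
  interpret P: right_module R P by fact
  interpret Q: right_module R Q by fact
  have y: "y i \<in> carrier Q" if "i \<in> I" for i using assms(4) that by auto
  have fc: "f i p \<in> carrier R" if "i \<in> I" "p \<in> carrier P" for i p
    using hom_closed[OF f] that by simp
  have yf: "y i \<bullet>\<^bsub>Q\<^esub> f i p \<in> carrier Q" if "i \<in> I" "p \<in> carrier P" for i p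
    using y fc Q.act_closed that by simp
  show ?thesis
  proof (rule rmodule_homI)
    show "(\<Oplus>\<^bsub>Q\<^esub>i\<in>I. y i \<bullet>\<^bsub>Q\<^esub> f i p) \<in> carrier Q" if "p \<in> carrier P" for p
      using that yf by (intro Q.finsum_closed) auto
    fix p assume p: "p \<in> carrier P"
    {
      fix q assume q: "q \<in> carrier P"
      have "(\<Oplus>\<^bsub>Q\<^esub>i\<in>I. y i \<bullet>\<^bsub>Q\<^esub> f i (p \<oplus>\<^bsub>P\<^esub> q)) = (\<Oplus>\<^bsub>Q\<^esub>i\<in>I. y i \<bullet>\<^bsub>Q\<^esub> f i p \<oplus>\<^bsub>Q\<^esub> y i \<bullet>\<^bsub>Q\<^esub> f i q)"
        using p q yf y fc by (intro Q.finsum_cong') (auto simp: hom_add[OF f] Q.act_add_right)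
      then show "(\<Oplus>\<^bsub>Q\<^esub>i\<in>I. y i \<bullet>\<^bsub>Q\<^esub> f i (p \<oplus>\<^bsub>P\<^esub> q)) =
          (\<Oplus>\<^bsub>Q\<^esub>i\<in>I. y i \<bullet>\<^bsub>Q\<^esub> f i p) \<oplus>\<^bsub>Q\<^esub> (\<Oplus>\<^bsub>Q\<^esub>i\<in>I. y i \<bullet>\<^bsub>Q\<^esub> f i q)"
        using p q yf by (simp add: Q.finsum_addf Pi_def)
    }
    fix a assume a: "a \<in> carrier R"
    have "(\<Oplus>\<^bsub>Q\<^esub>i\<in>I. y i \<bullet>\<^bsub>Q\<^esub> f i p) \<bullet>\<^bsub>Q\<^esub> a = (\<Oplus>\<^bsub>Q\<^esub>i\<in>I. (y i \<bullet>\<^bsub>Q\<^esub> f i p) \<bullet>\<^bsub>Q\<^esub> a)"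
      using assms(3) p yf a by (intro Q.finsum_act) auto
    also have "\<dots> = (\<Oplus>\<^bsub>Q\<^esub>i\<in>I. y i \<bullet>\<^bsub>Q\<^esub> f i (p \<bullet>\<^bsub>P\<^esub> a))"
      using p yf y fc a by (intro Q.finsum_cong') (auto simp: hom_act[OF f] Q.act_assoc Q.act_closed)
    finally show "(\<Oplus>\<^bsub>Q\<^esub>i\<in>I. y i \<bullet>\<^bsub>Q\<^esub> f i (p \<bullet>\<^bsub>P\<^esub> a)) = (\<Oplus>\<^bsub>Q\<^esub>i\<in>I. y i \<bullet>\<^bsub>Q\<^esub> f i p) \<bullet>\<^bsub>Q\<^esub> a" ..
  qed
qed

text \<open>The dual basis criterion for finitely generated projective modules. The generators may
  be redundant and the index set may have any type, so explicit modules over \<Lambda> can be tested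
  without an embedding into a free module.\<close>

definition dual_basis ::
  "('a, 'c) ring_scheme \<Rightarrow> ('a, 'b) rmodule \<Rightarrow> 'i set \<Rightarrow> ('i \<Rightarrow> 'b) \<Rightarrow> ('i \<Rightarrow> 'b \<Rightarrow> 'a) \<Rightarrow> bool" where
  "dual_basis R P I x f \<longleftrightarrow> finite I \<and> x \<in> I \<rightarrow> carrier P \<and>
     (\<forall>i\<in>I. f i \<in> rmodule_hom R P (reg_module R)) \<and>
     (\<forall>p\<in>carrier P. (\<Oplus>\<^bsub>P\<^esub>i\<in>I. x i \<bullet>\<^bsub>P\<^esub> f i p) = p)"

lemma (in ring) dual_basis_free:
  "dual_basis R (free_module R n) {..<n} (unit_vec R n) (\<lambda>i v. v i)"
proof -
  interpret F: right_module R "free_module R n" by (rule right_module_free)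
  have "(\<Oplus>\<^bsub>free_module R n\<^esub>i\<in>{..<n}. unit_vec R n i \<bullet>\<^bsub>free_module R n\<^esub> v i) = v" (is "?s = v")
    if v: "v \<in> carrier (free_module R n)" for v
  proof
    fix j
    have vi: "v i \<in> carrier R" if "i < n" for i using v that by auto
    have c: "(\<lambda>i. unit_vec R n i \<bullet>\<^bsub>free_module R n\<^esub> v i) \<in> {..<n} \<rightarrow> carrier (free_module R n)"
      using vi by (intro Pi_I F.act_closed unit_vec_closed) auto
    show "?s j = v j"
    proof (cases "j < n")
      case True
      have "?s j = (\<Oplus>i\<in>{..<n}. (unit_vec R n i \<bullet>\<^bsub>free_module R n\<^esub> v i) j)"
        using True c
        by (intro additive_finsum[where f = "\<lambda>v. v j"] F.abelian_group_axioms abelian_group_axioms) auto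
      also have "\<dots> = (\<Oplus>i\<in>{..<n}. if j = i then v i else \<zero>)"
        using True vi by (intro finsum_cong') (auto simp: unit_vec_def)
      also have "\<dots> = v j" using True vi by (intro finsum_singleton) auto
      finally show ?thesis .
    next
      case False
      have "?s \<in> carrier (free_module R n)" using c by (rule F.finsum_closed)
      then show ?thesis using False v by (simp add: PiE_iff extensional_def)
    qed
  qed
  then show ?thesis
    unfolding dual_basis_def using coordinate_hom unit_vec_closed by blast
qed

text \<open>Generators are pushed along the retraction, functionals are pulled back along the
  section.\<close>

lemma dual_basis_retract:
  assumes P: "right_module R P" and Q: "right_module R Q" and "retract R P Q" "dual_basis R Q I x f"
  shows "\<exists>y g. dual_basis R P I y g"
proof -
  obtain i r where ir: "i \<in> rmodule_hom R P Q" "r \<in> rmodule_hom R Q P" "\<And>x. x \<in> carrier P \<Longrightarrow> r (i x) = x"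
    using assms(3) by (rule retractE) blast
  interpret r: rmod_hom R Q P r using P Q ir by (simp add: rmod_homI)
  have db: "finite I" "x \<in> I \<rightarrow> carrier Q" "\<And>i. i \<in> I \<Longrightarrow> f i \<in> rmodule_hom R Q (reg_module R)"
    "\<And>p. p \<in> carrier Q \<Longrightarrow> (\<Oplus>\<^bsub>Q\<^esub>i\<in>I. x i \<bullet>\<^bsub>Q\<^esub> f i p) = p"
    using assms(4) by (auto simp: dual_basis_def)
  have "(\<Oplus>\<^bsub>P\<^esub>j\<in>I. r (x j) \<bullet>\<^bsub>P\<^esub> f j (i p)) = p" if p: "p \<in> carrier P" for p
  proof -
    have ip: "i p \<in> carrier Q" using p ir by (simp add: hom_closed)
    have "(\<Oplus>\<^bsub>P\<^esub>j\<in>I. r (x j) \<bullet>\<^bsub>P\<^esub> f j (i p)) = r (\<Oplus>\<^bsub>Q\<^esub>j\<in>I. x j \<bullet>\<^bsub>Q\<^esub> f j (i p))"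
      using db ip hom_closed[OF db(3)] by (intro r.lincomb[symmetric]) auto
    then show ?thesis using db(4)[OF ip] ir(3) p by simp
  qed
  then have "dual_basis R P I (\<lambda>j. r (x j)) (\<lambda>j p. f j (i p))"
    unfolding dual_basis_def using db hom_comp[OF ir(1) db(3)] funcset_mem[OF db(2)] by auto
  then show ?thesis by blast
qed

text \<open>The functionals together form the section into a free module, and taking linear
  combinations of the generators is the retraction.\<close>

lemma retract_free_if_dual_basis:
  assumes P: "right_module R P" and "dual_basis R P I x f"
  shows "\<exists>n. retract R P (free_module R n)"
proof -
  interpret P: right_module R P by fact
  have db: "finite I" "x \<in> I \<rightarrow> carrier P" "\<And>i. i \<in> I \<Longrightarrow> f i \<in> rmodule_hom R P (reg_module R)"
    "\<And>p. p \<in> carrier P \<Longrightarrow> (\<Oplus>\<^bsub>P\<^esub>i\<in>I. x i \<bullet>\<^bsub>P\<^esub> f i p) = p"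
    using assms by (auto simp: dual_basis_def)
  obtain g where g: "bij_betw g {..<card I} I"
    using db(1) ex_bij_betw_nat_finite[of I] by (auto simp: atLeast0LessThan)
  let ?n = "card I"
  have gI: "g j \<in> I" if "j < ?n" for j using g that by (auto simp: bij_betw_def)
  have fc: "f i p \<in> carrier R" if "i \<in> I" "p \<in> carrier P" for i p
    using hom_closed[OF db(3)] that by simp
  have "retract R P (free_module R ?n)"
  proof (rule retractI)
    show "(\<lambda>p. \<lambda>j\<in>{..<?n}. f (g j) p) \<in> rmodule_hom R P (free_module R ?n)"
      by (rule rmodule_homI)
        (auto simp: fc gI hom_add[OF db(3)] hom_act[OF db(3)] fun_eq_iff)
    show "(\<lambda>v. \<Oplus>\<^bsub>P\<^esub>j\<in>{..<?n}. x (g j) \<bullet>\<^bsub>P\<^esub> v j) \<in> rmodule_hom R (free_module R ?n) P"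
      using db gI coordinate_hom by (intro hom_lincomb P P.R.right_module_free) auto
    fix p assume p: "p \<in> carrier P"
    have c: "x i \<bullet>\<^bsub>P\<^esub> f i p \<in> carrier P" if "i \<in> I" for i
      using P.act_closed[OF funcset_mem[OF db(2)] fc] that p by blast
    have "(\<Oplus>\<^bsub>P\<^esub>j\<in>{..<?n}. x (g j) \<bullet>\<^bsub>P\<^esub> (\<lambda>j\<in>{..<?n}. f (g j) p) j)
        = (\<Oplus>\<^bsub>P\<^esub>j\<in>{..<?n}. x (g j) \<bullet>\<^bsub>P\<^esub> f (g j) p)"
      using gI c by (intro P.finsum_cong') auto
    also have "\<dots> = (\<Oplus>\<^bsub>P\<^esub>i\<in>g ` {..<?n}. x i \<bullet>\<^bsub>P\<^esub> f i p)"
      using g c gI by (intro P.finsum_reindex[symmetric]) (auto simp: bij_betw_def)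
    also have "\<dots> = p" using db(4)[OF p] g by (simp add: bij_betw_def)
    finally show "(\<Oplus>\<^bsub>P\<^esub>j\<in>{..<?n}. x (g j) \<bullet>\<^bsub>P\<^esub> (\<lambda>j\<in>{..<?n}. f (g j) p) j) = p" .
  qed
  then show ?thesis ..
qed

lemma fg_projective_iff_retract:
  "fg_projective R P \<longleftrightarrow> right_module R P \<and> (\<exists>n. retract R P (free_module R n))"
proof -
  have "iso_summand R P (free_module R n) \<longleftrightarrow> retract R P (free_module R n)" if "right_module R P" for n
  proof -
    interpret right_module R P by fact
    show ?thesis by (intro iso_summand_iff_retract that R.right_module_free)
  qed
  then show ?thesis by (auto simp: fg_projective_def)
qed

lemma fg_projective_right_module: "fg_projective R P \<Longrightarrow> right_module R P"
  by (simp add: fg_projective_def)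

lemma fg_projective_retract:
  assumes "fg_projective R P" "right_module R Q" "retract R Q P"
  shows "fg_projective R Q"
  using assms retract_trans[OF assms(3)] unfolding fg_projective_iff_retract by blast

lemma fg_projective_free: "ring R \<Longrightarrow> fg_projective R (free_module R n)"
  using retractI[OF hom_id hom_id] by (auto simp: fg_projective_iff_retract ring.right_module_free)

lemma fg_projectiveI: "right_module R P \<Longrightarrow> dual_basis R P I x f \<Longrightarrow> fg_projective R P"
  by (simp add: fg_projective_iff_retract retract_free_if_dual_basis)

lemma fg_projective_reg:
  assumes "ring R"
  shows "fg_projective R (reg_module R)"
proof -
  interpret ring R by fact
  interpret reg: right_module R "reg_module R" by (rule right_module_reg)
  have "dual_basis R (reg_module R) {()} (\<lambda>_. \<one>\<^bsub>R\<^esub>) (\<lambda>_ x. x)"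
    unfolding dual_basis_def using hom_id by (auto simp: reg.finsum_insert[of "{}", simplified])
  then show ?thesis by (rule fg_projectiveI[OF reg.right_module_axioms])
qed

lemma fg_projectiveE:
  fixes P :: "('a, 'b) rmodule"
  assumes "fg_projective R P"
  obtains n and x :: "nat \<Rightarrow> 'b" and f where "dual_basis R P {..<n} x f"
proof -
  interpret right_module R P using assms by (rule fg_projective_right_module)
  obtain n where "retract R P (free_module R n)" using assms by (auto simp: fg_projective_iff_retract)
  then show ?thesis
    using dual_basis_retract[OF right_module_axioms R.right_module_free _ R.dual_basis_free] that by blast
qed

lemma dual_basisD:
  assumes "dual_basis R P I x f"
  shows "finite I" "i \<in> I \<Longrightarrow> x i \<in> carrier P" "i \<in> I \<Longrightarrow> f i \<in> rmodule_hom R P (reg_module R)"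
    "p \<in> carrier P \<Longrightarrow> (\<Oplus>\<^bsub>P\<^esub>i\<in>I. x i \<bullet>\<^bsub>P\<^esub> f i p) = p"
    "i \<in> I \<Longrightarrow> p \<in> carrier P \<Longrightarrow> f i p \<in> carrier R"
  using assms hom_closed[of "f i" R P "reg_module R" p] by (auto simp: dual_basis_def)

text \<open>Preimages of the vectors \<open>h (x i)\<close> are chosen arbitrarily; the functionals
  of the dual basis turn the choice into a homomorphism.\<close>

lemma fg_projective_lift:
  assumes "fg_projective R P" and Y: "right_module R Y" and Q: "right_module R Q"
    and h: "h \<in> rmodule_hom R P Y" and q: "q \<in> rmodule_hom R Q Y" "carrier Y \<subseteq> q ` carrier Q"
  obtains g where "g \<in> rmodule_hom R P Q" "\<And>p. p \<in> carrier P \<Longrightarrow> q (g p) = h p"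
proof -
  interpret q: rmod_hom R Q Y q using Y Q q by (simp add: rmod_homI)
  interpret h: rmod_hom R P Y h using Y fg_projective_right_module[OF assms(1)] h by (simp add: rmod_homI)
  obtain n :: nat and x f where db: "dual_basis R P {..<n} x f" using assms(1) by (rule fg_projectiveE) blast
  note db = dual_basisD[OF db]
  have "\<exists>y. y \<in> carrier Q \<and> q y = h (x i)" if "i < n" for i
  proof -
    have "i \<in> {..<n}" using that by simp
    then have "h (x i) \<in> q ` carrier Q" by (rule subsetD[OF q(2) h.closed[OF db(2)]])
    then show ?thesis by (metis imageE)
  qed
  then obtain y where y: "\<And>i. i < n \<Longrightarrow> y i \<in> carrier Q" "\<And>i. i < n \<Longrightarrow> q (y i) = h (x i)" by metis
  let ?g = "\<lambda>p. \<Oplus>\<^bsub>Q\<^esub>i\<in>{..<n}. y i \<bullet>\<^bsub>Q\<^esub> f i p"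
  have "q (?g p) = h p" if p: "p \<in> carrier P" for p
  proof -
    have "q (?g p) = (\<Oplus>\<^bsub>Y\<^esub>i\<in>{..<n}. q (y i) \<bullet>\<^bsub>Y\<^esub> f i p)"
      using y db p by (intro q.lincomb) auto
    also have "\<dots> = (\<Oplus>\<^bsub>Y\<^esub>i\<in>{..<n}. h (x i) \<bullet>\<^bsub>Y\<^esub> f i p)"
      using y db p by (intro q.N.finsum_cong') (auto simp: q.N.act_closed)
    also have "\<dots> = h (\<Oplus>\<^bsub>P\<^esub>i\<in>{..<n}. x i \<bullet>\<^bsub>P\<^esub> f i p)"
      using y db p by (intro h.lincomb[symmetric]) auto
    finally show ?thesis using db(4)[OF p] by simp
  qed
  moreover have "?g \<in> rmodule_hom R P Q"
    using y db by (intro hom_lincomb h.M.right_module_axioms Q) auto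
  ultimately show ?thesis using that by blast
qed

lemma fg_projective_sum:
  assumes "fg_projective R P" "fg_projective R Q"
  shows "fg_projective R (rmodule_sum P Q)"
proof -
  interpret P: right_module R P using assms(1) by (rule fg_projective_right_module)
  interpret Q: right_module R Q using assms(2) by (rule fg_projective_right_module)
  let ?S = "rmodule_sum P Q"
  interpret S: right_module R ?S
    by (rule right_module_sum[OF P.right_module_axioms Q.right_module_axioms])
  obtain n :: nat and x f where dbP: "dual_basis R P {..<n} x f" using assms(1) by (rule fg_projectiveE) blast
  obtain m :: nat and y g where dbQ: "dual_basis R Q {..<m} y g" using assms(2) by (rule fg_projectiveE) blast
  note P = dual_basisD[OF dbP] and Q = dual_basisD[OF dbQ]
  interpret i: rmod_hom R P ?S "\<lambda>x. (x, \<zero>\<^bsub>Q\<^esub>)"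
    by (intro rmod_homI P.right_module_axioms S.right_module_axioms rmodule_homI) auto
  interpret j: rmod_hom R Q ?S "\<lambda>x. (\<zero>\<^bsub>P\<^esub>, x)"
    by (intro rmod_homI Q.right_module_axioms S.right_module_axioms rmodule_homI) auto
  define z where "z = case_sum (\<lambda>i. (x i, \<zero>\<^bsub>Q\<^esub>)) (\<lambda>i. (\<zero>\<^bsub>P\<^esub>, y i))"
  define k where "k = case_sum (\<lambda>i (p, q). f i p) (\<lambda>i (p, q). g i q)"
  \<comment> \<open>The two dual bases side by side, with their indices kept apart by
    \<open>Inl\<close> and \<open>Inr\<close>.\<close>
  let ?I = "Inl ` {..<n} \<union> Inr ` {..<m}"
  have "dual_basis R ?S ?I z k"
    unfolding dual_basis_def
  proof (intro conjI ballI)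
    show "finite ?I" by simp
    show "z \<in> ?I \<rightarrow> carrier ?S" using P(2) Q(2) by (auto simp: z_def)
    show "k l \<in> rmodule_hom R ?S (reg_module R)" if "l \<in> ?I" for l
      using that P(5) Q(5) hom_add[OF P(3)] hom_add[OF Q(3)] hom_act[OF P(3)] hom_act[OF Q(3)]
      by (intro rmodule_homI) (auto simp: k_def)
    fix s assume "s \<in> carrier ?S"
    then obtain p q where s: "s = (p, q)" "p \<in> carrier P" "q \<in> carrier Q" by auto
    let ?t = "\<lambda>l. z l \<bullet>\<^bsub>?S\<^esub> k l s"
    have c: "?t l \<in> carrier ?S" if "l \<in> ?I" for l
      proof -
      have *: "x i \<bullet>\<^bsub>P\<^esub> f i p \<in> carrier P" if "i < n" for i
        using P.act_closed[OF P(2,5)] s(2) that by simp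
      have **: "y i \<bullet>\<^bsub>Q\<^esub> g i q \<in> carrier Q" if "i < m" for i
        using Q.act_closed[OF Q(2,5)] s(3) that by simp
      have "f i p \<in> carrier R" if "i < n" for i using P(5) s(2) that by simp
      moreover have "g i q \<in> carrier R" if "i < m" for i using Q(5) s(3) that by simp
      ultimately show ?thesis
        using that * ** by (auto simp: z_def k_def s(1))
    qed
    have "finsum ?S ?t ?I = finsum ?S ?t (Inl ` {..<n}) \<oplus>\<^bsub>?S\<^esub> finsum ?S ?t (Inr ` {..<m})"
      using c by (intro S.finsum_Un_disjoint) blast+
    also have "finsum ?S ?t (Inl ` {..<n}) = finsum ?S (\<lambda>i. (x i, \<zero>\<^bsub>Q\<^esub>) \<bullet>\<^bsub>?S\<^esub> f i p) {..<n}"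
      using c by (subst S.finsum_reindex) (auto simp: z_def k_def s)
    also have "\<dots> = (p, \<zero>\<^bsub>Q\<^esub>)"
      using P s i.lincomb[of "{..<n}" x "\<lambda>i. f i p"] by (auto simp del: rmodule_sum_simps)
    also have "finsum ?S ?t (Inr ` {..<m}) = finsum ?S (\<lambda>i. (\<zero>\<^bsub>P\<^esub>, y i) \<bullet>\<^bsub>?S\<^esub> g i q) {..<m}"
      using c by (subst S.finsum_reindex) (auto simp: z_def k_def s)
    also have "\<dots> = (\<zero>\<^bsub>P\<^esub>, q)"
      using Q s j.lincomb[of "{..<m}" y "\<lambda>i. g i q"] by (auto simp del: rmodule_sum_simps)
    finally show "finsum ?S ?t ?I = s" using s by simp
  qed
  then show ?thesis by (intro fg_projectiveI S.right_module_axioms)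
qed

section \<open>Finitely generated modules\<close>

lemma fg_module_right_module: "fg_module R M \<Longrightarrow> right_module R M"
  by (simp add: fg_module_def)

lemma fg_module_iff_free_image:
  fixes M :: "('a, 'b) rmodule"
  assumes "right_module R M"
  shows "fg_module R M \<longleftrightarrow> (\<exists>n. \<exists>h\<in>rmodule_hom R (free_module R n) M. h ` carrier (free_module R n) = carrier M)"
proof
  interpret M: right_module R M by fact
  {
    assume "fg_module R M"
    then obtain S where S: "finite S" "S \<subseteq> carrier M"
      "\<And>N. rsubmodule R N M \<Longrightarrow> S \<subseteq> N \<Longrightarrow> N = carrier M"
      by (auto simp: fg_module_def)
    obtain n and s :: "nat \<Rightarrow> 'b" where s: "S = s ` {i. i < n}"
      using finite_imp_nat_seg_image_inj_on[OF S(1)] by blast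
    have sM: "s i \<in> carrier M" if "i < n" for i using that S(2) s by auto
    interpret F: right_module R "free_module R n" by (rule M.R.right_module_free)
    let ?h = "\<lambda>v. \<Oplus>\<^bsub>M\<^esub>i\<in>{..<n}. s i \<bullet>\<^bsub>M\<^esub> v i"
    have h: "?h \<in> rmodule_hom R (free_module R n) M"
      using sM coordinate_hom by (intro hom_lincomb F.right_module_axioms assms) auto
    interpret h: rmod_hom R "free_module R n" M ?h
      using h by (intro rmod_homI F.right_module_axioms assms)
    have "s j \<in> ?h ` carrier (free_module R n)" if "j < n" for j
    proof (rule image_eqI)
      have "?h (unit_vec R n j) = (\<Oplus>\<^bsub>M\<^esub>i\<in>{..<n}. if j = i then s i else \<zero>\<^bsub>M\<^esub>)"
        using sM by (intro M.finsum_cong') (auto simp: unit_vec_def M.act_one)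
      also have "\<dots> = s j" using that sM by (intro M.finsum_singleton) auto
      finally show "s j = ?h (unit_vec R n j)" ..
    qed (rule M.R.unit_vec_closed)
    then have "S \<subseteq> ?h ` carrier (free_module R n)" using s by auto
    then have "?h ` carrier (free_module R n) = carrier M"
      using S(3)[OF h.rsub_image[OF F.rsub_carrier]] by simp
    then show "\<exists>n. \<exists>h\<in>rmodule_hom R (free_module R n) M. h ` carrier (free_module R n) = carrier M"
      using h by blast
  next
    assume "\<exists>n. \<exists>h\<in>rmodule_hom R (free_module R n) M. h ` carrier (free_module R n) = carrier M"
    then obtain n h where h: "h \<in> rmodule_hom R (free_module R n) M"
      "h ` carrier (free_module R n) = carrier M" by blast
    interpret F: right_module R "free_module R n" by (rule M.R.right_module_free)
    interpret h: rmod_hom R "free_module R n" M h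
      using h by (intro rmod_homI F.right_module_axioms assms)
    note db = dual_basisD[OF M.R.dual_basis_free[of n]]
    have "N = carrier M" if N: "rsubmodule R N M" "h ` unit_vec R n ` {..<n} \<subseteq> N" for N
    proof
      show "carrier M \<subseteq> N"
      proof
        fix m assume "m \<in> carrier M"
        then obtain v where v: "v \<in> carrier (free_module R n)" "m = h v" using h(2) by auto
        have "m = h (\<Oplus>\<^bsub>free_module R n\<^esub>i\<in>{..<n}. unit_vec R n i \<bullet>\<^bsub>free_module R n\<^esub> v i)"
          using db(4)[OF v(1)] v(2) by simp
        also have "\<dots> = (\<Oplus>\<^bsub>M\<^esub>i\<in>{..<n}. h (unit_vec R n i) \<bullet>\<^bsub>M\<^esub> v i)"
          using v by (intro h.lincomb) (auto simp del: free_module_simps simp add: M.R.unit_vec_closed db(5))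
        also have "\<dots> \<in> N"
          using N(2) db(5)[OF _ v(1)] by (intro M.rsub_finsum[OF N(1)] Pi_I rsub_act[OF N(1)]) auto
        finally show "m \<in> N" .
      qed
    qed (use rsub_subset[OF N(1)] in simp)
    then show "fg_module R M"
      unfolding fg_module_def using assms M.R.unit_vec_closed[of n]
      by (intro conjI exI[of _ "h ` unit_vec R n ` {..<n}"]) (auto simp del: free_module_simps)
  }
qed

lemma fg_module_image:
  assumes "fg_module R M" "right_module R N" "f \<in> rmodule_hom R M N" "f ` carrier M = carrier N"
  shows "fg_module R N"
proof -
  obtain n h where h: "h \<in> rmodule_hom R (free_module R n) M" "h ` carrier (free_module R n) = carrier M"
    using assms(1) fg_module_iff_free_image[OF fg_module_right_module[OF assms(1)]] by blast
  then have "(\<lambda>v. f (h v)) ` carrier (free_module R n) = carrier N"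
    using assms(4) by (metis image_image)
  then show ?thesis
    using hom_comp[OF h(1) assms(3)] fg_module_iff_free_image[OF assms(2)] by blast
qed

lemma fg_module_retract:
  assumes "fg_module R M" "right_module R N" "retract R N M"
  shows "fg_module R N"
proof -
  obtain i r where ir: "i \<in> rmodule_hom R N M" "r \<in> rmodule_hom R M N" "\<And>x. x \<in> carrier N \<Longrightarrow> r (i x) = x"
    using assms(3) by (rule retractE) blast
  have "carrier N \<subseteq> r ` carrier M"
  proof
    fix x assume "x \<in> carrier N"
    then show "x \<in> r ` carrier M" using ir(3)[of x] hom_closed[OF ir(1), of x] by (metis image_eqI)
  qed
  then have "r ` carrier M = carrier N" using hom_closed[OF ir(2)] by auto
  then show ?thesis using fg_module_image assms(1,2) ir(2) by blast
qed

lemma fg_projective_imp_fg: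
  assumes "fg_projective R P"
  shows "fg_module R P"
proof -
  interpret right_module R P using assms by (rule fg_projective_right_module)
  obtain n where "retract R P (free_module R n)" using assms by (auto simp: fg_projective_iff_retract)
  moreover have "fg_module R (free_module R n)"
    unfolding fg_module_iff_free_image[OF R.right_module_free]
    by (intro exI[of _ n] bexI[of _ "\<lambda>x. x"] hom_id) simp
  ultimately show ?thesis using fg_module_retract right_module_axioms by blast
qed

lemma fg_module_sum:
  assumes "fg_module R M" "fg_module R N"
  shows "fg_module R (rmodule_sum M N)"
proof -
  interpret M: right_module R M by (rule fg_module_right_module[OF assms(1)])
  interpret N: right_module R N by (rule fg_module_right_module[OF assms(2)])
  interpret S: right_module R "rmodule_sum M N"
    by (rule right_module_sum[OF M.right_module_axioms N.right_module_axioms])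
  interpret i: rmod_hom R M "rmodule_sum M N" "\<lambda>x. (x, \<zero>\<^bsub>N\<^esub>)"
    by (intro rmod_homI M.right_module_axioms S.right_module_axioms rmodule_homI) auto
  interpret j: rmod_hom R N "rmodule_sum M N" "\<lambda>x. (\<zero>\<^bsub>M\<^esub>, x)"
    by (intro rmod_homI N.right_module_axioms S.right_module_axioms rmodule_homI) auto
  obtain X where X: "finite X" "X \<subseteq> carrier M" "\<And>K. rsubmodule R K M \<Longrightarrow> X \<subseteq> K \<Longrightarrow> K = carrier M"
    using assms(1) by (auto simp: fg_module_def)
  obtain Y where Y: "finite Y" "Y \<subseteq> carrier N" "\<And>K. rsubmodule R K N \<Longrightarrow> Y \<subseteq> K \<Longrightarrow> K = carrier N"
    using assms(2) by (auto simp: fg_module_def)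
  let ?G = "(\<lambda>x. (x, \<zero>\<^bsub>N\<^esub>)) ` X \<union> (\<lambda>y. (\<zero>\<^bsub>M\<^esub>, y)) ` Y"
  have "K = carrier (rmodule_sum M N)" if K: "rsubmodule R K (rmodule_sum M N)" "?G \<subseteq> K" for K
  proof
    have 1: "{x \<in> carrier M. (x, \<zero>\<^bsub>N\<^esub>) \<in> K} = carrier M"
      using K(2) X(2) by (intro X(3)[OF i.rsub_vimage[OF K(1)]]) auto
    have 2: "{y \<in> carrier N. (\<zero>\<^bsub>M\<^esub>, y) \<in> K} = carrier N"
      using K(2) Y(2) by (intro Y(3)[OF j.rsub_vimage[OF K(1)]]) auto
    show "carrier (rmodule_sum M N) \<subseteq> K"
    proof
      fix z assume "z \<in> carrier (rmodule_sum M N)"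
      then obtain x y where z: "z = (x, y)" "x \<in> carrier M" "y \<in> carrier N" by auto
      then have "(x, \<zero>\<^bsub>N\<^esub>) \<in> K" "(\<zero>\<^bsub>M\<^esub>, y) \<in> K" using 1 2 by blast+
      then show "z \<in> K" using rsub_add[OF K(1), of "(x, \<zero>\<^bsub>N\<^esub>)" "(\<zero>\<^bsub>M\<^esub>, y)"] z by simp
    qed
  qed (rule rsub_subset[OF K(1)])
  then show ?thesis
    unfolding fg_module_def using S.right_module_axioms X(1,2) Y(1,2)
    by (intro conjI exI[of _ ?G]) auto
qed

section \<open>Projective covers and syzygies\<close>

lemma superfluousI:
  assumes "rsubmodule R K P"
    and "\<And>N. rsubmodule R N P \<Longrightarrow> (\<And>p. p \<in> carrier P \<Longrightarrow> \<exists>n\<in>N. \<exists>k\<in>K. p = n \<oplus>\<^bsub>P\<^esub> k) \<Longrightarrow> carrier P \<subseteq> N"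
  shows "superfluous R K P"
  unfolding superfluous_def
proof (intro conjI allI impI assms(1))
  fix N assume N: "rsubmodule R N P \<and> N <+>\<^bsub>P\<^esub> K = carrier P"
  then have "\<exists>n\<in>N. \<exists>k\<in>K. p = n \<oplus>\<^bsub>P\<^esub> k" if "p \<in> carrier P" for p
    using that mem_set_add[of p P N K] by simp
  then show "N = carrier P" using assms(2)[of N] N rsub_subset by blast
qed

lemma (in right_module) superfluousD:
  assumes "superfluous R K M" "rsubmodule R N M"
    "\<And>p. p \<in> carrier M \<Longrightarrow> \<exists>n\<in>N. \<exists>k\<in>K. p = n \<oplus> k"
  shows "N = carrier M"
proof -
  have K: "rsubmodule R K M" using assms(1) by (simp add: superfluous_def)
  have "N <+>\<^bsub>M\<^esub> K = carrier M"
  proof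
    show "N <+>\<^bsub>M\<^esub> K \<subseteq> carrier M" by (rule rsub_subset[OF rsub_set_add[OF assms(2) K]])
    show "carrier M \<subseteq> N <+>\<^bsub>M\<^esub> K" using assms(3) mem_set_add[of _ M N K] by blast
  qed
  then show ?thesis using assms by (simp add: superfluous_def)
qed

text \<open>If \<open>L\<close> and the image of \<open>K\<close> span \<open>N\<close>, then
  \<open>K\<close> and the preimage of \<open>L\<close> span \<open>M\<close>. Hence
  \<open>f\<close> maps all of \<open>M\<close> into \<open>L\<close>, in particular
  \<open>K\<close>, and \<open>L\<close> is everything.\<close>

lemma (in rmod_hom) superfluous_image:
  assumes "superfluous R K M"
  shows "superfluous R (f ` K) N"
proof (rule superfluousI)
  have K: "rsubmodule R K M" using assms by (simp add: superfluous_def)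
  show "rsubmodule R (f ` K) N" by (rule rsub_image[OF K])
  fix L assume L: "rsubmodule R L N"
    and *: "\<And>p. p \<in> carrier N \<Longrightarrow> \<exists>n\<in>L. \<exists>k\<in>f ` K. p = n \<oplus>\<^bsub>N\<^esub> k"
  let ?L = "{x \<in> carrier M. f x \<in> L}"
  have "?L = carrier M"
  proof (rule M.superfluousD[OF assms rsub_vimage[OF L]])
    fix m assume m: "m \<in> carrier M"
    then obtain l k where lk: "l \<in> L" "k \<in> K" "f m = l \<oplus>\<^bsub>N\<^esub> f k" using *[of "f m"] by auto
    have k: "k \<in> carrier M" and l: "l \<in> carrier N" using rsub_in[OF K lk(2)] rsub_in[OF L lk(1)] .
    have "f (m \<ominus>\<^bsub>M\<^esub> k) = l" using m k l lk(3) by (simp add: a_minus_def N.a_assoc N.r_neg)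
    moreover have "m = (m \<ominus>\<^bsub>M\<^esub> k) \<oplus>\<^bsub>M\<^esub> k" using m k by (simp add: a_minus_def M.a_assoc M.l_neg)
    ultimately show "\<exists>n\<in>?L. \<exists>k\<in>K. m = n \<oplus>\<^bsub>M\<^esub> k" using m k lk by (intro bexI[of _ "m \<ominus>\<^bsub>M\<^esub> k"] bexI[of _ k]) auto
  qed
  then have fL: "f m \<in> L" if "m \<in> carrier M" for m using that by blast
  show "carrier N \<subseteq> L"
  proof
    fix p assume "p \<in> carrier N"
    then obtain l k where lk: "l \<in> L" "k \<in> K" "p = l \<oplus>\<^bsub>N\<^esub> f k" using * by blast
    then show "p \<in> L" using rsub_add[OF L lk(1) fL] rsub_in[OF K lk(2)] by simp
  qed
qed

text \<open>The superfluity of \<open>L\<close> is applied to \<open>N + K\<close>, which leaves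
  that of \<open>K\<close> for \<open>N\<close>.\<close>

lemma (in right_module) superfluous_set_add:
  assumes "superfluous R K M" "superfluous R L M"
  shows "superfluous R (K <+>\<^bsub>M\<^esub> L) M"
proof (rule superfluousI)
  have K: "rsubmodule R K M" and L: "rsubmodule R L M" using assms by (auto simp: superfluous_def)
  show "rsubmodule R (K <+>\<^bsub>M\<^esub> L) M" by (rule rsub_set_add[OF K L])
  fix N assume N: "rsubmodule R N M"
    and *: "\<And>p. p \<in> carrier M \<Longrightarrow> \<exists>n\<in>N. \<exists>k\<in>K <+>\<^bsub>M\<^esub> L. p = n \<oplus> k"
  have "N <+>\<^bsub>M\<^esub> K = carrier M"
  proof (rule superfluousD[OF assms(2) rsub_set_add[OF N K]])
    fix p assume "p \<in> carrier M"
    then obtain n k where nk: "n \<in> N" "k \<in> K <+>\<^bsub>M\<^esub> L" "p = n \<oplus> k" using * by blast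
    obtain k' l where kl: "k' \<in> K" "l \<in> L" "k = k' \<oplus> l" using nk(2) unfolding mem_set_add by blast
    have "p = (n \<oplus> k') \<oplus> l"
      using nk(3) kl(3) rsub_in[OF N nk(1)] rsub_in[OF K kl(1)] rsub_in[OF L kl(2)] by (simp add: a_assoc)
    then show "\<exists>n\<in>N <+>\<^bsub>M\<^esub> K. \<exists>k\<in>L. p = n \<oplus> k" using nk(1) kl mem_set_add[of _ M N K] by blast
  qed
  then have "N = carrier M" using assms(1) N by (simp add: superfluous_def)
  then show "carrier M \<subseteq> N" by simp
qed

lemma projective_coverD:
  assumes "projective_cover R P p X"
  shows "fg_projective R P" "right_module R P" "p \<in> rmodule_hom R P X" "p ` carrier P = carrier X"
    "superfluous R (a_kernel P X p) P"
  using assms fg_projective_right_module by (auto simp: projective_cover_def)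

text \<open>Conjugation with the two isomorphisms carries the cover and its kernel along. This moves
  covers built on products and functions to the carrier type that \<open>syzygy\<close>
  demands.\<close>

lemma projective_cover_iso:
  assumes cov: "projective_cover R P p X" and X: "right_module R X" "right_module R X'" "rmodule_iso R X X'"
    and P': "right_module R P'" "rmodule_iso R P P'"
  shows "\<exists>p'. projective_cover R P' p' X' \<and>
    rmodule_iso R (restrict_module P (a_kernel P X p)) (restrict_module P' (a_kernel P' X' p'))"
proof -
  note cov = projective_coverD[OF cov]
  obtain c d where c: "c \<in> rmodule_hom R X X'" "d \<in> rmodule_hom R X' X"
    "\<And>x. x \<in> carrier X \<Longrightarrow> d (c x) = x" "\<And>y. y \<in> carrier X' \<Longrightarrow> c (d y) = y"
    by (rule rmodule_isoE[OF X(1,3)]) blast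
  obtain f g where f: "f \<in> rmodule_hom R P P'" "g \<in> rmodule_hom R P' P"
    "\<And>x. x \<in> carrier P \<Longrightarrow> g (f x) = x" "\<And>y. y \<in> carrier P' \<Longrightarrow> f (g y) = y"
    by (rule rmodule_isoE[OF cov(2) P'(2)]) blast
  interpret c: rmod_hom R X X' c using c X by (simp add: rmod_homI)
  interpret d: rmod_hom R X' X d using c X by (simp add: rmod_homI)
  interpret f: rmod_hom R P P' f using f cov P' by (simp add: rmod_homI)
  interpret g: rmod_hom R P' P g using f cov P' by (simp add: rmod_homI)
  interpret p: rmod_hom R P X p using cov X by (simp add: rmod_homI)
  let ?p = "\<lambda>y. c (p (g y))"
  have h: "?p \<in> rmodule_hom R P' X'" using hom_comp[OF hom_comp[OF f(2) cov(3)] c(1)] .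
  interpret h: rmod_hom R P' X' ?p using h P' X by (simp add: rmod_homI)
  have ker: "a_kernel P' X' ?p = f ` a_kernel P X p"
  proof
    show "a_kernel P' X' ?p \<subseteq> f ` a_kernel P X p"
    proof
      fix y assume "y \<in> a_kernel P' X' ?p"
      then have y: "y \<in> carrier P'" "c (p (g y)) = \<zero>\<^bsub>X'\<^esub>" by (auto simp: h.kernel_eq)
      then have "p (g y) = \<zero>\<^bsub>X\<^esub>" using c(3)[of "p (g y)"] d.zero by simp
      then show "y \<in> f ` a_kernel P X p" using y f(4)[OF y(1)]
        by (intro image_eqI[of _ _ "g y"]) (auto simp: p.kernel_eq)
    qed
    show "f ` a_kernel P X p \<subseteq> a_kernel P' X' ?p" by (auto simp: h.kernel_eq p.kernel_eq f(3))
  qed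
  have "?p ` carrier P' = carrier X'"
  proof
    show "carrier X' \<subseteq> ?p ` carrier P'"
    proof
      fix y assume y: "y \<in> carrier X'"
      then obtain z where z: "z \<in> carrier P" "d y = p z" using cov(4) d.closed[OF y] by blast
      then have "y = ?p (f z)" using c(4)[OF y] f(3) by simp
      then show "y \<in> ?p ` carrier P'" using z by auto
    qed
  qed auto
  moreover have "superfluous R (a_kernel P' X' ?p) P'" unfolding ker by (rule f.superfluous_image[OF cov(5)])
  moreover have "fg_projective R P'"
    using fg_projective_retract[OF cov(1) P'(1)] iso_imp_retract[OF cov(2) P'(2)] by blast
  moreover have "rmodule_iso R (restrict_module P (a_kernel P X p)) (restrict_module P' (a_kernel P' X' ?p))"
  proof (rule rmodule_isoI[of f _ _ _ g])
    have s: "a_kernel P X p \<subseteq> carrier P" by (auto simp: p.kernel_eq)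
    show "f \<in> rmodule_hom R (restrict_module P (a_kernel P X p)) (restrict_module P' (a_kernel P' X' ?p))"
      by (intro hom_restrict_cod hom_restrict_dom[OF f(1) s]) (auto simp: ker)
  qed (auto simp: ker f(3) p.kernel_eq)
  ultimately show ?thesis using h by (auto simp: projective_cover_def)
qed

lemma syzygy_right_module:
  assumes "syzygy R d X Y" "right_module R X"
  shows "right_module R Y"
  using assms
proof (induction rule: syzygy.induct)
  case (syzygy_Suc d X Y P p)
  then interpret p: rmod_hom R P Y p using projective_coverD[of R P p Y] by (simp add: rmod_homI)
  show ?case by (rule p.M.right_module_restrict[OF p.rsub_kernel])
qed

lemma fg_projective_umodule:
  fixes P :: "('a, 'b) rmodule"
  assumes "fg_projective R P"
  obtains P' :: "'a umodule" where "fg_projective R P'" "rmodule_iso R P P'"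
proof -
  obtain P' :: "'a umodule" where P': "fg_module R P'" "rmodule_iso R P P'"
    using fg_module_iso_umodule[OF fg_projective_imp_fg[OF assms]] by blast
  then have "fg_projective R P'"
    using fg_projective_retract[OF assms fg_module_right_module]
      iso_imp_retract[OF fg_projective_right_module[OF assms]] by blast
  then show ?thesis using P'(2) that by blast
qed

text \<open>\<open>syzygy\<close> accepts only covers with the carrier type of
  \<open>umodule\<close>, of the very module reached so far. Here one more step is taken with a
  cover on any type, of a module that is merely isomorphic to that one.\<close>

lemma syzygy_step:
  assumes "syzygy R d X Y" "right_module R X" "right_module R Y0" "rmodule_iso R Y Y0"
    and cov: "projective_cover R P p Y0"
  obtains Z where "syzygy R (Suc d) X Z" "rmodule_iso R Z (restrict_module P (a_kernel P Y0 p))"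
proof -
  have Y: "right_module R Y" using assms syzygy_right_module by blast
  note cv = projective_coverD[OF cov]
  obtain P' :: "'a umodule" where P': "fg_projective R P'" "rmodule_iso R P P'"
    by (rule fg_projective_umodule[OF cv(1)])
  obtain p' where p': "projective_cover R P' p' Y" and
    iso: "rmodule_iso R (restrict_module P (a_kernel P Y0 p)) (restrict_module P' (a_kernel P' Y p'))"
    using projective_cover_iso[OF cov assms(3) Y rmodule_iso_sym[OF Y assms(4)]
        fg_projective_right_module[OF P'(1)] P'(2)] by blast
  interpret p: rmod_hom R P Y0 p using cv assms(3) by (simp add: rmod_homI)
  show ?thesis
    using that[OF syzygy_Suc[OF assms(1) p']]
      rmodule_iso_sym[OF p.M.right_module_restrict[OF p.rsub_kernel] iso] by blast
qed

lemma projective_cover_self: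
  assumes "fg_projective R P"
  shows "projective_cover R P (\<lambda>x. x) P"
proof -
  interpret right_module R P using assms by (rule fg_projective_right_module)
  have "a_kernel P P (\<lambda>x. x) = {\<zero>\<^bsub>P\<^esub>}" by (auto simp: a_kernel_def')
  moreover have "superfluous R {\<zero>\<^bsub>P\<^esub>} P"
    by (rule superfluousI[OF rsub_triv]) (use rsub_in in force)
  ultimately show ?thesis using assms by (simp add: projective_cover_def hom_id)
qed

lemma projective_cover_sum:
  assumes "projective_cover R P p X" "projective_cover R Q q Y" and X: "right_module R X" "right_module R Y"
  shows "projective_cover R (rmodule_sum P Q) (\<lambda>(x, y). (p x, q y)) (rmodule_sum X Y)"
    and "rmodule_iso R (restrict_module (rmodule_sum P Q)
        (a_kernel (rmodule_sum P Q) (rmodule_sum X Y) (\<lambda>(x, y). (p x, q y))))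
      (rmodule_sum (restrict_module P (a_kernel P X p)) (restrict_module Q (a_kernel Q Y q)))"
proof -
  note P = projective_coverD[OF assms(1)] and Q = projective_coverD[OF assms(2)]
  let ?S = "rmodule_sum P Q" and ?p = "\<lambda>(x, y). (p x, q y)"
  interpret p: rmod_hom R P X p using P X by (simp add: rmod_homI)
  interpret q: rmod_hom R Q Y q using Q X by (simp add: rmod_homI)
  interpret S: right_module R ?S by (rule right_module_sum[OF P(2) Q(2)])
  interpret i: rmod_hom R P ?S "\<lambda>x. (x, \<zero>\<^bsub>Q\<^esub>)"
    by (intro rmod_homI P Q S.right_module_axioms rmodule_homI) auto
  interpret j: rmod_hom R Q ?S "\<lambda>x. (\<zero>\<^bsub>P\<^esub>, x)"
    by (intro rmod_homI P Q S.right_module_axioms rmodule_homI) auto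
  have ker: "a_kernel ?S (rmodule_sum X Y) ?p = a_kernel P X p \<times> a_kernel Q Y q"
    by (auto simp: a_kernel_def')
  have "a_kernel P X p \<times> a_kernel Q Y q =
      (\<lambda>x. (x, \<zero>\<^bsub>Q\<^esub>)) ` a_kernel P X p <+>\<^bsub>?S\<^esub> (\<lambda>x. (\<zero>\<^bsub>P\<^esub>, x)) ` a_kernel Q Y q"
    unfolding set_eq_iff mem_set_add bex_simps by (auto simp: p.kernel_eq q.kernel_eq)
  then have "superfluous R (a_kernel ?S (rmodule_sum X Y) ?p) ?S"
    unfolding ker using S.superfluous_set_add[OF i.superfluous_image[OF P(5)] j.superfluous_image[OF Q(5)]]
    by simp
  moreover have "?p ` carrier ?S = carrier (rmodule_sum X Y)"
  proof -
    have "?p ` (carrier P \<times> carrier Q) = (p ` carrier P) \<times> (q ` carrier Q)" by auto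
    then show ?thesis by (simp add: P(4) Q(4))
  qed
  ultimately show "projective_cover R ?S ?p (rmodule_sum X Y)"
    unfolding projective_cover_def using fg_projective_sum[OF P(1) Q(1)] hom_sum[OF P(3) Q(3)] by blast
  show "rmodule_iso R (restrict_module ?S (a_kernel ?S (rmodule_sum X Y) ?p))
      (rmodule_sum (restrict_module P (a_kernel P X p)) (restrict_module Q (a_kernel Q Y q)))"
    unfolding ker by (rule rmodule_isoI[of "\<lambda>x. x" _ _ _ "\<lambda>x. x"]) (auto intro!: rmodule_homI)
qed

text \<open>A map \<open>h\<close> with \<open>p h = p\<close> is onto because the kernel of the cover \<open>p\<close> is superfluous, and it is
  injective because a section of it is onto for the same reason.\<close>

lemma projective_cover_kernel_retract:
  assumes "projective_cover R P p Y" "fg_projective R Q" "q \<in> rmodule_hom R Q Z" "q ` carrier Q = carrier Z"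
    and Y: "right_module R Y" and Z: "right_module R Z" and "retract R Y Z"
  shows "retract R (restrict_module P (a_kernel P Y p)) (restrict_module Q (a_kernel Q Z q))"
proof -
  note P = projective_coverD[OF assms(1)]
  have Q: "right_module R Q" using assms(2) by (rule fg_projective_right_module)
  obtain i r where ir: "i \<in> rmodule_hom R Y Z" "r \<in> rmodule_hom R Z Y" "\<And>x. x \<in> carrier Y \<Longrightarrow> r (i x) = x"
    using assms(7) by (rule retractE) blast
  interpret p: rmod_hom R P Y p using P Y by (simp add: rmod_homI)
  interpret q: rmod_hom R Q Z q using Q Z assms by (simp add: rmod_homI)
  interpret i: rmod_hom R Y Z i using Z Y ir by (simp add: rmod_homI)
  interpret r: rmod_hom R Z Y r using Z Y ir by (simp add: rmod_homI)
  \<comment> \<open>\<open>u\<close> and \<open>v\<close> lift the section and the retraction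
    between \<open>Y\<close> and \<open>Z\<close>. Their composite on \<open>P\<close> covers the
    identity of \<open>Y\<close>; it need not be the identity of \<open>P\<close>, and
    \<open>s\<close> will correct it.\<close>
  obtain u where u: "u \<in> rmodule_hom R P Q" "\<And>x. x \<in> carrier P \<Longrightarrow> q (u x) = i (p x)"
    using fg_projective_lift[OF P(1) Z Q hom_comp[OF P(3) ir(1)] assms(3)] assms(4) by blast
  obtain v where v: "v \<in> rmodule_hom R Q P" "\<And>x. x \<in> carrier Q \<Longrightarrow> p (v x) = r (q x)"
    using fg_projective_lift[OF assms(2) Y P(2) hom_comp[OF assms(3) ir(2)] P(3)] P(4) by blast
  interpret u: rmod_hom R P Q u using P Q u by (simp add: rmod_homI)
  interpret v: rmod_hom R Q P v using P Q v by (simp add: rmod_homI)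
  have onto: "h ` carrier P = carrier P"
    if h: "h \<in> rmodule_hom R P P" "\<And>x. x \<in> carrier P \<Longrightarrow> p (h x) = p x" for h
  proof -
    interpret h: rmod_hom R P P h using P h by (simp add: rmod_homI)
    show ?thesis
    proof (rule p.M.superfluousD[OF P(5) h.rsub_image[OF p.M.rsub_carrier]])
      fix x assume x: "x \<in> carrier P"
      have "x = h x \<oplus>\<^bsub>P\<^esub> (x \<ominus>\<^bsub>P\<^esub> h x)" using x by (simp add: a_minus_def p.M.a_ac p.M.r_neg)
      moreover have "x \<ominus>\<^bsub>P\<^esub> h x \<in> a_kernel P Y p"
        using x h(2) by (simp add: p.kernel_eq a_minus_def p.N.r_neg)
      ultimately show "\<exists>n\<in>h ` carrier P. \<exists>k\<in>a_kernel P Y p. x = n \<oplus>\<^bsub>P\<^esub> k" using x by blast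
    qed
  qed
  let ?h = "\<lambda>x. v (u x)"
  have h: "?h \<in> rmodule_hom R P P" by (rule hom_comp[OF u(1) v(1)])
  have ph: "p (?h x) = p x" if "x \<in> carrier P" for x using that by (simp add: v(2) u(2) ir(3))
  obtain s where s: "s \<in> rmodule_hom R P P" "\<And>x. x \<in> carrier P \<Longrightarrow> ?h (s x) = x"
    using fg_projective_lift[OF P(1) P(2) P(2) hom_id h] onto[OF h ph] by blast
  interpret s: rmod_hom R P P s using P s by (simp add: rmod_homI)
  have ps: "p (s x) = p x" if "x \<in> carrier P" for x using ph[of "s x"] s(2)[OF that] that by simp
  have sh: "s (?h x) = x" if x: "x \<in> carrier P" for x
  proof -
    obtain y where "y \<in> carrier P" "x = s y" using onto[OF s(1) ps] x by blast
    then show ?thesis using s(2) by simp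
  qed
  show ?thesis
  proof (rule retractI)
    show "u \<in> rmodule_hom R (restrict_module P (a_kernel P Y p)) (restrict_module Q (a_kernel Q Z q))"
      by (intro hom_restrict_cod hom_restrict_dom[OF u(1)]) (auto simp: p.kernel_eq q.kernel_eq u(2))
    show "(\<lambda>x. s (v x)) \<in> rmodule_hom R (restrict_module Q (a_kernel Q Z q)) (restrict_module P (a_kernel P Y p))"
      by (intro hom_restrict_cod hom_restrict_dom[OF hom_comp[OF v(1) s(1)]])
        (auto simp: p.kernel_eq q.kernel_eq ps v(2))
  qed (auto simp: sh p.kernel_eq)
qed

text \<open>The identity cover of \<open>P0\<close> contributes nothing to the kernel. Thus one
  further syzygy removes the projective summand that the definition of the delooping level
  allows.\<close>

lemma projective_cover_kernel_retract_sum: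
  assumes "projective_cover R P p Y" "projective_cover R Q q Z" "fg_projective R P0"
    and Y: "right_module R Y" and Z: "right_module R Z" and "retract R Y (rmodule_sum P0 Z)"
  shows "retract R (restrict_module P (a_kernel P Y p)) (restrict_module Q (a_kernel Q Z q))"
proof -
  note Q = projective_coverD[OF assms(2)]
  interpret P0: right_module R P0 using assms(3) by (rule fg_projective_right_module)
  interpret q: rmod_hom R Q Z q using Q Z by (simp add: rmod_homI)
  let ?q = "\<lambda>(x, y). (x, q y)" and ?S = "rmodule_sum P0 Q" and ?T = "rmodule_sum P0 Z"
  have T: "right_module R ?T" by (rule right_module_sum[OF P0.right_module_axioms Z])
  note cov = projective_coverD[OF projective_cover_sum(1)[OF projective_cover_self[OF assms(3)]
    assms(2) P0.right_module_axioms Z]]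
  have "retract R (restrict_module P (a_kernel P Y p)) (restrict_module ?S (a_kernel ?S ?T ?q))"
    by (rule projective_cover_kernel_retract[OF assms(1) cov(1,3,4) Y T assms(6)])
  moreover have "retract R (restrict_module ?S (a_kernel ?S ?T ?q)) (restrict_module Q (a_kernel Q Z q))"
    by (rule retractI[of snd _ _ _ "\<lambda>y. (\<zero>\<^bsub>P0\<^esub>, y)"]) (auto simp: a_kernel_def' intro!: rmodule_homI)
  ultimately show ?thesis by (rule retract_trans)
qed

section \<open>Restriction of scalars\<close>

text \<open>Along surjections this turns a module over \<open>A\<close> or over its semisimple
  quotient into one over the matrix algebra or its opposite; along \<open>\<phi>\<close> it gives
  the underlying module over the base ring.\<close>

definition restr_scalars :: "('a \<Rightarrow> 'b) \<Rightarrow> ('b, 'm) rmodule \<Rightarrow> ('a, 'm) rmodule" where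
  "restr_scalars \<rho> M = \<lparr>carrier = carrier M, mult = undefined, one = undefined,
     zero = \<zero>\<^bsub>M\<^esub>, add = add M, act = (\<lambda>x a. x \<bullet>\<^bsub>M\<^esub> \<rho> a)\<rparr>"

lemma restr_scalars_simps [simp]:
  "carrier (restr_scalars \<rho> M) = carrier M" "\<zero>\<^bsub>restr_scalars \<rho> M\<^esub> = \<zero>\<^bsub>M\<^esub>"
  "x \<oplus>\<^bsub>restr_scalars \<rho> M\<^esub> y = x \<oplus>\<^bsub>M\<^esub> y" "x \<bullet>\<^bsub>restr_scalars \<rho> M\<^esub> a = x \<bullet>\<^bsub>M\<^esub> \<rho> a"
  by (simp_all add: restr_scalars_def)

lemma right_module_restr_scalars:
  assumes "ring R" "\<rho> \<in> ring_hom R A" "right_module A M"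
  shows "right_module R (restr_scalars \<rho> M)"
proof -
  interpret M: right_module A M by fact
  note \<rho> = ring_hom_closed[OF assms(2)] ring_hom_add[OF assms(2)] ring_hom_mult[OF assms(2)] ring_hom_one[OF assms(2)]
  show ?thesis
    by (rule right_moduleI)
      (auto simp: assms(1) \<rho> M.a_ac M.act_closed M.act_add_left M.act_add_right M.act_assoc M.act_one
        intro!: bexI[of _ "\<ominus>\<^bsub>M\<^esub> x" for x] M.l_neg)
qed

lemma rsub_restr_scalars:
  assumes "ring R" "\<rho> \<in> ring_hom R A" "right_module A M" "rsubmodule A N M"
  shows "rsubmodule R N (restr_scalars \<rho> M)"
proof -
  interpret right_module R "restr_scalars \<rho> M" using assms by (intro right_module_restr_scalars)
  show ?thesis
    using rsub_in[OF assms(4)] rsub_zero[OF assms(4)] rsub_add[OF assms(4)] rsub_act[OF assms(4)]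
      ring_hom_closed[OF assms(2)]
    by (intro rsubmoduleI) auto
qed

lemma hom_restr_scalars:
  assumes "f \<in> rmodule_hom A M N" "\<rho> \<in> ring_hom R A"
  shows "f \<in> rmodule_hom R (restr_scalars \<rho> M) (restr_scalars \<rho> N)"
  using hom_closed[OF assms(1)] hom_add[OF assms(1)] hom_act[OF assms(1)] ring_hom_closed[OF assms(2)]
  by (intro rmodule_homI) auto

lemma retract_restr_scalars:
  assumes "retract A M N" "\<rho> \<in> ring_hom R A"
  shows "retract R (restr_scalars \<rho> M) (restr_scalars \<rho> N)"
proof -
  obtain i r where *: "i \<in> rmodule_hom A M N" "r \<in> rmodule_hom A N M" "\<And>x. x \<in> carrier M \<Longrightarrow> r (i x) = x"
    using assms(1) by (rule retractE) blast
  show ?thesis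
    by (rule retractI[OF hom_restr_scalars[OF *(1) assms(2)] hom_restr_scalars[OF *(2) assms(2)]]) (simp add: *(3))
qed

lemma rmodule_iso_restr_scalars:
  assumes "rmodule_iso A M N" "\<rho> \<in> ring_hom R A"
  shows "rmodule_iso R (restr_scalars \<rho> M) (restr_scalars \<rho> N)"
  using assms hom_restr_scalars[OF _ assms(2)] unfolding rmodule_iso_def by auto

lemma rsub_of_restr_scalars:
  assumes "\<rho> ` carrier R = carrier A" "right_module A M" "rsubmodule R N (restr_scalars \<rho> M)"
  shows "rsubmodule A N M"
proof -
  interpret right_module A M by fact
  show ?thesis
  proof (rule rsubmoduleI)
    show "x \<bullet>\<^bsub>M\<^esub> a \<in> N" if xa: "x \<in> N" "a \<in> carrier A" for x a
    proof -
      obtain r where "r \<in> carrier R" "a = \<rho> r" using assms(1) xa(2) by blast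
      then show ?thesis using rsub_act[OF assms(3) xa(1)] by simp
    qed
  qed (use rsub_in[OF assms(3)] rsub_zero[OF assms(3)] rsub_add[OF assms(3)] in auto)
qed

lemma fg_module_restr_scalars:
  assumes "ring R" "\<rho> \<in> ring_hom R A" "\<rho> ` carrier R = carrier A" "fg_module A M"
  shows "fg_module R (restr_scalars \<rho> M)"
proof -
  have M: "right_module A M" by (rule fg_module_right_module[OF assms(4)])
  obtain S where S: "finite S" "S \<subseteq> carrier M" "\<And>N. rsubmodule A N M \<Longrightarrow> S \<subseteq> N \<Longrightarrow> N = carrier M"
    using assms(4) by (auto simp: fg_module_def)
  then show ?thesis
    unfolding fg_module_def
    using right_module_restr_scalars[OF assms(1,2) M] rsub_of_restr_scalars[OF assms(3) M]
    by (intro conjI exI[of _ S]) simp_all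
qed

lemma simple_module_restr_scalars:
  assumes "ring R" "\<rho> \<in> ring_hom R A" "\<rho> ` carrier R = carrier A" "simple_module A M"
  shows "simple_module R (restr_scalars \<rho> M)"
proof -
  have M: "right_module A M" using assms(4) by (simp add: simple_module_def)
  then show ?thesis
    using assms(4) right_module_restr_scalars[OF assms(1,2) M] rsub_of_restr_scalars[OF assms(3) M]
    by (simp add: simple_module_def)
qed

section \<open>Simple modules\<close>

lemma simple_module_iso:
  assumes "simple_module R M" "right_module R N" "rmodule_iso R M N"
  shows "simple_module R N"
proof -
  have M: "right_module R M" using assms by (simp add: simple_module_def)
  obtain f g where fg: "f \<in> rmodule_hom R M N" "g \<in> rmodule_hom R N M"
    "\<And>x. x \<in> carrier M \<Longrightarrow> g (f x) = x" "\<And>y. y \<in> carrier N \<Longrightarrow> f (g y) = y"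
    by (rule rmodule_isoE[OF M assms(3)]) blast
  interpret f: rmod_hom R M N f using fg M assms by (simp add: rmod_homI)
  interpret g: rmod_hom R N M g using fg M assms by (simp add: rmod_homI)
  have fK: "f ` g ` K = K" if "K \<subseteq> carrier N" for K
  proof -
    have "f ` g ` K = (\<lambda>x. x) ` K"
      unfolding image_image using that fg(4) by (intro image_cong) auto
    then show ?thesis by simp
  qed
  have "K = {\<zero>\<^bsub>N\<^esub>} \<or> K = carrier N" if K: "rsubmodule R K N" for K
  proof -
    have "g ` K = {\<zero>\<^bsub>M\<^esub>} \<or> g ` K = carrier M"
      using assms(1) g.rsub_image[OF K] by (simp add: simple_module_def)
    moreover have "f ` carrier M = carrier N"
    proof
      show "carrier N \<subseteq> f ` carrier M"
        using fK[OF subset_refl] g.closed by blast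
    qed (use f.closed in blast)
    ultimately show ?thesis using fK[OF rsub_subset[OF K]] f.zero by (metis image_empty image_insert)
  qed
  moreover have "carrier N \<noteq> {\<zero>\<^bsub>N\<^esub>}"
  proof
    assume N: "carrier N = {\<zero>\<^bsub>N\<^esub>}"
    have "x = \<zero>\<^bsub>M\<^esub>" if "x \<in> carrier M" for x
      using fg(3)[OF that] f.closed[OF that] g.zero N by simp
    then have "carrier M = {\<zero>\<^bsub>M\<^esub>}" using f.M.zero_closed by blast
    then show False using assms(1) by (simp add: simple_module_def)
  qed
  ultimately show ?thesis using assms(2) by (simp add: simple_module_def)
qed

lemma simple_module_cyclic:
  assumes "simple_module R V" "v \<in> carrier V" "v \<noteq> \<zero>\<^bsub>V\<^esub>" "w \<in> carrier V"
  obtains a where "a \<in> carrier R" "w = v \<bullet>\<^bsub>V\<^esub> a"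
proof -
  interpret right_module R V using assms by (simp add: simple_module_def)
  have "(\<lambda>a. v \<bullet>\<^bsub>V\<^esub> a) ` carrier R = carrier V"
    using assms rsub_cyclic[OF assms(2)] cyclic_self[OF assms(2)] unfolding simple_module_def by blast
  then show ?thesis using assms(4) that by blast
qed

lemma simple_module_fg:
  assumes "simple_module R V"
  shows "fg_module R V"
proof -
  interpret right_module R V using assms by (simp add: simple_module_def)
  obtain v where v: "v \<in> carrier V" "v \<noteq> \<zero>\<^bsub>V\<^esub>"
    using assms zero_closed unfolding simple_module_def by blast
  then have "N = carrier V" if "rsubmodule R N V \<and> {v} \<subseteq> N" for N
    using assms that unfolding simple_module_def by blast
  then show ?thesis unfolding fg_module_def using v(1) right_module_axioms
    by (intro conjI exI[of _ "{v}"]) simp_all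
qed

text \<open>By \<open>comm\<close> every \<open>r c\<close> has the form \<open>c r'\<close>, which
  makes the elements killed by \<open>c\<close> a submodule. This is meant for the idempotents and
  square-zero elements of the triangular matrix algebra, which are not central.\<close>

lemma simple_module_kernel:
  assumes V: "simple_module R V" and c: "c \<in> carrier R"
    and comm: "\<And>r. r \<in> carrier R \<Longrightarrow> \<exists>r'\<in>carrier R. r \<otimes>\<^bsub>R\<^esub> c = c \<otimes>\<^bsub>R\<^esub> r'"
  shows "(\<forall>v\<in>carrier V. v \<bullet>\<^bsub>V\<^esub> c = \<zero>\<^bsub>V\<^esub>) \<or> (\<forall>v\<in>carrier V. v \<bullet>\<^bsub>V\<^esub> c = \<zero>\<^bsub>V\<^esub> \<longrightarrow> v = \<zero>\<^bsub>V\<^esub>)"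
proof -
  interpret V: right_module R V using V by (simp add: simple_module_def)
  have "rsubmodule R {v \<in> carrier V. v \<bullet>\<^bsub>V\<^esub> c = \<zero>\<^bsub>V\<^esub>} V"
  proof (rule V.rsubmoduleI)
    fix x r assume x: "x \<in> {v \<in> carrier V. v \<bullet>\<^bsub>V\<^esub> c = \<zero>\<^bsub>V\<^esub>}" and r: "r \<in> carrier R"
    obtain r' where r': "r' \<in> carrier R" "r \<otimes>\<^bsub>R\<^esub> c = c \<otimes>\<^bsub>R\<^esub> r'" using comm[OF r] by blast
    have "(x \<bullet>\<^bsub>V\<^esub> r) \<bullet>\<^bsub>V\<^esub> c = (x \<bullet>\<^bsub>V\<^esub> c) \<bullet>\<^bsub>V\<^esub> r'"
    proof -
      have "(x \<bullet>\<^bsub>V\<^esub> r) \<bullet>\<^bsub>V\<^esub> c = x \<bullet>\<^bsub>V\<^esub> (r \<otimes>\<^bsub>R\<^esub> c)" using x r c by (simp add: V.act_assoc)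
      also have "\<dots> = (x \<bullet>\<^bsub>V\<^esub> c) \<bullet>\<^bsub>V\<^esub> r'" unfolding r'(2) using x r'(1) c by (simp only: V.act_assoc mem_Collect_eq)
      finally show ?thesis .
    qed
    then show "x \<bullet>\<^bsub>V\<^esub> r \<in> {v \<in> carrier V. v \<bullet>\<^bsub>V\<^esub> c = \<zero>\<^bsub>V\<^esub>}"
      using x r r' by (simp add: V.act_closed)
  qed (use c in \<open>auto simp: V.act_add_left\<close>)
  then have "{v \<in> carrier V. v \<bullet>\<^bsub>V\<^esub> c = \<zero>\<^bsub>V\<^esub>} = {\<zero>\<^bsub>V\<^esub>} \<or> {v \<in> carrier V. v \<bullet>\<^bsub>V\<^esub> c = \<zero>\<^bsub>V\<^esub>} = carrier V"
    using V by (simp add: simple_module_def)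
  then show ?thesis by blast
qed

text \<open>\<open>v c\<close> is killed by \<open>c\<close>, so it is zero even if \<open>c\<close>
  acts injectively.\<close>

lemma simple_module_square_zero:
  assumes V: "simple_module R V" and c: "c \<in> carrier R" "c \<otimes>\<^bsub>R\<^esub> c = \<zero>\<^bsub>R\<^esub>"
    and comm: "\<And>r. r \<in> carrier R \<Longrightarrow> \<exists>r'\<in>carrier R. r \<otimes>\<^bsub>R\<^esub> c = c \<otimes>\<^bsub>R\<^esub> r'"
    and v: "v \<in> carrier V"
  shows "v \<bullet>\<^bsub>V\<^esub> c = \<zero>\<^bsub>V\<^esub>"
proof -
  interpret V: right_module R V using V by (simp add: simple_module_def)
  have "(v \<bullet>\<^bsub>V\<^esub> c) \<bullet>\<^bsub>V\<^esub> c = \<zero>\<^bsub>V\<^esub>" using V.act_assoc[OF v c(1) c(1)] c(2) v by simp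
  then show ?thesis
    using simple_module_kernel[OF V c(1) comm] v V.act_closed[OF v c(1)] by auto
qed

section \<open>Chain conditions over Artin algebras\<close>

text \<open>Phrased for an arbitrary predicate on sets, so that it covers submodules over the base
  ring and over \<open>A\<close> as well as right ideals of a ring and of its opposite.\<close>

definition dcc :: "('a set \<Rightarrow> bool) \<Rightarrow> bool" where
  "dcc Q \<longleftrightarrow> (\<forall>I :: nat \<Rightarrow> 'a set. (\<forall>n. Q (I n)) \<and> (\<forall>n. I (Suc n) \<subseteq> I n)
     \<longrightarrow> (\<exists>N. \<forall>n\<ge>N. I n = I N))"

lemma dcc_mono: "dcc Q \<Longrightarrow> (\<And>N. Q' N \<Longrightarrow> Q N) \<Longrightarrow> dcc Q'"
  unfolding dcc_def by blast

text \<open>If every candidate had a strictly smaller one, dependent choice would give a strictly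
  descending sequence.\<close>

lemma dcc_minimal:
  assumes "dcc Q" "Q N0" "T N0"
    and "\<And>N. Q N \<Longrightarrow> T N \<Longrightarrow> (\<And>N'. Q N' \<Longrightarrow> T N' \<Longrightarrow> N' \<subseteq> N \<Longrightarrow> N' = N) \<Longrightarrow> thesis"
  shows thesis
proof (rule ccontr)
  assume nt: "\<not> thesis"
  have *: "\<exists>N'. Q N' \<and> T N' \<and> N' \<subset> N" if N: "Q N" "T N" for N
  proof (rule ccontr)
    assume "\<not> ?thesis"
    then have "N' = N" if "Q N'" "T N'" "N' \<subseteq> N" for N' using that by blast
    then show False using assms(4)[OF N] nt by blast
  qed
  have "\<exists>f. \<forall>n. (Q (f n) \<and> T (f n)) \<and> f (Suc n) \<subset> f n"
    by (rule dependent_nat_choice) (use assms * in blast)+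
  then obtain f where f: "\<And>n. Q (f n)" "\<And>n. f (Suc n) \<subset> f n" by blast
  then obtain N where "\<forall>n\<ge>N. f n = f N" using assms(1) unfolding dcc_def by (metis psubset_imp_subset)
  then show False using f(2)[of N] by (metis le_Suc_eq le_refl psubset_eq)
qed

text \<open>Zorn's lemma for two purposes: with the unit as \<open>v\<close> it yields maximal right
  ideals, and inside a submodule \<open>L\<close> that is not finitely generated it yields the
  analogue of a hyperplane.\<close>

lemma (in right_module) rsub_maximal_avoiding:
  assumes "rsubmodule R N0 M" "N0 \<subseteq> L" "v \<notin> N0"
  obtains N where "rsubmodule R N M" "N0 \<subseteq> N" "N \<subseteq> L" "v \<notin> N"
    "\<And>N'. rsubmodule R N' M \<Longrightarrow> N \<subseteq> N' \<Longrightarrow> N' \<subseteq> L \<Longrightarrow> v \<notin> N' \<Longrightarrow> N' = N"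
proof -
  define A where "A = {N. rsubmodule R N M \<and> N0 \<subseteq> N \<and> N \<subseteq> L \<and> v \<notin> N}"
  have AD: "rsubmodule R N M" "N0 \<subseteq> N" "N \<subseteq> L" "v \<notin> N" if "N \<in> A" for N
    using that by (auto simp: A_def)
  have "\<exists>N\<in>A. \<forall>X\<in>A. N \<subseteq> X \<longrightarrow> X = N"
  proof (rule subset_Zorn_nonempty)
    show "A \<noteq> {}" using assms by (auto simp: A_def)
    fix C assume C: "C \<noteq> {}" "subset.chain A C"
    then have CA: "\<And>N. N \<in> C \<Longrightarrow> N \<in> A" by (auto simp: subset.chain_def)
    have "rsubmodule R (\<Union>C) M"
    proof (rule rsubmoduleI)
      show "\<Union>C \<subseteq> carrier M" using AD(1)[OF CA] rsub_subset[of R _ M] by blast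
      show "\<zero> \<in> \<Union>C" using C(1) AD(1)[OF CA] rsub_zero[of R _ M] by blast
      show "x \<oplus> y \<in> \<Union>C" if xy: "x \<in> \<Union>C" "y \<in> \<Union>C" for x y
      proof -
        obtain X Y where XY: "X \<in> C" "Y \<in> C" "x \<in> X" "y \<in> Y" using xy by blast
        have "X \<subseteq> Y \<or> Y \<subseteq> X"
          by (rule conjunct2[OF C(2)[unfolded subset_chain_def], rule_format]) (use XY in auto)
        then obtain Z where Z: "Z \<in> C" "x \<in> Z" "y \<in> Z" using XY by blast
        then have "rsubmodule R Z M" by (intro AD(1) CA)
        then show ?thesis using rsub_add[of R Z M x y] Z by blast
      qed
      show "x \<bullet> a \<in> \<Union>C" if "x \<in> \<Union>C" "a \<in> carrier R" for x a
        using that AD(1)[OF CA] rsub_act[of R _ M x a] by blast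
    qed
    moreover have "N0 \<subseteq> \<Union>C" using AD(2)[OF CA] C(1) by blast
    moreover have "\<Union>C \<subseteq> L" "v \<notin> \<Union>C" using AD(3,4)[OF CA] by blast+
    ultimately show "\<Union>C \<in> A" by (simp add: A_def)
  qed
  then obtain N where N: "N \<in> A" "\<And>X. X \<in> A \<Longrightarrow> N \<subseteq> X \<Longrightarrow> X = N" by blast
  have "N' = N" if "rsubmodule R N' M" "N \<subseteq> N'" "N' \<subseteq> L" "v \<notin> N'" for N'
    using that AD(2)[OF N(1)] by (intro N(2)) (auto simp: A_def)
  then show ?thesis using that AD[OF N(1)] by blast
qed

lemma additive_subgroup_reg [simp]: "additive_subgroup I (reg_module R) \<longleftrightarrow> additive_subgroup I R"
  by (simp add: additive_subgroup_def subgroup_def m_inv_def reg_module_def)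

lemma right_ideal_iff_rsubmodule: "right_ideal I R \<longleftrightarrow> rsubmodule R I (reg_module R)"
  by (simp add: right_ideal_def rsubmodule_def)

lemma (in cring) ideal_if_rsubmodule:
  assumes "rsubmodule R I (reg_module R)"
  shows "ideal I R"
proof (rule idealI[OF ring_axioms])
  have "additive_subgroup I R" using assms by (simp add: rsubmodule_def)
  then show "subgroup I (add_monoid R)" by (rule additive_subgroup.a_subgroup)
  show "a \<otimes> x \<in> I" if "a \<in> I" "x \<in> carrier R" for a x
    using rsub_act[OF assms that] by simp
  then show "x \<otimes> a \<in> I" if "a \<in> I" "x \<in> carrier R" for a x
    using that rsub_in[OF assms that(1)] m_comm[of x a] by simp
qed

text \<open>Given generators \<open>s\<close>, a submodule is determined inductively by its ideals of leading
  coefficients with respect to \<open>s 0, s 1, \<dots>\<close>.\<close>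

lemma (in right_module) dcc_over_artinian_ring:
  assumes k: "cring R" "artinian_ring R" and fg: "fg_module R M"
  shows "dcc (\<lambda>N. rsubmodule R N M)"
  unfolding dcc_def
proof (intro allI impI)
  interpret k: cring R by fact
  interpret reg: right_module R "reg_module R" by (rule R.right_module_reg)
  fix H :: "nat \<Rightarrow> 'b set"
  assume H: "(\<forall>n. rsubmodule R (H n) M) \<and> (\<forall>n. H (Suc n) \<subseteq> H n)"
  then have Hs: "rsubmodule R (H n) M" for n by blast
  have Hmono: "H j \<subseteq> H i" if "i \<le> j" for i j using H lift_Suc_antimono_le[of H] that by blast
  obtain S where S: "finite S" "S \<subseteq> carrier M" "\<And>N. rsubmodule R N M \<Longrightarrow> S \<subseteq> N \<Longrightarrow> N = carrier M"
    using fg by (auto simp: fg_module_def)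
  obtain m and s :: "nat \<Rightarrow> 'b" where s: "S = s ` {i. i < m}"
    using finite_imp_nat_seg_image_inj_on[OF S(1)] by blast
  have sM: "s i \<in> carrier M" if "i < m" for i using that S(2) s by auto
  \<comment> \<open>\<open>Sp i\<close> is the submodule spanned by the first \<open>i\<close>
    generators, so that \<open>Sp m\<close> is all of \<open>M\<close>.\<close>
  define Sp where "Sp = rec_nat {\<zero>} (\<lambda>i Y. {y \<oplus> s i \<bullet> c | y c. y \<in> Y \<and> c \<in> carrier R})"
  have Sp0: "Sp 0 = {\<zero>}" and SpS: "Sp (Suc i) = {y \<oplus> s i \<bullet> c | y c. y \<in> Sp i \<and> c \<in> carrier R}" for i
    by (simp_all add: Sp_def)
  have Sp: "rsubmodule R (Sp i) M" if "i \<le> m" for i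
    using that
  proof (induction i)
    case 0
    then show ?case by (simp add: Sp0 rsub_triv)
  next
    case (Suc i)
    then have Y: "rsubmodule R (Sp i) M" and si: "s i \<in> carrier M" using sM by auto
    have "Sp (Suc i) = Sp i <+>\<^bsub>M\<^esub> ((\<lambda>c. s i \<bullet> c) ` carrier R)"
      unfolding SpS set_eq_iff mem_set_add by blast
    then show ?case using rsub_set_add[OF Y rsub_cyclic[OF si]] by simp
  qed
  have SpI: "y \<in> Sp (Suc i)" if "y \<in> Sp i" "i < m" for y i
    using that rsub_in[OF Sp[of i] that(1)] sM[OF that(2)] unfolding SpS by force
  have s_Sp: "s i \<in> Sp (Suc i)" if "i < m" for i
    unfolding SpS using rsub_zero[OF Sp[of i]] that sM[OF that]
    by (auto intro!: exI[of _ "\<zero>"] exI[of _ "\<one>\<^bsub>R\<^esub>"] simp: act_one)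
  have "i < j \<Longrightarrow> j \<le> m \<Longrightarrow> s i \<in> Sp j" for i j
  proof (induction j)
    case (Suc j)
    then show ?case using s_Sp[of i] SpI[of "s i" j] by (cases "i = j") auto
  qed simp
  then have "S \<subseteq> Sp m" using s by auto
  then have Spm: "Sp m = carrier M" using S(3) Sp by blast
  define I where "I i j = {c \<in> carrier R. \<exists>y\<in>Sp i. y \<oplus> s i \<bullet> c \<in> H j}" for i j
  have I: "ideal (I i j) R" if "i < m" for i j
  proof (rule k.ideal_if_rsubmodule[OF reg.rsubmoduleI])
    note si = sM[OF that] and Y = Sp[of i]
    show "I i j \<subseteq> carrier (reg_module R)" by (auto simp: I_def)
    show "\<zero>\<^bsub>reg_module R\<^esub> \<in> I i j"
      using rsub_zero[OF Y] rsub_zero[OF Hs] that si by (auto simp: I_def intro!: bexI[of _ \<zero>])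
    show "c \<oplus>\<^bsub>reg_module R\<^esub> d \<in> I i j" if cd: "c \<in> I i j" "d \<in> I i j" for c d
    proof -
      obtain y z where yz: "y \<in> Sp i" "z \<in> Sp i" "y \<oplus> s i \<bullet> c \<in> H j" "z \<oplus> s i \<bullet> d \<in> H j"
        "c \<in> carrier R" "d \<in> carrier R" using cd by (auto simp: I_def)
      have "y \<in> carrier M" "z \<in> carrier M" using yz rsub_in[OF Y] \<open>i < m\<close> by auto
      then have "(y \<oplus> s i \<bullet> c) \<oplus> (z \<oplus> s i \<bullet> d) = (y \<oplus> z) \<oplus> s i \<bullet> (c \<oplus>\<^bsub>R\<^esub> d)"
        using yz(5,6) si act_closed[OF si] by (simp add: act_add_right a_ac)
      then show ?thesis using yz rsub_add[OF Hs yz(3,4)] rsub_add[OF Y, of y z] \<open>i < m\<close>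
        by (auto simp: I_def)
    qed
    show "c \<bullet>\<^bsub>reg_module R\<^esub> a \<in> I i j" if ca: "c \<in> I i j" "a \<in> carrier R" for c a
    proof -
      obtain y where y: "y \<in> Sp i" "y \<oplus> s i \<bullet> c \<in> H j" "c \<in> carrier R" using ca by (auto simp: I_def)
      have "y \<in> carrier M" using y rsub_in[OF Y] \<open>i < m\<close> by auto
      then have "(y \<oplus> s i \<bullet> c) \<bullet> a = y \<bullet> a \<oplus> s i \<bullet> (c \<otimes>\<^bsub>R\<^esub> a)"
        using y(3) si ca(2) by (simp add: act_add_left act_assoc act_closed)
      then show ?thesis using y ca rsub_act[OF Hs y(2) ca(2)] rsub_act[OF Y, of y a] \<open>i < m\<close>
        by (auto simp: I_def)
    qed
  qed
  \<comment> \<open>By induction the chain becomes stationary on each \<open>Sp i\<close>. For the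
    next span it has to be stationary on \<open>Sp i\<close>, which is true from \<open>N1\<close>
    on, and so have its leading coefficients at \<open>s i\<close>, from \<open>N2\<close>
    on.\<close>
  have "\<exists>N. \<forall>j\<ge>N. H N \<inter> Sp i \<subseteq> H j" if "i \<le> m" for i
    using that
  proof (induction i)
    case 0
    then show ?case using rsub_zero[OF Hs] by (auto simp: Sp0)
  next
    case (Suc i)
    then obtain N1 where N1: "\<And>j. j \<ge> N1 \<Longrightarrow> H N1 \<inter> Sp i \<subseteq> H j" by auto
    have "I i (Suc j) \<subseteq> I i j" for j using H unfolding I_def by blast
    then obtain N2 where N2: "\<And>j. j \<ge> N2 \<Longrightarrow> I i j = I i N2"
      using k(2) I[of i] Suc.prems unfolding artinian_ring_def by (metis Suc_le_lessD)
    define N where "N = max N1 N2"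
    have "H N \<inter> Sp (Suc i) \<subseteq> H j" if j: "j \<ge> N" for j
    proof
      have i: "i < m" using Suc.prems by simp
      fix x assume "x \<in> H N \<inter> Sp (Suc i)"
      then obtain y c where x: "x \<in> H N" "x = y \<oplus> s i \<bullet> c" "y \<in> Sp i" "c \<in> carrier R"
        unfolding SpS by blast
      then have "c \<in> I i N" by (auto simp: I_def)
      then have "c \<in> I i j" using N2[of N] N2[of j] j by (simp add: N_def)
      then obtain y' where y': "y' \<in> Sp i" "y' \<oplus> s i \<bullet> c \<in> H j" by (auto simp: I_def)
      have c: "y \<in> carrier M" "y' \<in> carrier M" "s i \<bullet> c \<in> carrier M"
        using rsub_in[OF Sp[of i]] x y'(1) i act_closed[OF sM[OF i]] by auto
      \<comment> \<open>An element of \<open>H j\<close> with the same leading coefficient is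
        subtracted; the leading terms cancel, and the difference lies in \<open>Sp i\<close>, where
        the induction hypothesis applies.\<close>
      have eq: "x \<ominus> (y' \<oplus> s i \<bullet> c) = y \<ominus> y'"
        using c by (simp add: x(2) a_minus_def a_ac minus_add r_neg2 r_neg1 r_neg)
      have "y \<ominus> y' \<in> H N1"
        using rsub_diff[OF Hs Hmono[THEN subsetD, OF _ x(1)] Hmono[THEN subsetD, OF _ y'(2)], of N1] j
        unfolding eq by (simp add: N_def)
      moreover have "y \<ominus> y' \<in> Sp i" using rsub_diff[OF Sp _ _, of i y y'] x y' i by simp
      ultimately have "y \<ominus> y' \<in> H j" using N1[of j] j by (auto simp: N_def)
      moreover have "x = (y \<ominus> y') \<oplus> (y' \<oplus> s i \<bullet> c)"
        using c by (simp add: x(2) a_minus_def a_assoc r_neg1)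
      ultimately show "x \<in> H j" using rsub_add[OF Hs _ y'(2)] by simp
    qed
    then show ?case by blast
  qed
  then obtain N where N: "\<And>j. j \<ge> N \<Longrightarrow> H N \<inter> carrier M \<subseteq> H j" using Spm by (metis le_refl)
  then have "H j = H N" if "j \<ge> N" for j
    using Hmono[OF that] N[OF that] rsub_subset[OF Hs[of N]] by blast
  then show "\<exists>N. \<forall>n\<ge>N. H n = H N" by blast
qed

text \<open>Expressed by the submodules of the ambient \<open>M\<close> rather than those of
  \<open>restrict_module M L\<close>; since they need not lie in \<open>L\<close>, inclusion
  replaces equality.\<close>

definition fg_rsub :: "('a, 'c) ring_scheme \<Rightarrow> ('a, 'b) rmodule \<Rightarrow> 'b set \<Rightarrow> bool" where
  "fg_rsub R M L \<longleftrightarrow> (\<exists>S. finite S \<and> S \<subseteq> L \<and> (\<forall>N. rsubmodule R N M \<and> S \<subseteq> N \<longrightarrow> L \<subseteq> N))"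

lemma fg_rsubE:
  assumes "fg_rsub R M L"
  obtains S where "finite S" "S \<subseteq> L" "\<And>N. rsubmodule R N M \<Longrightarrow> S \<subseteq> N \<Longrightarrow> L \<subseteq> N"
proof -
  obtain S where "finite S" "S \<subseteq> L" "\<forall>N. rsubmodule R N M \<and> S \<subseteq> N \<longrightarrow> L \<subseteq> N"
    using assms unfolding fg_rsub_def by (elim exE conjE)
  then show ?thesis by (intro that[of S]) simp_all
qed

text \<open>On a minimal submodule \<open>L\<close> that is not finitely generated, every scalar acts as zero or onto;
  hence \<open>L\<close> is a vector space over the quotient by its annihilator, and it has a hyperplane.\<close>

lemma (in right_module) fg_rsub_over_artinian_ring:
  assumes k: "cring R" "artinian_ring R" and dcc: "dcc (\<lambda>N. rsubmodule R N M)" and "rsubmodule R L M"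
  shows "fg_rsub R M L"
proof (rule ccontr)
  interpret k: cring R by fact
  interpret reg: right_module R "reg_module R" by (rule R.right_module_reg)
  assume "\<not> fg_rsub R M L"
  then obtain L where L: "rsubmodule R L M" "\<not> fg_rsub R M L"
    and minL: "\<And>N'. rsubmodule R N' M \<Longrightarrow> \<not> fg_rsub R M N' \<Longrightarrow> N' \<subseteq> L \<Longrightarrow> N' = L"
    using dcc_minimal[OF dcc assms(4), of "\<lambda>L. \<not> fg_rsub R M L"] by blast
  have LM: "x \<in> carrier M" if "x \<in> L" for x using rsub_in[OF L(1) that] .
  have act_hom: "rmod_hom R M M (\<lambda>x. x \<bullet> c)" if c: "c \<in> carrier R" for c
  proof (intro rmod_homI rmodule_homI right_module_axioms)
    show "x \<bullet> a \<bullet> c = x \<bullet> c \<bullet> a" if "x \<in> carrier M" "a \<in> carrier R" for x a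
      using that c k.m_comm by (simp flip: act_assoc)
  qed (use c in \<open>auto simp: act_closed act_add_left\<close>)
  \<comment> \<open>Otherwise the image and the kernel of \<open>c\<close> on \<open>L\<close> are
    both proper submodules of \<open>L\<close>, hence finitely generated by minimality. Preimages of
    generators of the image, together with generators of the kernel, would then generate
    \<open>L\<close>.\<close>
  have onto: "(\<lambda>x. x \<bullet> c) ` L = L" if c: "c \<in> carrier R" and nz: "\<not> (\<forall>x\<in>L. x \<bullet> c = \<zero>)" for c
  proof (rule ccontr)
    interpret c: rmod_hom R M M "\<lambda>x. x \<bullet> c" by (rule act_hom[OF c])
    let ?cL = "(\<lambda>x. x \<bullet> c) ` L" and ?K = "{x \<in> L. x \<bullet> c = \<zero>}"
    assume "?cL \<noteq> L"
    moreover have "?cL \<subseteq> L" using rsub_act[OF L(1) _ c] by blast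
    ultimately have "fg_rsub R M ?cL" using minL[OF c.rsub_image[OF L(1)]] by blast
    then obtain S2 where S2: "finite S2" "S2 \<subseteq> ?cL" "\<And>N. rsubmodule R N M \<Longrightarrow> S2 \<subseteq> N \<Longrightarrow> ?cL \<subseteq> N"
      by (rule fg_rsubE) blast
    obtain T where T: "T \<subseteq> L" "finite T" "S2 = (\<lambda>x. x \<bullet> c) ` T"
      using finite_subset_image[OF S2(1,2)] by blast
    have K: "rsubmodule R ?K M"
    proof -
      have "?K = L \<inter> {x \<in> carrier M. x \<bullet> c \<in> {\<zero>}}" using LM by blast
      then show ?thesis using rsub_Int[OF L(1) c.rsub_vimage[OF rsub_triv]] by simp
    qed
    moreover have "?K \<noteq> L" using nz by blast
    ultimately have "fg_rsub R M ?K" using minL[OF K] by blast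
    then obtain S1 where S1: "finite S1" "S1 \<subseteq> ?K" "\<And>N. rsubmodule R N M \<Longrightarrow> S1 \<subseteq> N \<Longrightarrow> ?K \<subseteq> N"
      by (rule fg_rsubE) blast
    have "L \<subseteq> N" if N: "rsubmodule R N M" "S1 \<union> T \<subseteq> N" for N
    proof
      fix x assume x: "x \<in> L"
      have NL: "rsubmodule R (N \<inter> L) M" by (rule rsub_Int[OF N(1) L(1)])
      have "?cL \<subseteq> (\<lambda>x. x \<bullet> c) ` (N \<inter> L)"
        using T N(2) by (intro S2(3)[OF c.rsub_image[OF NL]]) auto
      then obtain n where n: "n \<in> N" "n \<in> L" "x \<bullet> c = n \<bullet> c" using x by blast
      then have "(x \<ominus> n) \<bullet> c = \<zero>" using x LM c.diff[of x n] by (simp add: a_minus_def r_neg act_closed c)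
      then have "x \<ominus> n \<in> N" using rsub_diff[OF L(1) x n(2)] S1(3)[OF N(1)] N(2) by blast
      then show "x \<in> N" using rsub_add[OF N(1) _ n(1), of "x \<ominus> n"] LM[OF x] LM[OF n(2)]
        by (simp add: a_minus_def a_assoc l_neg)
    qed
    then have "fg_rsub R M L" unfolding fg_rsub_def using S1(1,2) T(1,2)
      by (intro exI[of _ "S1 \<union> T"]) blast
    then show False using L(2) by blast
  qed
  \<comment> \<open>The ideals generated by the powers of \<open>c\<close> become stationary, so
    \<open>c^N = c^(N+1) r\<close> for some \<open>N\<close> and \<open>r\<close>. Since
    \<open>c^N\<close> maps \<open>L\<close> onto \<open>L\<close>, the product \<open>c r\<close>
    acts as the identity.\<close>
  have inverse: "\<exists>r\<in>carrier R. \<forall>x\<in>L. x \<bullet> (c \<otimes>\<^bsub>R\<^esub> r) = x"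
    if c: "c \<in> carrier R" and nz: "\<not> (\<forall>x\<in>L. x \<bullet> c = \<zero>)" for c
  proof -
    define J where "J n = (\<lambda>r. c [^]\<^bsub>R\<^esub> n \<otimes>\<^bsub>R\<^esub> r) ` carrier R" for n :: nat
    have cn: "c [^]\<^bsub>R\<^esub> (n::nat) \<in> carrier R" for n using c by simp
    have "ideal (J n) R" for n
    proof (rule k.ideal_if_rsubmodule[OF reg.rsubmoduleI])
      show "\<zero>\<^bsub>reg_module R\<^esub> \<in> J n" using cn by (auto simp: J_def intro!: image_eqI[of _ _ "\<zero>\<^bsub>R\<^esub>"])
    qed (use cn in \<open>auto simp: J_def R.m_assoc simp flip: R.r_distr\<close>)
    moreover have "J (Suc n) \<subseteq> J n" for n using c cn[of n] by (auto simp: J_def R.m_assoc)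
    ultimately obtain N where N: "\<And>n. n \<ge> N \<Longrightarrow> J n = J N" using k(2) unfolding artinian_ring_def by metis
    have "J N \<subseteq> J (Suc N)" using N[of "Suc N"] by (metis le_refl le_SucI order_refl)
    moreover have "c [^]\<^bsub>R\<^esub> N \<in> J N" using cn[of N] by (auto simp: J_def intro!: image_eqI[of _ _ "\<one>\<^bsub>R\<^esub>"])
    ultimately obtain r where r: "r \<in> carrier R" "c [^]\<^bsub>R\<^esub> N = c [^]\<^bsub>R\<^esub> Suc N \<otimes>\<^bsub>R\<^esub> r" unfolding J_def by blast
    have cnL: "(\<lambda>x. x \<bullet> c [^]\<^bsub>R\<^esub> n) ` L = L" for n :: nat
    proof (induction n)
      case 0
      then show ?case using LM by (simp add: act_one)
    next
      case (Suc n)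
      have "(\<lambda>x. x \<bullet> c [^]\<^bsub>R\<^esub> Suc n) ` L = (\<lambda>x. x \<bullet> c) ` (\<lambda>x. x \<bullet> c [^]\<^bsub>R\<^esub> n) ` L"
        using LM cn[of n] c by (auto simp: image_image act_assoc)
      then show ?case by (simp only: Suc onto[OF c nz])
    qed
    have "x \<bullet> (c \<otimes>\<^bsub>R\<^esub> r) = x" if "x \<in> L" for x
    proof -
      have "x \<in> (\<lambda>x. x \<bullet> c [^]\<^bsub>R\<^esub> N) ` L" using cnL[of N] that by simp
      then obtain y where y: "y \<in> L" "x = y \<bullet> c [^]\<^bsub>R\<^esub> N" by blast
      have "x \<bullet> (c \<otimes>\<^bsub>R\<^esub> r) = y \<bullet> (c [^]\<^bsub>R\<^esub> Suc N \<otimes>\<^bsub>R\<^esub> r)"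
        using y(2) LM[OF y(1)] c r(1) cn[of N] by (simp add: R.m_assoc act_assoc act_closed)
      also have "\<dots> = y \<bullet> c [^]\<^bsub>R\<^esub> N" by (simp only: r(2)[symmetric])
      finally show ?thesis by (simp only: y(2)[symmetric])
    qed
    then show ?thesis using r(1) by blast
  qed
  have "\<exists>v\<in>L. v \<noteq> \<zero>"
  proof (rule ccontr)
    assume "\<not> ?thesis"
    then have "L \<subseteq> {\<zero>}" by blast
    then have "L \<subseteq> N" if "rsubmodule R N M" for N using rsub_zero[OF that] by blast
    then have "fg_rsub R M L" unfolding fg_rsub_def by (intro exI[of _ "{}"]) simp
    then show False using L(2) by blast
  qed
  then obtain v where v: "v \<in> L" "v \<noteq> \<zero>" by blast
  \<comment> \<open>\<open>L'\<close> is proper, hence finitely generated, and together with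
    \<open>v\<close> it will generate \<open>L\<close>: for \<open>w\<close> in \<open>L\<close>
    outside \<open>L'\<close>, maximality puts \<open>v\<close> into \<open>L' + w R\<close>, and
    the coefficient of \<open>w\<close> can be inverted.\<close>
  obtain L' where L': "rsubmodule R L' M" "L' \<subseteq> L" "v \<notin> L'"
    and maxL': "\<And>N'. rsubmodule R N' M \<Longrightarrow> L' \<subseteq> N' \<Longrightarrow> N' \<subseteq> L \<Longrightarrow> v \<notin> N' \<Longrightarrow> N' = L'"
    by (rule rsub_maximal_avoiding[OF rsub_triv, of L v]) (use v rsub_zero[OF L(1)] in blast)+
  have "fg_rsub R M L'" using minL[OF L'(1) _ L'(2)] L'(3) v(1) by blast
  then obtain S where S: "finite S" "S \<subseteq> L'" "\<And>N. rsubmodule R N M \<Longrightarrow> S \<subseteq> N \<Longrightarrow> L' \<subseteq> N"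
    by (rule fg_rsubE) blast
  have "L \<subseteq> N" if N: "rsubmodule R N M" "insert v S \<subseteq> N" for N
  proof
    fix w assume w: "w \<in> L"
    have L'N: "L' \<subseteq> N" using S(3)[OF N(1)] N(2) by blast
    show "w \<in> N"
    proof (cases "w \<in> L'")
      case False
      have wM: "w \<in> carrier M" using LM w .
      let ?W = "(\<lambda>c. w \<bullet> c) ` carrier R"
      have W: "rsubmodule R ?W M" and w1: "w \<in> ?W" using rsub_cyclic[OF wM] cyclic_self[OF wM] .
      let ?N = "L' <+>\<^bsub>M\<^esub> ?W"
      have N': "rsubmodule R ?N M" by (rule rsub_set_add[OF L'(1) W])
      have "L' \<subseteq> ?N"
      proof
        fix l assume "l \<in> L'"
        then have "l = l \<oplus> \<zero>" using rsub_in[OF L'(1)] by simp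
        then show "l \<in> ?N" unfolding mem_set_add using \<open>l \<in> L'\<close> rsub_zero[OF W] by blast
      qed
      moreover have "?N \<subseteq> L"
        using rsub_act[OF L(1) w] rsub_add[OF L(1) subsetD[OF L'(2)]] by (auto simp: mem_set_add)
      moreover have "w \<in> ?N"
      proof -
        have "w = \<zero> \<oplus> w" using wM by simp
        then show ?thesis unfolding mem_set_add using w1 rsub_zero[OF L'(1)] by blast
      qed
      ultimately have "v \<in> ?N" using maxL'[OF N'] False by blast
      then obtain l c where lc: "l \<in> L'" "c \<in> carrier R" "v = l \<oplus> w \<bullet> c" unfolding mem_set_add by blast
      have lM: "l \<in> carrier M" using rsub_in[OF L'(1) lc(1)] .
      have "\<not> (\<forall>x\<in>L. x \<bullet> c = \<zero>)"
      proof
        assume "\<forall>x\<in>L. x \<bullet> c = \<zero>"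
        then have "v = l" using lc w lM by simp
        then show False using lc(1) L'(3) by simp
      qed
      then obtain r where r: "r \<in> carrier R" "w \<bullet> (c \<otimes>\<^bsub>R\<^esub> r) = w" using inverse[OF lc(2)] w by blast
      have "w \<bullet> c = v \<ominus> l" using lc(2,3) lM wM act_closed by (simp add: a_minus_def a_ac r_neg2 r_neg1 r_neg)
      moreover have "v \<ominus> l \<in> N" using rsub_diff[OF N(1)] N(2) L'N lc(1) by blast
      ultimately have "(w \<bullet> c) \<bullet> r \<in> N" using rsub_act[OF N(1) _ r(1)] by simp
      then show ?thesis using r wM lc(2) by (simp add: act_assoc)
    qed (use L'N in blast)
  qed
  then have "fg_rsub R M L" unfolding fg_rsub_def using S(1,2) L'(2) v(1)
    by (intro exI[of _ "insert v S"]) blast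
  then show False using L(2) by blast
qed

section \<open>Finitely generated modules over an Artin algebra and their projective covers\<close>

context artin_algebra
begin

lemma right_module_base: "right_module A M \<Longrightarrow> right_module k (restr_scalars \<phi> M)"
  by (rule right_module_restr_scalars[OF k.ring_axioms structure_hom])

text \<open>The products of module generators with generators of \<open>A\<close> over the base ring
  suffice, because central scalars can be moved past the latter.\<close>

lemma fg_module_base:
  assumes "fg_module A M"
  shows "fg_module k (restr_scalars \<phi> M)"
proof -
  interpret M: right_module A M using assms by (rule fg_module_right_module)
  interpret Mk: right_module k "restr_scalars \<phi> M" by (rule right_module_base[OF M.right_module_axioms])
  note \<phi> = ring_hom_closed[OF structure_hom]
  obtain X where X: "finite X" "X \<subseteq> carrier M" "\<And>N. rsubmodule A N M \<Longrightarrow> X \<subseteq> N \<Longrightarrow> N = carrier M"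
    using assms by (auto simp: fg_module_def)
  obtain S where S: "finite S" "S \<subseteq> carrier A"
    "\<forall>a\<in>carrier A. \<exists>c \<in> S \<rightarrow> carrier k. a = (\<Oplus>\<^bsub>A\<^esub>s\<in>S. \<phi> (c s) \<otimes>\<^bsub>A\<^esub> s)"
    using finitely_generated_over_base by blast
  let ?X = "(\<lambda>(x, s). x \<bullet>\<^bsub>M\<^esub> s) ` (X \<times> S)"
  have "N = carrier M" if N: "rsubmodule k N (restr_scalars \<phi> M)" "?X \<subseteq> N" for N
  proof -
    \<comment> \<open>The largest \<open>A\<close>-submodule inside the \<open>k\<close>-submodule
      \<open>N\<close>.\<close>
    let ?N = "{m \<in> carrier M. \<forall>a\<in>carrier A. m \<bullet>\<^bsub>M\<^esub> a \<in> N}"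
    have "rsubmodule A ?N M"
      using rsub_zero[OF N(1)] rsub_add[OF N(1)]
      by (intro M.rsubmoduleI) (auto simp: M.act_closed M.act_add_left simp flip: M.act_assoc)
    moreover have "X \<subseteq> ?N"
    proof
      fix x assume x: "x \<in> X"
      then have xM: "x \<in> carrier M" using X by blast
      have "x \<bullet>\<^bsub>M\<^esub> a \<in> N" if a: "a \<in> carrier A" for a
      proof -
        obtain c where c: "c \<in> S \<rightarrow> carrier k" "a = (\<Oplus>\<^bsub>A\<^esub>s\<in>S. \<phi> (c s) \<otimes>\<^bsub>A\<^esub> s)"
          using S(3) a by blast
        have cs: "\<phi> (c s) \<in> carrier A" "s \<in> carrier A" "c s \<in> carrier k" if "s \<in> S" for s
          using that c(1) \<phi> S(2) by auto
        have "x \<bullet>\<^bsub>M\<^esub> a = (\<Oplus>\<^bsub>restr_scalars \<phi> M\<^esub>s\<in>S. x \<bullet>\<^bsub>M\<^esub> (\<phi> (c s) \<otimes>\<^bsub>A\<^esub> s))"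
          unfolding c(2) using cs xM S(1)
          by (intro additive_finsum A.abelian_group_axioms Mk.abelian_group_axioms)
            (auto simp: M.act_closed M.act_add_right)
        also have "\<dots> \<in> N"
        proof (rule Mk.rsub_finsum[OF N(1) S(1)], rule Pi_I)
          fix s assume s: "s \<in> S"
          have "x \<bullet>\<^bsub>M\<^esub> (\<phi> (c s) \<otimes>\<^bsub>A\<^esub> s) = (x \<bullet>\<^bsub>M\<^esub> s) \<bullet>\<^bsub>M\<^esub> \<phi> (c s)"
            using cs[OF s] xM by (simp add: structure_central M.act_assoc)
          moreover have "x \<bullet>\<^bsub>M\<^esub> s \<in> N" using N(2) x s by auto
          ultimately show "x \<bullet>\<^bsub>M\<^esub> (\<phi> (c s) \<otimes>\<^bsub>A\<^esub> s) \<in> N"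
            using rsub_act[OF N(1), of "x \<bullet>\<^bsub>M\<^esub> s" "c s"] cs[OF s] by simp
        qed
        finally show ?thesis .
      qed
      then show "x \<in> ?N" using xM by blast
    qed
    ultimately have "?N = carrier M" by (rule X(3))
    then have "carrier M \<subseteq> N" using M.act_one by force
    then show ?thesis using rsub_subset[OF N(1)] by auto
  qed
  moreover have "?X \<subseteq> carrier M" using X(2) S(2) M.act_closed by auto
  ultimately show ?thesis
    unfolding fg_module_def using Mk.right_module_axioms X(1) S(1)
    by (intro conjI exI[of _ ?X]) auto
qed

lemma dcc_base:
  assumes "fg_module A M"
  shows "dcc (\<lambda>N. rsubmodule k N (restr_scalars \<phi> M))"
proof -
  interpret Mk: right_module k "restr_scalars \<phi> M"
    by (rule right_module_base[OF fg_module_right_module[OF assms]])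
  show ?thesis by (rule Mk.dcc_over_artinian_ring[OF k.is_cring artinian_base fg_module_base[OF assms]])
qed

lemma dcc_rsubmodule:
  assumes "fg_module A M"
  shows "dcc (\<lambda>N. rsubmodule A N M)"
  by (rule dcc_mono[OF dcc_base[OF assms]])
    (rule rsub_restr_scalars[OF k.ring_axioms structure_hom fg_module_right_module[OF assms]])

text \<open>Finitely generated modules are Noetherian: generators over the base ring also generate
  over \<open>A\<close>, as every \<open>A\<close>-submodule is a
  \<open>k\<close>-submodule.\<close>

lemma fg_rsubmodule:
  assumes "fg_module A M" "rsubmodule A L M"
  shows "fg_rsub A M L"
proof -
  have M: "right_module A M" by (rule fg_module_right_module[OF assms(1)])
  interpret Mk: right_module k "restr_scalars \<phi> M" by (rule right_module_base[OF M])
  note r = rsub_restr_scalars[OF k.ring_axioms structure_hom M]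
  have "fg_rsub k (restr_scalars \<phi> M) L"
    by (rule Mk.fg_rsub_over_artinian_ring[OF k.is_cring artinian_base dcc_base[OF assms(1)] r[OF assms(2)]])
  then obtain S where "finite S" "S \<subseteq> L"
    and S: "\<And>N. rsubmodule k N (restr_scalars \<phi> M) \<Longrightarrow> S \<subseteq> N \<Longrightarrow> L \<subseteq> N"
    by (rule fg_rsubE) blast
  moreover have "L \<subseteq> N" if "rsubmodule A N M \<and> S \<subseteq> N" for N
    using that by (intro S r) auto
  ultimately show ?thesis unfolding fg_rsub_def by (intro exI[of _ S]) simp
qed

lemma fg_module_rsub:
  assumes "fg_module A M" "rsubmodule A L M"
  shows "fg_module A (restrict_module M L)"
proof -
  interpret M: right_module A M using assms(1) by (rule fg_module_right_module)
  show ?thesis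
  proof (rule fg_rsubE[OF fg_rsubmodule[OF assms]])
    fix S assume S: "finite S" "S \<subseteq> L" "\<And>N. rsubmodule A N M \<Longrightarrow> S \<subseteq> N \<Longrightarrow> L \<subseteq> N"
    have "N = L" if "rsubmodule A N (restrict_module M L)" "S \<subseteq> N" for N
      using that S(3)[of N] by (auto simp: M.rsub_restrict_iff[OF assms(2)])
    then show ?thesis
      unfolding fg_module_def using S(1,2) M.right_module_restrict[OF assms(2)]
      by (intro conjI exI[of _ S]) simp_all
  qed
qed

text \<open>The kernels of the powers of \<open>h\<close> ascend, and their union is finitely
  generated, hence equal to the kernel of some \<open>h^m\<close>. Write \<open>x\<close> as
  \<open>h^m y\<close>; then \<open>y\<close> is killed by \<open>h^(m+1)\<close>, so already by
  \<open>h^m\<close>, and \<open>x\<close> is zero.\<close>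

lemma surjective_endo_injective:
  assumes "fg_module A M" "h \<in> rmodule_hom A M M" "h ` carrier M = carrier M"
    and x: "x \<in> carrier M" "h x = \<zero>\<^bsub>M\<^esub>"
  shows "x = \<zero>\<^bsub>M\<^esub>"
proof -
  interpret M: right_module A M using assms(1) by (rule fg_module_right_module)
  interpret h: rmod_hom A M M h using assms(2) by (intro rmod_homI M.right_module_axioms)
  have hn: "h ^^ n \<in> rmodule_hom A M M" for n
  proof (induction n)
    case 0
    then show ?case using hom_id[of A M] by (simp add: id_def)
  next
    case (Suc n)
    then show ?case using hom_comp[OF Suc assms(2)] by (simp add: o_def)
  qed
  interpret hn: rmod_hom A M M "h ^^ n" for n using hn by (intro rmod_homI M.right_module_axioms)
  have onto: "(h ^^ n) ` carrier M = carrier M" for n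
  proof (induction n)
    case (Suc n)
    have "(h ^^ Suc n) ` carrier M = h ` (h ^^ n) ` carrier M" by (simp add: image_comp)
    then show ?case using Suc assms(3) by simp
  qed simp
  define U where "U n = a_kernel M M (h ^^ n)" for n
  have U: "rsubmodule A (U n) M" for n unfolding U_def by (rule hn.rsub_kernel)
  have Ueq: "U n = {x \<in> carrier M. (h ^^ n) x = \<zero>\<^bsub>M\<^esub>}" for n unfolding U_def by (rule hn.kernel_eq)
  have Umono: "U n \<subseteq> U (Suc n)" for n by (auto simp: Ueq)
  then have Um: "U n \<subseteq> U m" if "n \<le> m" for n m using lift_Suc_mono_le[of U] that by blast
  have "rsubmodule A (\<Union>n. U n) M"
  proof (rule M.rsubmoduleI)
    show "x \<oplus>\<^bsub>M\<^esub> y \<in> (\<Union>n. U n)" if "x \<in> (\<Union>n. U n)" "y \<in> (\<Union>n. U n)" for x y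
    proof -
      obtain n m where "x \<in> U n" "y \<in> U m" using \<open>x \<in> _\<close> \<open>y \<in> _\<close> by blast
      then have "x \<in> U (max n m)" "y \<in> U (max n m)" using Um by (meson max.cobounded1 max.cobounded2 subsetD)+
      then show ?thesis using rsub_add[OF U] by blast
    qed
  qed (auto dest: rsub_in[OF U] intro: rsub_zero[OF U] rsub_act[OF U])
  then obtain S where S: "finite S" "S \<subseteq> (\<Union>n. U n)" "\<And>N. rsubmodule A N M \<Longrightarrow> S \<subseteq> N \<Longrightarrow> (\<Union>n. U n) \<subseteq> N"
    by (rule fg_rsubE[OF fg_rsubmodule[OF assms(1)]]) blast
  have "\<exists>m. S \<subseteq> U m" using S(1,2)
  proof (induction S rule: finite_induct)
    case (insert y S)
    then obtain m n where "S \<subseteq> U m" "y \<in> U n" by auto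
    then have "insert y S \<subseteq> U (max m n)" using Um[of m "max m n"] Um[of n "max m n"] by auto
    then show ?case ..
  qed simp
  then obtain m where m: "(\<Union>n. U n) \<subseteq> U m" using S(3)[OF U] by blast
  obtain y where y: "y \<in> carrier M" "x = (h ^^ m) y" using onto[of m] x(1) by (metis imageE)
  then have "y \<in> U (Suc m)" using x(2) by (simp add: Ueq)
  then have "y \<in> U m" using m by blast
  then show ?thesis using y by (simp add: Ueq)
qed

text \<open>Inside a free module \<open>F\<close> mapping onto \<open>X\<close>, a submodule \<open>N\<close> minimal among those that map onto
  \<open>X\<close> is the cover: a lift \<open>F \<rightarrow> N\<close> of the map to \<open>X\<close> restricts to an automorphism of \<open>N\<close>.\<close>

lemma projective_cover_exists:
  assumes "fg_module A X"
  obtains P :: "('a, nat \<Rightarrow> 'a) rmodule" and p where "projective_cover A P p X"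
proof -
  interpret X: right_module A X using assms by (rule fg_module_right_module)
  obtain n \<pi> where \<pi>: "\<pi> \<in> rmodule_hom A (free_module A n) X" "\<pi> ` carrier (free_module A n) = carrier X"
    using assms fg_module_iff_free_image[OF X.right_module_axioms] by blast
  let ?F = "free_module A n"
  have F: "fg_projective A ?F" by (rule fg_projective_free[OF A.ring_axioms])
  interpret F: right_module A ?F by (rule fg_projective_right_module[OF F])
  obtain N where N: "rsubmodule A N ?F" "\<pi> ` N = carrier X"
    and minN: "\<And>N'. rsubmodule A N' ?F \<Longrightarrow> \<pi> ` N' = carrier X \<Longrightarrow> N' \<subseteq> N \<Longrightarrow> N' = N"
    using dcc_minimal[OF dcc_rsubmodule[OF fg_projective_imp_fg[OF F]] F.rsub_carrier, of "\<lambda>N. \<pi> ` N = carrier X"] \<pi>(2)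
    by blast
  let ?N = "restrict_module ?F N"
  have fgN: "fg_module A ?N" by (rule fg_module_rsub[OF fg_projective_imp_fg[OF F] N(1)])
  interpret N: right_module A ?N by (rule F.right_module_restrict[OF N(1)])
  have \<pi>N: "\<pi> \<in> rmodule_hom A ?N X" by (rule hom_restrict_dom[OF \<pi>(1) rsub_subset[OF N(1)]])
  interpret \<pi>: rmod_hom A ?N X \<pi> using \<pi>N by (intro rmod_homI N.right_module_axioms X.right_module_axioms)
  have NF: "x \<in> carrier ?F" if "x \<in> N" for x using rsub_in[OF N(1) that] .
  obtain g where g: "g \<in> rmodule_hom A ?F ?N" "\<And>x. x \<in> carrier ?F \<Longrightarrow> \<pi> (g x) = \<pi> x"
    using fg_projective_lift[OF F X.right_module_axioms N.right_module_axioms \<pi>(1) \<pi>N] N(2) by auto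
  have gN: "g \<in> rmodule_hom A ?N ?N" by (rule hom_restrict_dom[OF g(1) rsub_subset[OF N(1)]])
  interpret gN: rmod_hom A ?N ?N g using gN by (intro rmod_homI N.right_module_axioms)
  \<comment> \<open>\<open>g\<close> is compatible with the maps to \<open>X\<close>, so the image
    of \<open>N\<close> still maps onto \<open>X\<close> and minimality applies.\<close>
  have "g ` N = N"
  proof (rule minN)
    show "rsubmodule A (g ` N) ?F" "g ` N \<subseteq> N"
      using gN.rsub_image[OF N.rsub_carrier] by (simp_all add: F.rsub_restrict_iff[OF N(1)])
    show "\<pi> ` g ` N = carrier X" using g(2)[OF NF] N(2) by (simp add: image_image)
  qed
  then have onto: "g ` carrier ?N = carrier ?N" by simp
  have inj: "inj_on g N"
  proof (rule inj_onI)
    fix x y assume xy: "x \<in> N" "y \<in> N" "g x = g y"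
    then have xN: "x \<in> carrier ?N" "y \<in> carrier ?N" by simp_all
    have "g (x \<ominus>\<^bsub>?N\<^esub> y) = \<zero>\<^bsub>?N\<^esub>"
      unfolding gN.diff[OF xN] using N.diff_eq_zero_iff[OF gN.closed gN.closed, OF xN] xy(3) by blast
    then have "x \<ominus>\<^bsub>?N\<^esub> y = \<zero>\<^bsub>?N\<^esub>"
      by (rule surjective_endo_injective[OF fgN gN onto N.minus_closed[OF xN]])
    then show "x = y" using N.diff_eq_zero_iff[OF xN] by blast
  qed
  have bij: "bij_betw g N N" using inj onto by (simp add: bij_betw_def)
  define e where "e = inv_into N g"
  have eg: "e (g x) = x" if "x \<in> N" for x using bij that by (simp add: e_def bij_betw_inv_into_left)
  have ge: "g (e x) = x" "e x \<in> N" if "x \<in> N" for x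
    using bij that onto by (auto simp: e_def bij_betw_inv_into_right inv_into_into)
  have e: "e \<in> rmodule_hom A ?N ?N"
  proof (rule rmodule_homI)
    show "e (x \<oplus>\<^bsub>?N\<^esub> y) = e x \<oplus>\<^bsub>?N\<^esub> e y" if "x \<in> carrier ?N" "y \<in> carrier ?N" for x y
      using that gN.add[of "e x" "e y"] ge eg[of "e x \<oplus>\<^bsub>?N\<^esub> e y"] rsub_add[OF N(1), of "e x" "e y"]
      by (simp del: gN.add free_module_simps)
    show "e (x \<bullet>\<^bsub>?N\<^esub> a) = e x \<bullet>\<^bsub>?N\<^esub> a" if "x \<in> carrier ?N" "a \<in> carrier A" for x a
      using that gN.act[of "e x" a] ge eg[of "e x \<bullet>\<^bsub>?N\<^esub> a"] rsub_act[OF N(1), of "e x" a]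
      by (simp del: gN.act free_module_simps)
  qed (use ge in simp)
  have "retract A ?N ?F"
    by (rule retractI[OF hom_restrict_dom[OF hom_id rsub_subset[OF N(1)]] hom_comp[OF g(1) e]]) (simp add: eg)
  then have "fg_projective A ?N" by (rule fg_projective_retract[OF F N.right_module_axioms])
  moreover have "superfluous A (a_kernel ?N X \<pi>) ?N"
  proof (rule superfluousI[OF \<pi>.rsub_kernel])
    fix N' assume N': "rsubmodule A N' ?N"
      and *: "\<And>p. p \<in> carrier ?N \<Longrightarrow> \<exists>n\<in>N'. \<exists>k\<in>a_kernel ?N X \<pi>. p = n \<oplus>\<^bsub>?N\<^esub> k"
    have N'': "rsubmodule A N' ?F" "N' \<subseteq> N" using N' F.rsub_restrict_iff[OF N(1)] by auto
    have "N' = N"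
    proof (rule minN[OF N''(1) _ N''(2)])
      show "\<pi> ` N' = carrier X"
      proof
        show "\<pi> ` N' \<subseteq> carrier X" using N''(2) N(2) by blast
        show "carrier X \<subseteq> \<pi> ` N'"
        proof
          fix x assume "x \<in> carrier X"
          then obtain p where p: "p \<in> N" "x = \<pi> p" using N(2) by blast
          then obtain n k where nk: "n \<in> N'" "k \<in> a_kernel ?N X \<pi>" "p = n \<oplus>\<^bsub>?N\<^esub> k"
            using *[unfolded restrict_module_simps(1), OF p(1)] by blast
          have "\<pi> (n \<oplus>\<^bsub>?N\<^esub> k) = \<pi> n" using nk N''(2) \<pi>.closed[of n] by (subst \<pi>.add) (auto simp: \<pi>.kernel_eq)
          then show "x \<in> \<pi> ` N'" using nk p(2) by auto
        qed
      qed
    qed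
    then show "carrier ?N \<subseteq> N'" by simp
  qed
  ultimately have "projective_cover A ?N \<pi> X" using \<pi>N N(2) by (simp add: projective_cover_def)
  then show ?thesis by (rule that)
qed

end

section \<open>The Jacobson radical and semisimplicity\<close>

context ring
begin

interpretation reg: right_module R "reg_module R" by (rule right_module_reg)

lemma right_ideal_carrier_iff:
  assumes "right_ideal I R"
  shows "I = carrier R \<longleftrightarrow> \<one> \<in> I"
proof
  assume "\<one> \<in> I"
  then have "x \<in> I" if "x \<in> carrier R" for x
    using assms that unfolding right_ideal_def by (metis l_one)
  then show "I = carrier R" using assms rsub_subset[of R I "reg_module R"]
    by (auto simp: right_ideal_iff_rsubmodule)
qed simp

lemma maximal_right_ideal_exists:
  assumes "right_ideal I R" "\<one> \<notin> I"
  obtains K where "maximal_right_ideal K R" "I \<subseteq> K"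
proof -
  have I: "rsubmodule R I (reg_module R)" using assms(1) by (simp add: right_ideal_iff_rsubmodule)
  obtain K where K: "rsubmodule R K (reg_module R)" "I \<subseteq> K" "\<one> \<notin> K"
    "\<And>N'. rsubmodule R N' (reg_module R) \<Longrightarrow> K \<subseteq> N' \<Longrightarrow> N' \<subseteq> carrier R \<Longrightarrow> \<one> \<notin> N' \<Longrightarrow> N' = K"
    by (rule reg.rsub_maximal_avoiding[OF I _ assms(2), of "carrier R"])
      (use rsub_subset[OF I] in \<open>simp, blast\<close>)
  have "N' = K \<or> N' = carrier R" if "right_ideal N' R" "K \<subseteq> N'" for N'
    using that K(4)[of N'] right_ideal_carrier_iff[OF that(1)] rsub_subset[of R N' "reg_module R"]
    by (auto simp: right_ideal_iff_rsubmodule)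
  then have "maximal_right_ideal K R" using K by (auto simp: maximal_right_ideal_def right_ideal_iff_rsubmodule)
  then show ?thesis using K(2) that by blast
qed

lemma maximal_right_idealD:
  assumes "maximal_right_ideal I R"
  shows "rsubmodule R I (reg_module R)" "\<one> \<notin> I"
    "\<And>K. rsubmodule R K (reg_module R) \<Longrightarrow> I \<subseteq> K \<Longrightarrow> K = I \<or> K = carrier R"
  using assms right_ideal_carrier_iff[of I]
  by (auto simp: maximal_right_ideal_def right_ideal_iff_rsubmodule)

lemma maximal_right_idealI:
  assumes "rsubmodule R I (reg_module R)" "\<one> \<notin> I"
    "\<And>K t. rsubmodule R K (reg_module R) \<Longrightarrow> I \<subseteq> K \<Longrightarrow> t \<in> K \<Longrightarrow> t \<notin> I \<Longrightarrow> \<one> \<in> K"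
  shows "maximal_right_ideal I R"
  using assms right_ideal_carrier_iff unfolding maximal_right_ideal_def right_ideal_iff_rsubmodule
  by (metis one_closed subsetI subset_antisym)

lemma maximal_right_ideal_add:
  assumes "maximal_right_ideal I R" "x \<in> carrier R" "x \<notin> I" "z \<in> carrier R"
  obtains i r where "i \<in> I" "r \<in> carrier R" "z = i \<oplus> x \<otimes> r"
proof -
  note I = maximal_right_idealD[OF assms(1)]
  let ?X = "(\<lambda>a. x \<bullet>\<^bsub>reg_module R\<^esub> a) ` carrier R" and ?K = "I <+>\<^bsub>reg_module R\<^esub> (\<lambda>a. x \<bullet>\<^bsub>reg_module R\<^esub> a) ` carrier R"
  have X: "rsubmodule R ?X (reg_module R)" "x \<in> ?X"
    using reg.rsub_cyclic[of x] reg.cyclic_self[of x] assms(2) by auto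
  have "I \<subseteq> ?K"
  proof
    fix i assume "i \<in> I"
    then have "i = i \<oplus>\<^bsub>reg_module R\<^esub> \<zero>" using rsub_in[OF I(1)] by simp
    then show "i \<in> ?K" unfolding mem_set_add
      using \<open>i \<in> I\<close> rsub_zero[OF X(1)] by (intro bexI[of _ i] bexI[of _ \<zero>]) auto
  qed
  moreover have "x \<in> ?K"
    using X(2) rsub_zero[OF I(1)] assms(2) unfolding mem_set_add by force
  ultimately have "?K = carrier R" using I(3)[OF reg.rsub_set_add[OF I(1) X(1)]] assms(3) by blast
  then have "z \<in> ?K" using assms(4) by simp
  then show ?thesis using that unfolding mem_set_add by auto
qed

lemma jacobson_radicalD: "a \<in> jacobson_radical R \<Longrightarrow> maximal_right_ideal I R \<Longrightarrow> a \<in> I"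
  by (simp add: jacobson_radical_def)

lemma jacobson_radical_rsubmodule: "rsubmodule R (jacobson_radical R) (reg_module R)"
proof (rule reg.rsubmoduleI)
  fix x y assume "x \<in> jacobson_radical R" "y \<in> jacobson_radical R"
  then show "x \<oplus>\<^bsub>reg_module R\<^esub> y \<in> jacobson_radical R"
    using rsub_add[OF maximal_right_idealD(1)] by (auto simp: jacobson_radical_def)
next
  fix x a assume "x \<in> jacobson_radical R" "a \<in> carrier R"
  then show "x \<bullet>\<^bsub>reg_module R\<^esub> a \<in> jacobson_radical R"
    using rsub_act[OF maximal_right_idealD(1)] by (auto simp: jacobson_radical_def)
qed (use rsub_zero[OF maximal_right_idealD(1)] in \<open>auto simp: jacobson_radical_def\<close>)

text \<open>If \<open>y\<close> is outside the maximal right ideal \<open>I\<close>, then the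
  elements \<open>z\<close> with \<open>y z\<close> in \<open>I\<close> form again a maximal right
  ideal, which therefore contains \<open>a\<close>.\<close>

lemma jacobson_radical_mult_left:
  assumes a: "a \<in> jacobson_radical R" and y: "y \<in> carrier R"
  shows "y \<otimes> a \<in> jacobson_radical R"
proof -
  have aR: "a \<in> carrier R" using a by (simp add: jacobson_radical_def)
  have "y \<otimes> a \<in> I" if I: "maximal_right_ideal I R" for I
  proof (cases "y \<in> I")
    case True
    then show ?thesis using rsub_act[OF maximal_right_idealD(1)[OF I] _ aR] by simp
  next
    case False
    note add = maximal_right_ideal_add[OF I]
    note I = maximal_right_idealD[OF I]
    let ?K = "{z \<in> carrier R. y \<otimes> z \<in> I}"
    have "maximal_right_ideal ?K R"
    proof (rule maximal_right_idealI)
      show "rsubmodule R ?K (reg_module R)"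
        using y rsub_zero[OF I(1)] rsub_add[OF I(1)] rsub_act[OF I(1)]
        by (intro reg.rsubmoduleI) (auto simp: r_distr simp flip: m_assoc)
      show "\<one> \<notin> ?K" using False y by simp
      fix K t assume K: "rsubmodule R K (reg_module R)" "?K \<subseteq> K" "t \<in> K" "t \<notin> ?K"
      have t: "t \<in> carrier R" "y \<otimes> t \<notin> I" using K rsub_in[OF K(1,3)] by auto
      obtain i r where ir: "i \<in> I" "r \<in> carrier R" "y = i \<oplus> (y \<otimes> t) \<otimes> r"
        using add[of "y \<otimes> t" y] t y by auto
      have i: "i \<in> carrier R" using rsub_in[OF I(1) ir(1)] by simp
      have "y \<otimes> (\<one> \<ominus> t \<otimes> r) = y \<ominus> (y \<otimes> t) \<otimes> r"
        using y t ir(2) by (simp add: a_minus_def r_distr r_minus m_assoc)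
      also have "\<dots> = (i \<oplus> (y \<otimes> t) \<otimes> r) \<ominus> (y \<otimes> t) \<otimes> r" using ir(3) by simp
      also have "\<dots> = i" using i y t ir(2) by (simp add: a_minus_def a_assoc r_neg)
      finally have "\<one> \<ominus> t \<otimes> r \<in> K" using ir t K(2) by auto
      moreover have "t \<otimes> r \<in> K" using rsub_act[OF K(1,3) ir(2)] by simp
      moreover have "\<one> = (\<one> \<ominus> t \<otimes> r) \<oplus> t \<otimes> r" using t ir(2) by (simp add: a_minus_def a_assoc l_neg)
      ultimately show "\<one> \<in> K" using rsub_add[OF K(1)] by (metis reg_module_simps(3))
    qed
    then show ?thesis using jacobson_radicalD[OF a] by blast
  qed
  then show ?thesis using aR y by (simp add: jacobson_radical_def)
qed

lemma jacobson_radical_ideal: "ideal (jacobson_radical R) R"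
proof (rule idealI[OF ring_axioms])
  have "additive_subgroup (jacobson_radical R) R"
    using jacobson_radical_rsubmodule by (simp add: rsubmodule_def)
  then show "subgroup (jacobson_radical R) (add_monoid R)" by (rule additive_subgroup.a_subgroup)
  show "a \<otimes> x \<in> jacobson_radical R" if "a \<in> jacobson_radical R" "x \<in> carrier R" for a x
    using rsub_act[OF jacobson_radical_rsubmodule that] by simp
qed (rule jacobson_radical_mult_left)

text \<open>Maximal right ideals provide a right inverse \<open>b\<close>. Then
  \<open>b = 1 + a b\<close> is itself one minus an element of the radical and has a right inverse
  \<open>c\<close>; it follows that \<open>c = 1 - a\<close>, so \<open>b\<close> is an inverse on
  both sides.\<close>

lemma one_minus_jacobson_radical_unit:
  assumes "a \<in> jacobson_radical R"
  shows "\<exists>b\<in>carrier R. b \<otimes> (\<one> \<ominus> a) = \<one>"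
proof -
  have right_inv: "\<exists>b\<in>carrier R. (\<one> \<ominus> a) \<otimes> b = \<one>" if a: "a \<in> jacobson_radical R" for a
  proof (rule ccontr)
    assume *: "\<not> ?thesis"
    have aR: "a \<in> carrier R" using a by (simp add: jacobson_radical_def)
    let ?I = "(\<lambda>b. (\<one> \<ominus> a) \<bullet>\<^bsub>reg_module R\<^esub> b) ` carrier R"
    have "right_ideal ?I R" unfolding right_ideal_iff_rsubmodule by (rule reg.rsub_cyclic) (use aR in simp)
    moreover have "\<one> \<notin> ?I" using * by auto
    ultimately obtain K where K: "maximal_right_ideal K R" "?I \<subseteq> K" by (rule maximal_right_ideal_exists)
    note K' = maximal_right_idealD[OF K(1)]
    have "\<one> \<ominus> a \<in> K" using K(2) reg.cyclic_self[of "\<one> \<ominus> a"] aR by auto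
    moreover have "\<one> = (\<one> \<ominus> a) \<oplus> a" using aR by (simp add: a_minus_def a_assoc l_neg)
    ultimately have "\<one> \<in> K" using rsub_add[OF K'(1)] jacobson_radicalD[OF a K(1)] by (metis reg_module_simps(3))
    then show False using K'(2) by simp
  qed
  have aR: "a \<in> carrier R" using assms by (simp add: jacobson_radical_def)
  obtain b where b: "b \<in> carrier R" "(\<one> \<ominus> a) \<otimes> b = \<one>" using right_inv[OF assms] by blast
  have "\<ominus> (a \<otimes> b) \<in> jacobson_radical R"
    using reg.rsub_neg[OF jacobson_radical_rsubmodule] rsub_act[OF jacobson_radical_rsubmodule assms b(1)]
      reg.act_minus_one[of "a \<otimes> b"] rsub_act[OF jacobson_radical_rsubmodule, of "a \<otimes> b" "\<ominus> \<one>"] aR b(1)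
    by (simp add: r_minus)
  then obtain c where c: "c \<in> carrier R" "(\<one> \<ominus> \<ominus> (a \<otimes> b)) \<otimes> c = \<one>" using right_inv by blast
  have "b = (\<one> \<ominus> a) \<otimes> b \<oplus> a \<otimes> b" using aR b(1) by (simp add: a_minus_def l_distr l_minus a_assoc l_neg)
  then have "b = \<one> \<ominus> \<ominus> (a \<otimes> b)" using b aR by (simp add: a_minus_def)
  then have bc: "b \<otimes> c = \<one>" using c(2) by simp
  have "c = ((\<one> \<ominus> a) \<otimes> b) \<otimes> c" using b(2) c(1) by simp
  also have "\<dots> = \<one> \<ominus> a" using bc b(1) c(1) aR by (simp add: m_assoc)
  finally show ?thesis using bc b(1) by blast
qed

end

lemma opposite_ring_simps [simp]:
  "carrier (opposite_ring R) = carrier R" "\<zero>\<^bsub>opposite_ring R\<^esub> = \<zero>\<^bsub>R\<^esub>" "\<one>\<^bsub>opposite_ring R\<^esub> = \<one>\<^bsub>R\<^esub>"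
  "x \<oplus>\<^bsub>opposite_ring R\<^esub> y = x \<oplus>\<^bsub>R\<^esub> y" "x \<otimes>\<^bsub>opposite_ring R\<^esub> y = y \<otimes>\<^bsub>R\<^esub> x"
  "opposite_ring (opposite_ring R) = R"
  by (simp_all add: opposite_ring_def)

lemma (in ring) ring_opposite: "ring (opposite_ring R)"
proof (rule ringI)
  show "abelian_group (opposite_ring R)"
    by (rule abelian_groupI) (auto simp: a_ac intro!: bexI[of _ "\<ominus> x" for x] l_neg)
  show "Group.monoid (opposite_ring R)"
    by (rule monoidI) (auto simp: m_assoc)
qed (auto simp: l_distr r_distr)

text \<open>The left-right symmetry of the radical: a maximal left ideal missing \<open>a\<close>
  contains some \<open>1 - r a\<close>, which has a left inverse.\<close>

lemma (in ring) jacobson_radical_subset_opposite: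
  "jacobson_radical R \<subseteq> jacobson_radical (opposite_ring R)"
proof
  fix a assume a: "a \<in> jacobson_radical R"
  have aR: "a \<in> carrier R" using a by (simp add: jacobson_radical_def)
  interpret op: ring "opposite_ring R" by (rule ring_opposite)
  have "a \<in> I" if I: "maximal_right_ideal I (opposite_ring R)" for I
  proof (rule ccontr)
    note I' = op.maximal_right_idealD[OF I]
    assume "a \<notin> I"
    then obtain i r where ir: "i \<in> I" "r \<in> carrier R" "\<one> = i \<oplus> r \<otimes> a"
      using op.maximal_right_ideal_add[OF I, of a \<one>] aR by auto
    have i: "i \<in> carrier R" using rsub_in[OF I'(1) ir(1)] by simp
    have "i = \<one> \<ominus> r \<otimes> a" using ir(2,3) i aR by (simp add: a_minus_def a_assoc r_neg)
    then obtain b where "b \<in> carrier R" "b \<otimes> i = \<one>"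
      using one_minus_jacobson_radical_unit[OF jacobson_radical_mult_left[OF a ir(2)]] by blast
    then show False using rsub_act[OF I'(1) ir(1), of b] I'(2) by simp
  qed
  then show "a \<in> jacobson_radical (opposite_ring R)" using aR by (simp add: jacobson_radical_def)
qed

lemma (in ring) jacobson_radical_opposite: "jacobson_radical (opposite_ring R) = jacobson_radical R"
proof -
  interpret op: ring "opposite_ring R" by (rule ring_opposite)
  show ?thesis using jacobson_radical_subset_opposite op.jacobson_radical_subset_opposite by simp
qed

section \<open>Semisimple rings and the quotient by the radical\<close>

definition semisimple_ring :: "('a, 'c) ring_scheme \<Rightarrow> bool" where
  "semisimple_ring S \<longleftrightarrow> ring S \<and> dcc (\<lambda>I. right_ideal I S) \<and> jacobson_radical S = {\<zero>\<^bsub>S\<^esub>}"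

text \<open>\<open>L\<close> is chosen minimal with \<open>L + I = S\<close>. A nonzero
  \<open>x\<close> in both would avoid some maximal right ideal \<open>I2\<close>, because the
  radical is zero; as \<open>x S\<close> lies in \<open>I\<close>, the smaller
  \<open>L \<inter> I2\<close> would still give all of \<open>S\<close> together with
  \<open>I\<close>.\<close>

lemma maximal_right_ideal_complement:
  assumes "semisimple_ring S" and I: "maximal_right_ideal I S"
  obtains L where "rsubmodule S L (reg_module S)" "L \<inter> I \<subseteq> {\<zero>\<^bsub>S\<^esub>}"
    "\<And>z. z \<in> carrier S \<Longrightarrow> \<exists>l\<in>L. \<exists>i\<in>I. z = l \<oplus>\<^bsub>S\<^esub> i"
proof -
  interpret S: ring S using assms by (simp add: semisimple_ring_def)
  interpret reg: right_module S "reg_module S" by (rule S.right_module_reg)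
  have dcc: "dcc (\<lambda>I. rsubmodule S I (reg_module S))" and J: "jacobson_radical S = {\<zero>\<^bsub>S\<^esub>}"
    using assms by (auto simp: semisimple_ring_def right_ideal_iff_rsubmodule)
  note I' = S.maximal_right_idealD[OF I]
  let ?T = "\<lambda>L. \<forall>z\<in>carrier S. \<exists>l\<in>L. \<exists>i\<in>I. z = l \<oplus>\<^bsub>S\<^esub> i"
  have T: "?T (carrier S)" using rsub_zero[OF I'(1)] by force
  have "rsubmodule S (carrier S) (reg_module S)" using reg.rsub_carrier by simp
  then obtain L where L: "rsubmodule S L (reg_module S)" "?T L"
    and minL: "\<And>N'. rsubmodule S N' (reg_module S) \<Longrightarrow> ?T N' \<Longrightarrow> N' \<subseteq> L \<Longrightarrow> N' = L"
    by (rule dcc_minimal[where T = "?T", OF dcc _ T]) blast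
  have "x = \<zero>\<^bsub>S\<^esub>" if x: "x \<in> L" "x \<in> I" for x
  proof (rule ccontr)
    assume "x \<noteq> \<zero>\<^bsub>S\<^esub>"
    have xS: "x \<in> carrier S" using rsub_in[OF L(1) x(1)] by simp
    then obtain I2 where I2: "maximal_right_ideal I2 S" "x \<notin> I2"
      using J \<open>x \<noteq> \<zero>\<^bsub>S\<^esub>\<close> by (auto simp: jacobson_radical_def)
    note I2' = S.maximal_right_idealD[OF I2(1)]
    have "?T (L \<inter> I2)"
    proof
      fix z assume "z \<in> carrier S"
      then obtain l i where li: "l \<in> L" "i \<in> I" "z = l \<oplus>\<^bsub>S\<^esub> i" using L(2) by blast
      have lS: "l \<in> carrier S" "i \<in> carrier S" using rsub_in[OF L(1) li(1)] rsub_in[OF I'(1) li(2)] by simp_all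
      obtain i2 r where ir: "i2 \<in> I2" "r \<in> carrier S" "l = i2 \<oplus>\<^bsub>S\<^esub> x \<otimes>\<^bsub>S\<^esub> r"
        using S.maximal_right_ideal_add[OF I2(1) xS I2(2) lS(1)] by blast
      have i2: "i2 \<in> carrier S" using rsub_in[OF I2'(1) ir(1)] by simp
      have xr: "x \<otimes>\<^bsub>S\<^esub> r \<in> L" "x \<otimes>\<^bsub>S\<^esub> r \<in> I"
        using rsub_act[OF L(1) x(1) ir(2)] rsub_act[OF I'(1) x(2) ir(2)] by simp_all
      have "i2 \<in> L" using reg.rsub_add_cancel[OF L(1), of i2 "x \<otimes>\<^bsub>S\<^esub> r"] ir li(1) xr i2 by simp
      moreover have "z = i2 \<oplus>\<^bsub>S\<^esub> (x \<otimes>\<^bsub>S\<^esub> r \<oplus>\<^bsub>S\<^esub> i)"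
        using i2 xS ir(2) lS li(3) by (simp add: ir(3) S.a_assoc)
      moreover have "x \<otimes>\<^bsub>S\<^esub> r \<oplus>\<^bsub>S\<^esub> i \<in> I" using rsub_add[OF I'(1) xr(2) li(2)] by simp
      ultimately show "\<exists>l\<in>L \<inter> I2. \<exists>i\<in>I. z = l \<oplus>\<^bsub>S\<^esub> i" using ir(1) by blast
    qed
    then have "L \<inter> I2 = L" using minL[OF reg.rsub_Int[OF L(1) I2'(1)]] by blast
    then show False using x(1) I2(2) by blast
  qed
  then show ?thesis using that[of L] L by blast
qed

text \<open>The annihilator of a nonzero vector is a maximal right ideal, and its complement maps
  isomorphically onto the module.\<close>

lemma simple_module_retract:
  assumes V: "simple_module R V" and S: "semisimple_ring S"
    and \<pi>: "\<pi> \<in> ring_hom R S" "\<pi> ` carrier R = carrier S" and R: "ring R"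
    and kill: "\<And>v r. v \<in> carrier V \<Longrightarrow> r \<in> carrier R \<Longrightarrow> \<pi> r = \<zero>\<^bsub>S\<^esub> \<Longrightarrow> v \<bullet>\<^bsub>V\<^esub> r = \<zero>\<^bsub>V\<^esub>"
  shows "retract R V (restr_scalars \<pi> (reg_module S))"
proof -
  interpret V: right_module R V using V by (simp add: simple_module_def)
  interpret S: ring S using S by (simp add: semisimple_ring_def)
  interpret reg: right_module S "reg_module S" by (rule S.right_module_reg)
  interpret \<pi>: ring_hom_ring R S \<pi> by (intro ring_hom_ringI2 R S.ring_axioms \<pi>(1))
  let ?S = "restr_scalars \<pi> (reg_module S)"
  obtain v where v: "v \<in> carrier V" "v \<noteq> \<zero>\<^bsub>V\<^esub>"
    using V V.zero_closed unfolding simple_module_def by blast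
  \<comment> \<open>The map from \<open>S\<close> to \<open>V\<close> that sends the unit to
    \<open>v\<close>, defined through preimages under \<open>\<pi>\<close>; by \<open>kill\<close>
    the choice of the preimage does not matter.\<close>
  define \<theta> where "\<theta> s = v \<bullet>\<^bsub>V\<^esub> (SOME r. r \<in> carrier R \<and> \<pi> r = s)" for s
  have \<theta>: "\<theta> (\<pi> r) = v \<bullet>\<^bsub>V\<^esub> r" if r: "r \<in> carrier R" for r
  proof -
    define r' where "r' = (SOME r'. r' \<in> carrier R \<and> \<pi> r' = \<pi> r)"
    have r': "r' \<in> carrier R \<and> \<pi> r' = \<pi> r" unfolding r'_def by (rule someI_ex) (use r in blast)
    then have "\<pi> (r' \<ominus>\<^bsub>R\<^esub> r) = \<zero>\<^bsub>S\<^esub>" using r by (simp add: a_minus_def S.r_neg)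
    then have "v \<bullet>\<^bsub>V\<^esub> (r' \<ominus>\<^bsub>R\<^esub> r) = \<zero>\<^bsub>V\<^esub>" using kill v(1) r r' by simp
    then have "v \<bullet>\<^bsub>V\<^esub> r' \<ominus>\<^bsub>V\<^esub> v \<bullet>\<^bsub>V\<^esub> r = \<zero>\<^bsub>V\<^esub>"
      using v(1) r r' by (simp add: a_minus_def V.act_add_right V.act_neg_right)
    then show ?thesis using V.diff_eq_zero_iff v(1) r r' V.act_closed by (simp add: \<theta>_def r'_def)
  qed
  have surj: "\<exists>r\<in>carrier R. s = \<pi> r" if "s \<in> carrier S" for s using that \<pi>(2) by blast
  have S': "right_module R ?S" by (rule right_module_restr_scalars[OF R \<pi>(1) reg.right_module_axioms])
  have \<theta>_hom: "\<theta> \<in> rmodule_hom R ?S V"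
  proof (rule rmodule_homI)
    fix s assume "s \<in> carrier ?S"
    then obtain r where r: "r \<in> carrier R" "s = \<pi> r" using surj by auto
    then show "\<theta> s \<in> carrier V" using v(1) by (simp add: \<theta> V.act_closed)
    show "\<theta> (s \<bullet>\<^bsub>?S\<^esub> a) = \<theta> s \<bullet>\<^bsub>V\<^esub> a" if a: "a \<in> carrier R" for a
      using \<theta>[of "r \<otimes>\<^bsub>R\<^esub> a"] r a v(1) by (simp add: \<theta> V.act_assoc)
    fix t assume "t \<in> carrier ?S"
    then obtain q where q: "q \<in> carrier R" "t = \<pi> q" using surj by auto
    show "\<theta> (s \<oplus>\<^bsub>?S\<^esub> t) = \<theta> s \<oplus>\<^bsub>V\<^esub> \<theta> t"
      using \<theta>[of "r \<oplus>\<^bsub>R\<^esub> q"] r q v(1) by (simp add: \<theta> V.act_add_right)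
  qed
  interpret \<theta>: rmod_hom R ?S V \<theta> by (intro rmod_homI S' V.right_module_axioms \<theta>_hom)
  define I where "I = {s \<in> carrier S. \<theta> s = \<zero>\<^bsub>V\<^esub>}"
  have I: "maximal_right_ideal I S"
  proof (rule S.maximal_right_idealI)
    show "rsubmodule S I (reg_module S)"
    proof (rule reg.rsubmoduleI)
      show "x \<bullet>\<^bsub>reg_module S\<^esub> a \<in> I" if x: "x \<in> I" "a \<in> carrier S" for x a
      proof -
        obtain r where r: "r \<in> carrier R" "a = \<pi> r" using surj x by auto
        then show ?thesis using x \<theta>.act[of x r] by (simp add: I_def)
      qed
    qed (use \<theta>.zero \<theta>.add in \<open>auto simp: I_def\<close>)
    show "\<one>\<^bsub>S\<^esub> \<notin> I" using \<theta>[of "\<one>\<^bsub>R\<^esub>"] v by (simp add: I_def V.act_one)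
    fix K t assume K: "rsubmodule S K (reg_module S)" "I \<subseteq> K" "t \<in> K" "t \<notin> I"
    have t: "t \<in> carrier S" "\<theta> t \<noteq> \<zero>\<^bsub>V\<^esub>" using rsub_in[OF K(1,3)] K(4) by (auto simp: I_def)
    \<comment> \<open>As \<open>V\<close> is simple, \<open>\<theta> t\<close> generates it, so the
      image of the unit is \<open>\<theta> t\<close> times some \<open>r\<close>. Then the unit
      minus \<open>t \<pi>(r)\<close> lies in \<open>I\<close>, and the unit lies in
      \<open>K\<close>.\<close>
    then obtain r where r: "r \<in> carrier R" "\<theta> \<one>\<^bsub>S\<^esub> = \<theta> t \<bullet>\<^bsub>V\<^esub> r"
      using simple_module_cyclic[OF V, of "\<theta> t" "\<theta> \<one>\<^bsub>S\<^esub>"] \<theta>.closed[of t] \<theta>.closed[of "\<one>\<^bsub>S\<^esub>"] by auto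
    have "\<theta> (\<one>\<^bsub>S\<^esub> \<oplus>\<^bsub>S\<^esub> t \<otimes>\<^bsub>S\<^esub> \<pi> (\<ominus>\<^bsub>R\<^esub> r)) = \<theta> \<one>\<^bsub>S\<^esub> \<oplus>\<^bsub>V\<^esub> \<theta> t \<bullet>\<^bsub>V\<^esub> (\<ominus>\<^bsub>R\<^esub> r)"
      using \<theta>.add[of "\<one>\<^bsub>S\<^esub>" "t \<otimes>\<^bsub>S\<^esub> \<pi> (\<ominus>\<^bsub>R\<^esub> r)"] \<theta>.act[of t "\<ominus>\<^bsub>R\<^esub> r"] t(1) r(1) by simp
    also have "\<dots> = \<zero>\<^bsub>V\<^esub>"
      using r t(1) \<theta>.closed[of t] by (simp add: V.act_neg_right V.act_closed V.r_neg)
    finally have "\<one>\<^bsub>S\<^esub> \<oplus>\<^bsub>S\<^esub> t \<otimes>\<^bsub>S\<^esub> \<pi> (\<ominus>\<^bsub>R\<^esub> r) \<in> K" using t(1) r(1) K(2) by (auto simp: I_def)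
    moreover have "t \<otimes>\<^bsub>S\<^esub> \<pi> (\<ominus>\<^bsub>R\<^esub> r) \<in> K" using rsub_act[OF K(1,3), of "\<pi> (\<ominus>\<^bsub>R\<^esub> r)"] r(1) by simp
    ultimately show "\<one>\<^bsub>S\<^esub> \<in> K" using reg.rsub_add_cancel[OF K(1), of "\<one>\<^bsub>S\<^esub>"] by simp
  qed
  obtain L where L: "rsubmodule S L (reg_module S)" "L \<inter> I \<subseteq> {\<zero>\<^bsub>S\<^esub>}"
    "\<And>z. z \<in> carrier S \<Longrightarrow> \<exists>l\<in>L. \<exists>i\<in>I. z = l \<oplus>\<^bsub>S\<^esub> i"
    using maximal_right_ideal_complement[OF S I] by blast
  have LS: "l \<in> carrier S" if "l \<in> L" for l using rsub_in[OF L(1) that] by simp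
  have ex: "\<exists>l. l \<in> L \<and> \<theta> l = w" if "w \<in> carrier V" for w
  proof -
    obtain r where r: "r \<in> carrier R" "w = v \<bullet>\<^bsub>V\<^esub> r" using simple_module_cyclic[OF V v \<open>w \<in> _\<close>] by blast
    then obtain l i where li: "l \<in> L" "i \<in> I" "\<pi> r = l \<oplus>\<^bsub>S\<^esub> i" using L(3)[of "\<pi> r"] by auto
    then have "\<theta> l = \<theta> (\<pi> r)" using \<theta>.add[of l i] LS \<theta>.closed[of l] by (simp add: I_def)
    then show ?thesis using \<theta>[OF r(1)] r(2) li(1) by auto
  qed
  have uniq: "l = l'" if l: "l \<in> L" "l' \<in> L" "\<theta> l = \<theta> l'" for l l'
  proof -
    have "l \<ominus>\<^bsub>?S\<^esub> l' \<in> I"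
      using \<theta>.diff[of l l'] \<theta>.M.minus_closed[of l l'] LS l \<theta>.closed[of l'] V.diff_eq_zero_iff[of "\<theta> l'" "\<theta> l'"]
      by (simp add: I_def)
    moreover have "l \<ominus>\<^bsub>?S\<^esub> l' = l \<oplus>\<^bsub>S\<^esub> l' \<otimes>\<^bsub>S\<^esub> (\<ominus>\<^bsub>S\<^esub> \<one>\<^bsub>S\<^esub>)"
      using \<theta>.M.act_minus_one[of l'] LS l by (simp add: a_minus_def)
    moreover have "\<dots> \<in> L" using rsub_add[OF L(1) l(1) rsub_act[OF L(1) l(2)]] by simp
    ultimately have "l \<ominus>\<^bsub>?S\<^esub> l' = \<zero>\<^bsub>?S\<^esub>" using L(2) by auto
    then show ?thesis using \<theta>.M.diff_eq_zero_iff[of l l'] LS l by simp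
  qed
  define e where "e w = (SOME l. l \<in> L \<and> \<theta> l = w)" for w
  have e: "e w \<in> L" "\<theta> (e w) = w" if "w \<in> carrier V" for w
    using someI_ex[OF ex[OF that]] by (auto simp: e_def)
  have e_hom: "e \<in> rmodule_hom R V ?S"
  proof (rule rmodule_homI)
    fix w assume w: "w \<in> carrier V"
    show "e w \<in> carrier ?S" using e w LS by simp
    show "e (w \<bullet>\<^bsub>V\<^esub> a) = e w \<bullet>\<^bsub>?S\<^esub> a" if a: "a \<in> carrier R" for a
      using w a e \<theta>.act[of "e w" a] LS rsub_act[OF L(1) e(1)[OF w], of "\<pi> a"]
      by (intro uniq) (simp_all add: V.act_closed)
    show "e (w \<oplus>\<^bsub>V\<^esub> u) = e w \<oplus>\<^bsub>?S\<^esub> e u" if u: "u \<in> carrier V" for u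
      using w u e \<theta>.add[of "e w" "e u"] LS rsub_add[OF L(1) e(1)[OF w] e(1)[OF u]]
      by (intro uniq) simp_all
  qed
  show ?thesis by (rule retractI[OF e_hom \<theta>_hom e(2)])
qed

lemma dcc_image:
  assumes "dcc Q" "\<And>N. Q' N \<Longrightarrow> Q (f N)" "\<And>N N'. N \<subseteq> N' \<Longrightarrow> f N \<subseteq> f N'"
    "\<And>N N'. Q' N \<Longrightarrow> Q' N' \<Longrightarrow> f N = f N' \<Longrightarrow> N = N'"
  shows "dcc Q'"
  unfolding dcc_def
proof (intro allI impI)
  fix I :: "nat \<Rightarrow> 'b set" assume I: "(\<forall>n. Q' (I n)) \<and> (\<forall>n. I (Suc n) \<subseteq> I n)"
  then have "\<exists>N. \<forall>n\<ge>N. f (I n) = f (I N)"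
    using assms(1)[unfolded dcc_def, rule_format, of "\<lambda>n. f (I n)"] assms(2,3) by blast
  then show "\<exists>N. \<forall>n\<ge>N. I n = I N" using assms(4) I by blast
qed

lemma fg_module_reg: "ring R \<Longrightarrow> fg_module R (reg_module R)"
  unfolding fg_module_def
proof (intro conjI exI[of _ "{\<one>\<^bsub>R\<^esub>}"] allI impI)
  assume "ring R"
  then interpret ring R .
  show "right_module R (reg_module R)" by (rule right_module_reg)
  fix N assume "rsubmodule R N (reg_module R) \<and> {\<one>\<^bsub>R\<^esub>} \<subseteq> N"
  then show "N = carrier (reg_module R)"
    using right_ideal_carrier_iff[of N] by (auto simp: right_ideal_iff_rsubmodule)
qed (use ring.ring_simprules in auto)

text \<open>The quotient by the radical is kept abstract, as the target of a surjection with the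
  right kernel, so that no cosets occur in the arguments.\<close>

locale radical_quotient = artin_algebra k \<phi> A + S: ring S
  for k :: "('k, 'c) ring_scheme" and \<phi> :: "'k \<Rightarrow> 'a" and A :: "('a, 'd) ring_scheme"
    and S :: "('s, 'e) ring_scheme" +
  fixes \<rho> :: "'a \<Rightarrow> 's"
  assumes \<rho>_hom: "\<rho> \<in> ring_hom A S" and \<rho>_onto: "\<rho> ` carrier A = carrier S"
    and \<rho>_kernel: "a \<in> carrier A \<Longrightarrow> \<rho> a = \<zero>\<^bsub>S\<^esub> \<longleftrightarrow> a \<in> jacobson_radical A"
begin

sublocale \<rho>: ring_hom_ring A S \<rho>
  by (intro ring_hom_ringI2 A.ring_axioms S.ring_axioms \<rho>_hom)

lemma \<rho>_surj: "s \<in> carrier S \<Longrightarrow> \<exists>a\<in>carrier A. s = \<rho> a" using \<rho>_onto by blast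

text \<open>A maximal right ideal of \<open>A\<close> contains the radical, so it is the full
  preimage of its image, and the image is maximal too. A lift of an element in the radical of
  \<open>S\<close> thus lies in all maximal right ideals of \<open>A\<close>.\<close>

lemma jacobson_radical_quotient: "jacobson_radical S = {\<zero>\<^bsub>S\<^esub>}"
proof -
  interpret regA: right_module A "reg_module A" by (rule A.right_module_reg)
  interpret regS: right_module S "reg_module S" by (rule S.right_module_reg)
  have "s = \<zero>\<^bsub>S\<^esub>" if s: "s \<in> jacobson_radical S" for s
  proof -
    have "s \<in> carrier S" using s by (simp add: jacobson_radical_def)
    then obtain a where a: "a \<in> carrier A" "s = \<rho> a" using \<rho>_surj by blast
    have "a \<in> I" if I: "maximal_right_ideal I A" for I
    proof -
      note I' = A.maximal_right_idealD[OF I]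
      have IA: "i \<in> carrier A" if "i \<in> I" for i using rsub_in[OF I'(1) that] by simp
      have refl: "x \<in> I" if x: "x \<in> carrier A" "\<rho> x \<in> \<rho> ` I" for x
      proof -
        obtain i where i: "i \<in> I" "\<rho> x = \<rho> i" using x(2) by blast
        have "\<rho> (x \<ominus>\<^bsub>A\<^esub> i) = \<zero>\<^bsub>S\<^esub>" using x i IA by (simp add: a_minus_def S.r_neg)
        then have "x \<ominus>\<^bsub>A\<^esub> i \<in> I" using \<rho>_kernel[of "x \<ominus>\<^bsub>A\<^esub> i"] x IA[OF i(1)] A.jacobson_radicalD[OF _ I] by simp
        moreover have "x = (x \<ominus>\<^bsub>A\<^esub> i) \<oplus>\<^bsub>A\<^esub> i"
          using x(1) IA[OF i(1)] by (simp add: a_minus_def A.a_assoc A.l_neg)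
        ultimately show ?thesis using rsub_add[OF I'(1) _ i(1), of "x \<ominus>\<^bsub>A\<^esub> i"] by simp
      qed
      have "maximal_right_ideal (\<rho> ` I) S"
      proof (rule S.maximal_right_idealI)
        show "rsubmodule S (\<rho> ` I) (reg_module S)"
        proof (rule regS.rsubmoduleI)
          show "\<zero>\<^bsub>reg_module S\<^esub> \<in> \<rho> ` I" using rsub_zero[OF I'(1)] by (metis \<rho>.hom_zero image_eqI reg_module_simps(2))
          show "x \<oplus>\<^bsub>reg_module S\<^esub> y \<in> \<rho> ` I" if "x \<in> \<rho> ` I" "y \<in> \<rho> ` I" for x y
            using that rsub_add[OF I'(1)] IA by (auto simp flip: \<rho>.hom_add)
          show "x \<bullet>\<^bsub>reg_module S\<^esub> t \<in> \<rho> ` I" if xt: "x \<in> \<rho> ` I" "t \<in> carrier S" for x t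
          proof -
            obtain b where "b \<in> carrier A" "t = \<rho> b" using \<rho>_surj xt(2) by blast
            then show ?thesis using xt(1) rsub_act[OF I'(1)] IA by (auto simp flip: \<rho>.hom_mult)
          qed
        qed (use IA in auto)
        show "\<one>\<^bsub>S\<^esub> \<notin> \<rho> ` I" using refl[of "\<one>\<^bsub>A\<^esub>"] I'(2) by auto
        fix K t assume K: "rsubmodule S K (reg_module S)" "\<rho> ` I \<subseteq> K" "t \<in> K" "t \<notin> \<rho> ` I"
        let ?K = "{x \<in> carrier A. \<rho> x \<in> K}"
        have "t \<in> carrier S" using rsub_in[OF K(1,3)] by simp
        then obtain b where b: "b \<in> carrier A" "t = \<rho> b" using \<rho>_surj by blast
        have "rsubmodule A ?K (reg_module A)"
          using rsub_zero[OF K(1)] rsub_add[OF K(1)] rsub_act[OF K(1)]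
          by (intro regA.rsubmoduleI) auto
        moreover have "I \<subseteq> ?K" using IA K(2) by auto
        moreover have "?K \<noteq> I" using b K(3,4) by auto
        ultimately have "\<one>\<^bsub>A\<^esub> \<in> ?K" using I'(3) by blast
        then show "\<one>\<^bsub>S\<^esub> \<in> K" by simp
      qed
      then have "s \<in> \<rho> ` I" using S.jacobson_radicalD[OF s] by blast
      then show ?thesis using refl a by simp
    qed
    then have "a \<in> jacobson_radical A" using a(1) by (simp add: jacobson_radical_def)
    then show ?thesis using \<rho>_kernel a by simp
  qed
  moreover have "\<zero>\<^bsub>S\<^esub> \<in> jacobson_radical S" using rsub_zero[OF S.jacobson_radical_rsubmodule] by simp
  ultimately show ?thesis by blast
qed

text \<open>Closure under addition and under scalars from \<open>k\<close> is common to left and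
  right ideals of \<open>S\<close>; their preimages are \<open>k\<close>-submodules of
  \<open>A\<close>, where the chain condition is known.\<close>

lemma dcc_ideals_quotient:
  assumes "\<And>I. Q I \<Longrightarrow> I \<subseteq> carrier S \<and> \<zero>\<^bsub>S\<^esub> \<in> I \<and> (\<forall>x\<in>I. \<forall>y\<in>I. x \<oplus>\<^bsub>S\<^esub> y \<in> I) \<and>
      (\<forall>x\<in>I. \<forall>c\<in>carrier k. x \<otimes>\<^bsub>S\<^esub> \<rho> (\<phi> c) \<in> I)"
  shows "dcc Q"
proof (rule dcc_image[OF dcc_base[OF fg_module_reg[OF A.ring_axioms]]])
  interpret right_module k "restr_scalars \<phi> (reg_module A)"
    by (rule right_module_base[OF A.right_module_reg])
  let ?f = "\<lambda>I. {a \<in> carrier A. \<rho> a \<in> I}"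
  show "rsubmodule k (?f I) (restr_scalars \<phi> (reg_module A))" if "Q I" for I
    using assms[OF that] ring_hom_closed[OF structure_hom] by (intro rsubmoduleI) auto
  show "?f I \<subseteq> ?f I'" if "I \<subseteq> I'" for I I' using that by auto
  show "I = I'" if "Q I" "Q I'" "?f I = ?f I'" for I I'
  proof -
    have "I = \<rho> ` ?f I" if "I \<subseteq> carrier S" for I using that \<rho>_surj by force
    then show ?thesis using that assms by metis
  qed
qed

lemma semisimple_quotient: "semisimple_ring S"
proof -
  have "dcc (\<lambda>I. right_ideal I S)"
  proof (rule dcc_ideals_quotient)
    fix I assume "right_ideal I S"
    then have I: "rsubmodule S I (reg_module S)" by (simp add: right_ideal_iff_rsubmodule)
    show "I \<subseteq> carrier S \<and> \<zero>\<^bsub>S\<^esub> \<in> I \<and> (\<forall>x\<in>I. \<forall>y\<in>I. x \<oplus>\<^bsub>S\<^esub> y \<in> I) \<and>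
      (\<forall>x\<in>I. \<forall>c\<in>carrier k. x \<otimes>\<^bsub>S\<^esub> \<rho> (\<phi> c) \<in> I)"
      using rsub_subset[OF I] rsub_zero[OF I] rsub_add[OF I] rsub_act[OF I] ring_hom_closed[OF structure_hom]
      by auto
  qed
  then show ?thesis by (simp add: semisimple_ring_def jacobson_radical_quotient S.ring_axioms)
qed

lemma semisimple_quotient_opposite: "semisimple_ring (opposite_ring S)"
proof -
  interpret op: ring "opposite_ring S" by (rule S.ring_opposite)
  have "dcc (\<lambda>I. right_ideal I (opposite_ring S))"
  proof (rule dcc_ideals_quotient)
    fix I assume "right_ideal I (opposite_ring S)"
    then have I: "rsubmodule (opposite_ring S) I (reg_module (opposite_ring S))"
      by (simp add: right_ideal_iff_rsubmodule)
    have IS: "I \<subseteq> carrier S" using rsub_subset[OF I] by simp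
    have "x \<otimes>\<^bsub>S\<^esub> \<rho> (\<phi> c) \<in> I" if x: "x \<in> I" and c: "c \<in> carrier k" for x c
    proof -
      have \<phi>c: "\<phi> c \<in> carrier A" using ring_hom_closed[OF structure_hom c] .
      obtain a where a: "a \<in> carrier A" "x = \<rho> a" using IS x \<rho>_surj by blast
      \<comment> \<open>Scalars are central, so a left ideal absorbs them from the right as
        well.\<close>
      have "x \<otimes>\<^bsub>S\<^esub> \<rho> (\<phi> c) = \<rho> (\<phi> c) \<otimes>\<^bsub>S\<^esub> x"
        unfolding a(2) using structure_central[OF c a(1)] a(1) \<phi>c by (simp flip: \<rho>.hom_mult)
      then show ?thesis using rsub_act[OF I x, of "\<rho> (\<phi> c)"] \<phi>c by simp
    qed
    then show "I \<subseteq> carrier S \<and> \<zero>\<^bsub>S\<^esub> \<in> I \<and> (\<forall>x\<in>I. \<forall>y\<in>I. x \<oplus>\<^bsub>S\<^esub> y \<in> I) \<and>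
      (\<forall>x\<in>I. \<forall>c\<in>carrier k. x \<otimes>\<^bsub>S\<^esub> \<rho> (\<phi> c) \<in> I)"
      using IS rsub_zero[OF I] rsub_add[OF I] by auto
  qed
  then show ?thesis
    by (simp add: semisimple_ring_def S.jacobson_radical_opposite jacobson_radical_quotient op.ring_axioms)
qed

end

section \<open>Modules over the triangular matrix algebra\<close>

lemma (in radical_quotient) top_exists:
  fixes P :: "('a, 'p) rmodule"
  assumes "fg_projective A P"
  obtains n :: nat and x f and U :: "('s, nat \<Rightarrow> 's) rmodule" and \<tau> g where
    "dual_basis A P {..<n} x f" "dual_basis S U {..<n} (\<lambda>i. \<tau> (x i)) g" "right_module S U"
    "\<tau> \<in> rmodule_hom A P (restr_scalars \<rho> U)" "\<tau> ` carrier P = carrier U"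
    "\<And>i p. i < n \<Longrightarrow> p \<in> carrier P \<Longrightarrow> g i (\<tau> p) = \<rho> (f i p)"
    "\<And>K q. superfluous A K P \<Longrightarrow> q \<in> K \<Longrightarrow> \<tau> q = \<zero>\<^bsub>U\<^esub>"
proof -
  interpret P: right_module A P using assms by (rule fg_projective_right_module)
  interpret regA: right_module A "reg_module A" by (rule A.right_module_reg)
  obtain n :: nat and x f where db: "dual_basis A P {..<n} x f" using assms by (rule fg_projectiveE) blast
  note dbD = dual_basisD[OF db]
  let ?F = "free_module S n"
  interpret F: right_module S ?F by (rule S.right_module_free)
  define \<tau> where "\<tau> p = (\<lambda>i\<in>{..<n}. \<rho> (f i p))" for p
  have fc: "f i p \<in> carrier A" if "i < n" "p \<in> carrier P" for i p using dbD(5) that by simp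
  have fh: "f i (p \<oplus>\<^bsub>P\<^esub> q) = f i p \<oplus>\<^bsub>A\<^esub> f i q" "a \<in> carrier A \<Longrightarrow> f i (p \<bullet>\<^bsub>P\<^esub> a) = f i p \<otimes>\<^bsub>A\<^esub> a"
    if "i < n" "p \<in> carrier P" "q \<in> carrier P" for i p q a
    using hom_add[OF dbD(3)] hom_act[OF dbD(3)] that by auto
  have \<tau>F: "\<tau> p \<in> carrier ?F" if "p \<in> carrier P" for p using fc that by (auto simp: \<tau>_def)
  have \<tau>_add: "\<tau> (p \<oplus>\<^bsub>P\<^esub> q) = \<tau> p \<oplus>\<^bsub>?F\<^esub> \<tau> q" if "p \<in> carrier P" "q \<in> carrier P" for p q
    using that fh fc by (auto simp: \<tau>_def)
  have \<tau>_act: "\<tau> (p \<bullet>\<^bsub>P\<^esub> a) = \<tau> p \<bullet>\<^bsub>?F\<^esub> \<rho> a" if "p \<in> carrier P" "a \<in> carrier A" for p a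
    using that fh fc by (auto simp: \<tau>_def)
  define U where "U = restrict_module ?F (\<tau> ` carrier P)"
  have U: "rsubmodule S (\<tau> ` carrier P) ?F"
  proof (rule F.rsubmoduleI)
    have "\<tau> \<zero>\<^bsub>P\<^esub> = \<zero>\<^bsub>?F\<^esub>"
      by (rule additive_zero[OF P.abelian_group_axioms F.abelian_group_axioms]) (use \<tau>F \<tau>_add in auto)
    then show "\<zero>\<^bsub>?F\<^esub> \<in> \<tau> ` carrier P" by (metis P.zero_closed image_eqI)
    show "u \<bullet>\<^bsub>?F\<^esub> s \<in> \<tau> ` carrier P" if us: "u \<in> \<tau> ` carrier P" "s \<in> carrier S" for u s
    proof -
      obtain a where "a \<in> carrier A" "s = \<rho> a" using \<rho>_surj us(2) by blast
      then show ?thesis using us(1) P.act_closed by (auto simp flip: \<tau>_act simp del: free_module_simps)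
    qed
    show "u \<oplus>\<^bsub>?F\<^esub> u' \<in> \<tau> ` carrier P" if "u \<in> \<tau> ` carrier P" "u' \<in> \<tau> ` carrier P" for u u'
      using that by (auto simp flip: \<tau>_add simp del: free_module_simps)
  qed (use \<tau>F in blast)
  have Um: "right_module S U" unfolding U_def by (rule F.right_module_restrict[OF U])
  interpret U: right_module S U by (rule Um)
  have Us: "carrier U = \<tau> ` carrier P" "u \<oplus>\<^bsub>U\<^esub> u' = u \<oplus>\<^bsub>?F\<^esub> u'" "u \<bullet>\<^bsub>U\<^esub> s = u \<bullet>\<^bsub>?F\<^esub> s" for u u' s
    by (simp_all add: U_def)
  define g where "g i u = u i" for i :: nat and u :: "nat \<Rightarrow> 's"
  have g\<tau>: "g i (\<tau> p) = \<rho> (f i p)" if "i < n" for i p using that by (simp add: g_def \<tau>_def)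
  have \<tau>: "\<tau> \<in> rmodule_hom A P (restr_scalars \<rho> U)"
    by (rule rmodule_homI) (simp_all add: Us \<tau>_add \<tau>_act del: free_module_simps)
  have "dual_basis S U {..<n} (\<lambda>i. \<tau> (x i)) g"
    unfolding dual_basis_def
  proof (intro conjI ballI)
    show "(\<lambda>i. \<tau> (x i)) \<in> {..<n} \<rightarrow> carrier U" using dbD(2) by (auto simp: Us)
    show "g i \<in> rmodule_hom S U (reg_module S)" if "i \<in> {..<n}" for i
      unfolding g_def U_def by (rule hom_restrict_dom[OF coordinate_hom rsub_subset[OF U]]) (use that in simp)
    fix u assume "u \<in> carrier U"
    then obtain p where p: "p \<in> carrier P" "u = \<tau> p" by (auto simp: Us)
    have "u = \<tau> (\<Oplus>\<^bsub>P\<^esub>i\<in>{..<n}. x i \<bullet>\<^bsub>P\<^esub> f i p)" using p dbD(4) by simp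
    also have "\<dots> = (\<Oplus>\<^bsub>U\<^esub>i\<in>{..<n}. \<tau> (x i \<bullet>\<^bsub>P\<^esub> f i p))"
      using dbD(2,5) p P.act_closed
      by (intro additive_finsum P.abelian_group_axioms U.abelian_group_axioms)
        (auto simp: Us \<tau>_add simp del: free_module_simps)
    also have "\<dots> = (\<Oplus>\<^bsub>U\<^esub>i\<in>{..<n}. \<tau> (x i) \<bullet>\<^bsub>U\<^esub> g i u)"
    proof (rule U.finsum_cong')
      show "(\<lambda>i. \<tau> (x i) \<bullet>\<^bsub>U\<^esub> g i u) \<in> {..<n} \<rightarrow> carrier U"
        using dbD(2) p fc by (intro Pi_I U.act_closed) (auto simp: Us g\<tau>)
      show "\<tau> (x i \<bullet>\<^bsub>P\<^esub> f i p) = \<tau> (x i) \<bullet>\<^bsub>U\<^esub> g i u" if "i \<in> {..<n}" for i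
        using that dbD(2) p fc by (simp add: Us g\<tau> \<tau>_act del: free_module_simps)
    qed simp
    finally show "(\<Oplus>\<^bsub>U\<^esub>i\<in>{..<n}. \<tau> (x i) \<bullet>\<^bsub>U\<^esub> g i u) = u" ..
  qed simp
  moreover have "\<tau> q = \<zero>\<^bsub>U\<^esub>" if K: "superfluous A K P" "q \<in> K" for K q
  proof -
    have Ks: "rsubmodule A K P" using K(1) by (simp add: superfluous_def)
    have qP: "q \<in> carrier P" using rsub_in[OF Ks K(2)] .
    \<comment> \<open>If \<open>f i q\<close> missed a maximal right ideal \<open>I\<close>, then
      \<open>K\<close> and the preimage of \<open>I\<close> under \<open>f i\<close> would span
      \<open>P\<close>; so the preimage would be all of \<open>P\<close>, and would contain
      \<open>q\<close>.\<close>
    have "f i q \<in> jacobson_radical A" if i: "i < n" for i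
    proof -
      have "f i q \<in> I" if I: "maximal_right_ideal I A" for I
      proof (rule ccontr)
        assume ni: "f i q \<notin> I"
        note I' = A.maximal_right_idealD[OF I]
        interpret fi: rmod_hom A P "reg_module A" "f i"
          by (intro rmod_homI P.right_module_axioms regA.right_module_axioms dbD(3)) (use i in simp)
        have "{p \<in> carrier P. f i p \<in> I} = carrier P"
        proof (rule P.superfluousD[OF K(1) fi.rsub_vimage[OF I'(1)]])
          fix p assume p: "p \<in> carrier P"
          obtain j r where jr: "j \<in> I" "r \<in> carrier A" "f i p = j \<oplus>\<^bsub>A\<^esub> f i q \<otimes>\<^bsub>A\<^esub> r"
            by (rule A.maximal_right_ideal_add[OF I fc[OF i qP] ni fc[OF i p]]) blast
          have qr: "q \<bullet>\<^bsub>P\<^esub> r \<in> K" using rsub_act[OF Ks K(2) jr(2)] .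
          have qrP: "q \<bullet>\<^bsub>P\<^esub> r \<in> carrier P" using rsub_in[OF Ks qr] .
          have jA: "j \<in> carrier A" using rsub_in[OF I'(1) jr(1)] by simp
          have "f i (p \<ominus>\<^bsub>P\<^esub> q \<bullet>\<^bsub>P\<^esub> r) \<oplus>\<^bsub>A\<^esub> f i (q \<bullet>\<^bsub>P\<^esub> r) = f i p"
            using p qrP fi.add[of "p \<ominus>\<^bsub>P\<^esub> q \<bullet>\<^bsub>P\<^esub> r" "q \<bullet>\<^bsub>P\<^esub> r"]
            by (simp add: a_minus_def P.a_assoc P.l_neg del: fi.add fi.diff fi.neg)
          then have "f i (p \<ominus>\<^bsub>P\<^esub> q \<bullet>\<^bsub>P\<^esub> r) \<oplus>\<^bsub>A\<^esub> f i (q \<bullet>\<^bsub>P\<^esub> r) = j \<oplus>\<^bsub>A\<^esub> f i (q \<bullet>\<^bsub>P\<^esub> r)"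
            using jr qP fi.act[of q r] by (simp del: fi.diff)
          then have "f i (p \<ominus>\<^bsub>P\<^esub> q \<bullet>\<^bsub>P\<^esub> r) = j"
            using A.add.right_cancel[of "f i (q \<bullet>\<^bsub>P\<^esub> r)" "f i (p \<ominus>\<^bsub>P\<^esub> q \<bullet>\<^bsub>P\<^esub> r)" j] fc[OF i] p qrP jA
            by (simp del: fi.diff)
          moreover have "p = (p \<ominus>\<^bsub>P\<^esub> q \<bullet>\<^bsub>P\<^esub> r) \<oplus>\<^bsub>P\<^esub> q \<bullet>\<^bsub>P\<^esub> r"
            using p qrP by (simp add: a_minus_def P.a_assoc P.l_neg)
          ultimately show "\<exists>n\<in>{p \<in> carrier P. f i p \<in> I}. \<exists>k\<in>K. p = n \<oplus>\<^bsub>P\<^esub> k"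
            using jr(1) p qrP qr by (intro bexI[of _ "p \<ominus>\<^bsub>P\<^esub> q \<bullet>\<^bsub>P\<^esub> r"] bexI[of _ "q \<bullet>\<^bsub>P\<^esub> r"]) auto
        qed
        then show False using ni qP by blast
      qed
      then show ?thesis using fc[OF i qP] by (simp add: jacobson_radical_def)
    qed
    then have "\<rho> (f i q) = \<zero>\<^bsub>S\<^esub>" if "i < n" for i using that \<rho>_kernel fc qP by blast
    then show ?thesis by (auto simp: \<tau>_def U_def)
  qed
  ultimately show ?thesis using that[OF db _ Um \<tau> _ g\<tau>] Us(1) by blast
qed

section \<open>The triangular matrix algebra and explicit projective covers over it\<close>

locale triangular_extension = radical_quotient k \<phi> A S \<rho>
  for k :: "('k, 'c) ring_scheme" and \<phi> :: "'k \<Rightarrow> 'a" and A :: "('a, 'd) ring_scheme"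
    and S :: "('s, 'e) ring_scheme" and \<rho> :: "'a \<Rightarrow> 's" +
  fixes \<Lambda> :: "('a \<times> 's \<times> ('s \<times> 's)) ring"
  assumes \<Lambda>_eq: "\<Lambda> = triangular_matrix_ring A S (\<lambda>a m. \<rho> a \<otimes>\<^bsub>S\<^esub> m)
    (\<lambda>m b. m \<otimes>\<^bsub>S\<^esub> canonical_epi b) (trivial_extension S)"
begin

lemma \<Lambda>_simps [simp]:
  "carrier \<Lambda> = carrier A \<times> carrier S \<times> (carrier S \<times> carrier S)"
  "\<one>\<^bsub>\<Lambda>\<^esub> = (\<one>\<^bsub>A\<^esub>, \<zero>\<^bsub>S\<^esub>, (\<one>\<^bsub>S\<^esub>, \<zero>\<^bsub>S\<^esub>))" "\<zero>\<^bsub>\<Lambda>\<^esub> = (\<zero>\<^bsub>A\<^esub>, \<zero>\<^bsub>S\<^esub>, (\<zero>\<^bsub>S\<^esub>, \<zero>\<^bsub>S\<^esub>))"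
  "(a, m, (s, t)) \<oplus>\<^bsub>\<Lambda>\<^esub> (a', m', (s', t')) = (a \<oplus>\<^bsub>A\<^esub> a', m \<oplus>\<^bsub>S\<^esub> m', (s \<oplus>\<^bsub>S\<^esub> s', t \<oplus>\<^bsub>S\<^esub> t'))"
  "(a, m, (s, t)) \<otimes>\<^bsub>\<Lambda>\<^esub> (a', m', (s', t')) =
     (a \<otimes>\<^bsub>A\<^esub> a', \<rho> a \<otimes>\<^bsub>S\<^esub> m' \<oplus>\<^bsub>S\<^esub> m \<otimes>\<^bsub>S\<^esub> s', (s \<otimes>\<^bsub>S\<^esub> s', s \<otimes>\<^bsub>S\<^esub> t' \<oplus>\<^bsub>S\<^esub> t \<otimes>\<^bsub>S\<^esub> s'))"
  by (simp_all add: \<Lambda>_eq triangular_matrix_ring_def trivial_extension_def canonical_epi_def)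

lemma ring_\<Lambda>: "ring \<Lambda>"
proof (rule ringI)
  show "abelian_group \<Lambda>"
  proof (rule abelian_groupI)
    show "\<exists>y\<in>carrier \<Lambda>. y \<oplus>\<^bsub>\<Lambda>\<^esub> x = \<zero>\<^bsub>\<Lambda>\<^esub>" if "x \<in> carrier \<Lambda>" for x
    proof -
      obtain a m s t where x: "x = (a, m, (s, t))" by (metis prod.exhaust)
      then show ?thesis using that
        by (intro bexI[of _ "(\<ominus>\<^bsub>A\<^esub> a, \<ominus>\<^bsub>S\<^esub> m, (\<ominus>\<^bsub>S\<^esub> s, \<ominus>\<^bsub>S\<^esub> t))"]) (auto simp: A.l_neg S.l_neg)
    qed
  qed (auto simp: A.a_ac S.a_ac)
  show "Group.monoid \<Lambda>"
    by (rule monoidI) (auto simp: A.m_assoc S.m_assoc S.l_distr S.r_distr S.a_ac)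
qed (auto simp: A.l_distr A.r_distr S.l_distr S.r_distr S.a_ac)

sublocale \<Lambda>: ring \<Lambda> by (rule ring_\<Lambda>)

text \<open>\<open>\<alpha>\<close> and \<open>\<beta>\<close> are the ring homomorphisms along
  which an \<open>A\<close>-module X becomes (X, 0) and an \<open>S\<close>-module W becomes (0, W);
  the latter also drops the nilpotent part of B.\<close>

definition \<alpha> :: "'a \<times> 's \<times> ('s \<times> 's) \<Rightarrow> 'a" where "\<alpha> = (\<lambda>(a, m, (s, t)). a)"
definition \<beta> :: "'a \<times> 's \<times> ('s \<times> 's) \<Rightarrow> 's" where "\<beta> = (\<lambda>(a, m, (s, t)). s)"

lemma \<alpha>_simp [simp]: "\<alpha> (a, m, (s, t)) = a" by (simp add: \<alpha>_def)
lemma \<beta>_simp [simp]: "\<beta> (a, m, (s, t)) = s" by (simp add: \<beta>_def)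

lemma \<alpha>_hom: "\<alpha> \<in> ring_hom \<Lambda> A" by (rule ring_hom_memI) auto
lemma \<beta>_hom: "\<beta> \<in> ring_hom \<Lambda> S" by (rule ring_hom_memI) auto

lemma right_module_\<alpha>: "right_module A M \<Longrightarrow> right_module \<Lambda> (restr_scalars \<alpha> M)"
  by (rule right_module_restr_scalars[OF ring_\<Lambda> \<alpha>_hom])

lemma right_module_\<beta>: "right_module S M \<Longrightarrow> right_module \<Lambda> (restr_scalars \<beta> M)"
  by (rule right_module_restr_scalars[OF ring_\<Lambda> \<beta>_hom])

text \<open>\<open>(0, W \<otimes> B)\<close>: a pair \<open>(w, w')\<close> stands for \<open>w + w' x\<close>, where \<open>B = S[x]/(x\<^sup>2)\<close>.\<close>

definition double :: "('s, 'm) rmodule \<Rightarrow> ('a \<times> 's \<times> ('s \<times> 's), 'm \<times> 'm) rmodule" where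
  "double W = \<lparr>carrier = carrier W \<times> carrier W, mult = undefined, one = undefined,
     zero = (\<zero>\<^bsub>W\<^esub>, \<zero>\<^bsub>W\<^esub>), add = (\<lambda>(w, w') (u, u'). (w \<oplus>\<^bsub>W\<^esub> u, w' \<oplus>\<^bsub>W\<^esub> u')),
     act = (\<lambda>(w, w') (a, m, (s, t)). (w \<bullet>\<^bsub>W\<^esub> s, w \<bullet>\<^bsub>W\<^esub> t \<oplus>\<^bsub>W\<^esub> w' \<bullet>\<^bsub>W\<^esub> s))\<rparr>"

lemma double_simps [simp]:
  "carrier (double W) = carrier W \<times> carrier W" "\<zero>\<^bsub>double W\<^esub> = (\<zero>\<^bsub>W\<^esub>, \<zero>\<^bsub>W\<^esub>)"
  "(w, w') \<oplus>\<^bsub>double W\<^esub> (u, u') = (w \<oplus>\<^bsub>W\<^esub> u, w' \<oplus>\<^bsub>W\<^esub> u')"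
  "(w, w') \<bullet>\<^bsub>double W\<^esub> (a, m, (s, t)) = (w \<bullet>\<^bsub>W\<^esub> s, w \<bullet>\<^bsub>W\<^esub> t \<oplus>\<^bsub>W\<^esub> w' \<bullet>\<^bsub>W\<^esub> s)"
  by (simp_all add: double_def)

lemma right_module_double:
  assumes "right_module S W"
  shows "right_module \<Lambda> (double W)"
proof -
  interpret W: right_module S W by fact
  show ?thesis
  proof (rule right_moduleI)
    show "\<exists>y\<in>carrier (double W). y \<oplus>\<^bsub>double W\<^esub> x = \<zero>\<^bsub>double W\<^esub>" if "x \<in> carrier (double W)" for x
      using that by (auto intro!: bexI[of _ "(\<ominus>\<^bsub>W\<^esub> fst x, \<ominus>\<^bsub>W\<^esub> snd x)"] simp: W.l_neg)
  qed (auto simp: ring_\<Lambda> W.a_ac W.act_closed W.act_add_left W.act_add_right W.act_assoc W.act_one)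
qed

text \<open>A dual basis of \<open>W\<close> is extended from \<open>S\<close> to B: the generators
  are regarded as constants, and the functionals are applied to both coefficients.\<close>

lemma fg_projective_double:
  assumes "fg_projective S W"
  shows "fg_projective \<Lambda> (double W)"
proof -
  interpret W: right_module S W using assms by (rule fg_projective_right_module)
  interpret D: right_module \<Lambda> "double W" by (rule right_module_double[OF W.right_module_axioms])
  obtain n :: nat and x f where db: "dual_basis S W {..<n} x f" using assms by (rule fg_projectiveE) blast
  note dbD = dual_basisD[OF db]
  have fc: "f i w \<in> carrier S" if "i < n" "w \<in> carrier W" for i w using dbD(5) that by simp
  define y where "y i = (x i, \<zero>\<^bsub>W\<^esub>)" for i
  define g where "g i = (\<lambda>(w, w'). (\<zero>\<^bsub>A\<^esub>, \<zero>\<^bsub>S\<^esub>, (f i w, f i w')))" for i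
  have "dual_basis \<Lambda> (double W) {..<n} y g"
    unfolding dual_basis_def
  proof (intro conjI ballI)
    show "y \<in> {..<n} \<rightarrow> carrier (double W)" using dbD(2) by (auto simp: y_def)
    show "g i \<in> rmodule_hom \<Lambda> (double W) (reg_module \<Lambda>)" if "i \<in> {..<n}" for i
      using that hom_add[OF dbD(3)] hom_act[OF dbD(3)] fc
      by (intro rmodule_homI) (auto simp: g_def W.act_closed)
    fix p assume p: "p \<in> carrier (double W)"
    then obtain w w' where w: "p = (w, w')" "w \<in> carrier W" "w' \<in> carrier W" by auto
    let ?t = "\<lambda>i. y i \<bullet>\<^bsub>double W\<^esub> g i p"
    have t: "?t i = (x i \<bullet>\<^bsub>W\<^esub> f i w, x i \<bullet>\<^bsub>W\<^esub> f i w')" if "i < n" for i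
      using that dbD(2) fc w by (simp add: y_def g_def W.act_closed)
    have c: "?t \<in> {..<n} \<rightarrow> carrier (double W)"
      using dbD(2) fc w(2,3) by (auto simp: t W.act_closed)
    have "fst (\<Oplus>\<^bsub>double W\<^esub>i\<in>{..<n}. ?t i) = (\<Oplus>\<^bsub>W\<^esub>i\<in>{..<n}. fst (?t i))"
      by (intro additive_finsum c D.abelian_group_axioms W.abelian_group_axioms) auto
    also have "\<dots> = (\<Oplus>\<^bsub>W\<^esub>i\<in>{..<n}. x i \<bullet>\<^bsub>W\<^esub> f i w)"
      using dbD(2) fc w(2,3) by (intro W.finsum_cong') (auto simp: t W.act_closed)
    also have "\<dots> = w" using dbD(4) w by simp
    finally have 1: "fst (\<Oplus>\<^bsub>double W\<^esub>i\<in>{..<n}. ?t i) = w" .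
    have "snd (\<Oplus>\<^bsub>double W\<^esub>i\<in>{..<n}. ?t i) = (\<Oplus>\<^bsub>W\<^esub>i\<in>{..<n}. snd (?t i))"
      by (intro additive_finsum c D.abelian_group_axioms W.abelian_group_axioms) auto
    also have "\<dots> = (\<Oplus>\<^bsub>W\<^esub>i\<in>{..<n}. x i \<bullet>\<^bsub>W\<^esub> f i w')"
      using dbD(2) fc w(2,3) by (intro W.finsum_cong') (auto simp: t W.act_closed)
    also have "\<dots> = w'" using dbD(4) w by simp
    finally show "(\<Oplus>\<^bsub>double W\<^esub>i\<in>{..<n}. ?t i) = p" using 1 by (intro prod_eqI) (simp_all add: w(1))
  qed simp
  then show ?thesis by (rule fg_projectiveI[OF D.right_module_axioms])
qed

text \<open>The kernel consists of the multiples by the square-zero element x. A submodule that maps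
  onto \<open>W\<close> contains its own multiples by x, and these fill the kernel; dropping the
  factor x identifies the kernel with \<open>W\<close>.\<close>

lemma cover_double:
  assumes "fg_projective S W"
  shows "projective_cover \<Lambda> (double W) fst (restr_scalars \<beta> W)"
    and "rmodule_iso \<Lambda> (restrict_module (double W) (a_kernel (double W) (restr_scalars \<beta> W) fst))
      (restr_scalars \<beta> W)"
proof -
  interpret W: right_module S W using assms by (rule fg_projective_right_module)
  interpret D: right_module \<Lambda> "double W" by (rule right_module_double[OF W.right_module_axioms])
  have h: "fst \<in> rmodule_hom \<Lambda> (double W) (restr_scalars \<beta> W)" by (rule rmodule_homI) auto
  interpret h: rmod_hom \<Lambda> "double W" "restr_scalars \<beta> W" fst
    by (intro rmod_homI h D.right_module_axioms right_module_\<beta> W.right_module_axioms)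
  have ker: "a_kernel (double W) (restr_scalars \<beta> W) fst = {\<zero>\<^bsub>W\<^esub>} \<times> carrier W"
    by (auto simp: h.kernel_eq)
  have "superfluous \<Lambda> (a_kernel (double W) (restr_scalars \<beta> W) fst) (double W)"
  proof (rule superfluousI[OF h.rsub_kernel])
    fix N assume N: "rsubmodule \<Lambda> N (double W)"
      and *: "\<And>p. p \<in> carrier (double W) \<Longrightarrow>
        \<exists>n\<in>N. \<exists>k\<in>a_kernel (double W) (restr_scalars \<beta> W) fst. p = n \<oplus>\<^bsub>double W\<^esub> k"
    have NW: "u \<in> carrier W" "u' \<in> carrier W" if "(u, u') \<in> N" for u u' using rsub_in[OF N that] by auto
    have 1: "\<exists>w'. (w, w') \<in> N" if w: "w \<in> carrier W" for w
    proof -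
      obtain u u' k where "(u, u') \<in> N" "k \<in> {\<zero>\<^bsub>W\<^esub>} \<times> carrier W" "(w, \<zero>\<^bsub>W\<^esub>) = (u, u') \<oplus>\<^bsub>double W\<^esub> k"
        using *[of "(w, \<zero>\<^bsub>W\<^esub>)"] w unfolding ker by auto
      then show ?thesis using NW by auto
    qed
    have 2: "(\<zero>\<^bsub>W\<^esub>, w) \<in> N" if w: "w \<in> carrier W" for w
    proof -
      obtain w' where w': "(w, w') \<in> N" using 1[OF w] ..
      show ?thesis
        using rsub_act[OF N w', of "(\<zero>\<^bsub>A\<^esub>, \<zero>\<^bsub>S\<^esub>, (\<zero>\<^bsub>S\<^esub>, \<one>\<^bsub>S\<^esub>))"] NW[OF w'] by (simp add: W.act_one)
    qed
    show "carrier (double W) \<subseteq> N"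
    proof
      fix p assume "p \<in> carrier (double W)"
      then obtain w w' where w: "p = (w, w')" "w \<in> carrier W" "w' \<in> carrier W" by auto
      obtain u where u: "(w, u) \<in> N" using 1[OF w(2)] ..
      have "(w, u) \<oplus>\<^bsub>double W\<^esub> (\<zero>\<^bsub>W\<^esub>, \<ominus>\<^bsub>W\<^esub> u \<oplus>\<^bsub>W\<^esub> w') \<in> N"
        using rsub_add[OF N u 2] NW[OF u] w by simp
      then show "p \<in> N" using w NW[OF u] by (simp add: W.r_neg2)
    qed
  qed
  moreover have "fst ` carrier (double W) = carrier (restr_scalars \<beta> W)" by force
  ultimately show "projective_cover \<Lambda> (double W) fst (restr_scalars \<beta> W)"
    using h fg_projective_double[OF assms] by (simp add: projective_cover_def)
  show "rmodule_iso \<Lambda> (restrict_module (double W) (a_kernel (double W) (restr_scalars \<beta> W) fst))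
      (restr_scalars \<beta> W)"
    unfolding ker
    by (rule rmodule_isoI[of snd _ _ _ "\<lambda>w. (\<zero>\<^bsub>W\<^esub>, w)"]) (auto intro!: rmodule_homI simp: W.act_closed)
qed

text \<open>\<open>(P, U)\<close> with structure map induced by \<open>\<tau> : P \<rightarrow> U\<close>; for \<open>U\<close> the top of a projective \<open>P\<close> this is
  the projective \<open>\<Lambda>\<close>-module \<open>P \<otimes> e \<Lambda>\<close>.\<close>

definition twisted :: "('a, 'p) rmodule \<Rightarrow> ('s, 'u) rmodule \<Rightarrow> ('p \<Rightarrow> 'u) \<Rightarrow>
    ('a \<times> 's \<times> ('s \<times> 's), 'p \<times> 'u) rmodule" where
  "twisted P U \<tau> = \<lparr>carrier = carrier P \<times> carrier U, mult = undefined, one = undefined,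
     zero = (\<zero>\<^bsub>P\<^esub>, \<zero>\<^bsub>U\<^esub>), add = (\<lambda>(p, u) (q, v). (p \<oplus>\<^bsub>P\<^esub> q, u \<oplus>\<^bsub>U\<^esub> v)),
     act = (\<lambda>(p, u) (a, m, (s, t)). (p \<bullet>\<^bsub>P\<^esub> a, \<tau> p \<bullet>\<^bsub>U\<^esub> m \<oplus>\<^bsub>U\<^esub> u \<bullet>\<^bsub>U\<^esub> s))\<rparr>"

lemma twisted_simps [simp]:
  "carrier (twisted P U \<tau>) = carrier P \<times> carrier U" "\<zero>\<^bsub>twisted P U \<tau>\<^esub> = (\<zero>\<^bsub>P\<^esub>, \<zero>\<^bsub>U\<^esub>)"
  "(p, u) \<oplus>\<^bsub>twisted P U \<tau>\<^esub> (q, v) = (p \<oplus>\<^bsub>P\<^esub> q, u \<oplus>\<^bsub>U\<^esub> v)"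
  "(p, u) \<bullet>\<^bsub>twisted P U \<tau>\<^esub> (a, m, (s, t)) = (p \<bullet>\<^bsub>P\<^esub> a, \<tau> p \<bullet>\<^bsub>U\<^esub> m \<oplus>\<^bsub>U\<^esub> u \<bullet>\<^bsub>U\<^esub> s)"
  by (simp_all add: twisted_def)

lemma right_module_twisted:
  assumes "right_module A P" "right_module S U" and \<tau>: "\<tau> \<in> rmodule_hom A P (restr_scalars \<rho> U)"
  shows "right_module \<Lambda> (twisted P U \<tau>)"
proof -
  interpret P: right_module A P by fact
  interpret U: right_module S U by fact
  interpret \<tau>: rmod_hom A P "restr_scalars \<rho> U" \<tau>
    by (intro rmod_homI \<tau> P.right_module_axioms right_module_restr_scalars[OF A.ring_axioms \<rho>_hom] U.right_module_axioms)
  note \<tau>s = \<tau>.closed[simplified] \<tau>.add[simplified] \<tau>.act[simplified]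
  show ?thesis
  proof (rule right_moduleI)
    show "\<exists>y\<in>carrier (twisted P U \<tau>). y \<oplus>\<^bsub>twisted P U \<tau>\<^esub> x = \<zero>\<^bsub>twisted P U \<tau>\<^esub>"
      if "x \<in> carrier (twisted P U \<tau>)" for x
      using that by (auto intro!: bexI[of _ "(\<ominus>\<^bsub>P\<^esub> fst x, \<ominus>\<^bsub>U\<^esub> snd x)"] simp: P.l_neg U.l_neg)
  qed (auto simp: ring_\<Lambda> P.a_ac U.a_ac P.act_closed U.act_closed P.act_add_left U.act_add_left
      P.act_add_right U.act_add_right P.act_assoc U.act_assoc P.act_one U.act_one \<tau>s)
qed

text \<open>The kernel splits because \<open>\<tau>\<close> vanishes on the kernel of \<open>p\<close>, which lies in the radical.\<close>

lemma cover_twisted: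
  assumes cov: "projective_cover A P p Y" and Y: "right_module A Y"
  obtains U :: "('s, nat \<Rightarrow> 's) rmodule" and \<tau> c where "fg_projective S U"
    "projective_cover \<Lambda> (twisted P U \<tau>) c (restr_scalars \<alpha> Y)"
    "rmodule_iso \<Lambda> (restrict_module (twisted P U \<tau>) (a_kernel (twisted P U \<tau>) (restr_scalars \<alpha> Y) c))
      (rmodule_sum (restr_scalars \<alpha> (restrict_module P (a_kernel P Y p))) (restr_scalars \<beta> U))"
proof -
  note cv = projective_coverD[OF cov]
  interpret p: rmod_hom A P Y p using cv Y by (simp add: rmod_homI)
  obtain n :: nat and x f and U :: "('s, nat \<Rightarrow> 's) rmodule" and \<tau> g where
    db: "dual_basis A P {..<n} x f" and dbU: "dual_basis S U {..<n} (\<lambda>i. \<tau> (x i)) g"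
    and U: "right_module S U" and \<tau>: "\<tau> \<in> rmodule_hom A P (restr_scalars \<rho> U)"
    and onto: "\<tau> ` carrier P = carrier U"
    and g\<tau>: "\<And>i p. i < n \<Longrightarrow> p \<in> carrier P \<Longrightarrow> g i (\<tau> p) = \<rho> (f i p)"
    and kill: "\<And>K q. superfluous A K P \<Longrightarrow> q \<in> K \<Longrightarrow> \<tau> q = \<zero>\<^bsub>U\<^esub>"
    by (rule top_exists[OF cv(1)]) blast
  interpret U: right_module S U by (rule U)
  let ?C = "twisted P U \<tau>" and ?Y = "restr_scalars \<alpha> Y"
  interpret C: right_module \<Lambda> ?C by (rule right_module_twisted[OF cv(2) U \<tau>])
  interpret \<tau>: rmod_hom A P "restr_scalars \<rho> U" \<tau>
    by (intro rmod_homI \<tau> cv right_module_restr_scalars[OF A.ring_axioms \<rho>_hom] U)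
  note \<tau>s = \<tau>.closed[simplified] \<tau>.add[simplified] \<tau>.act[simplified]
  note dbD = dual_basisD[OF db] and dbUD = dual_basisD[OF dbU]
  have fc: "f i q \<in> carrier A" if "i < n" "q \<in> carrier P" for i q using dbD(5) that by simp
  have gc: "g i u \<in> carrier S" if "i < n" "u \<in> carrier U" for i u using dbUD(5) that by simp
  define y where "y i = (x i, \<zero>\<^bsub>U\<^esub>)" for i
  \<comment> \<open>The values lie in the first row of \<Lambda>. Linearity with respect to
    off-diagonal entries is the compatibility
    \<open>g i (\<tau> p) = \<rho> (f i p)\<close>.\<close>
  define h where "h i = (\<lambda>(q, u). (f i q, g i u, (\<zero>\<^bsub>S\<^esub>, \<zero>\<^bsub>S\<^esub>)))" for i
  have "dual_basis \<Lambda> ?C {..<n} y h"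
    unfolding dual_basis_def
  proof (intro conjI ballI)
    show "y \<in> {..<n} \<rightarrow> carrier ?C" using dbD(2) by (auto simp: y_def)
    show "h i \<in> rmodule_hom \<Lambda> ?C (reg_module \<Lambda>)" if "i \<in> {..<n}" for i
      using that hom_add[OF dbD(3)] hom_act[OF dbD(3)] hom_add[OF dbUD(3)] hom_act[OF dbUD(3)] fc gc
      by (intro rmodule_homI) (auto simp: h_def U.act_closed \<tau>s g\<tau>)
    fix q assume "q \<in> carrier ?C"
    then obtain w w' where w: "q = (w, w')" "w \<in> carrier P" "w' \<in> carrier U" by auto
    let ?t = "\<lambda>i. y i \<bullet>\<^bsub>?C\<^esub> h i q"
    have xc: "x i \<in> carrier P" if "i < n" for i using dbD(2) that by simp
    have t: "?t i = (x i \<bullet>\<^bsub>P\<^esub> f i w, \<tau> (x i) \<bullet>\<^bsub>U\<^esub> g i w')" if "i < n" for i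
      using that xc gc w by (simp add: y_def h_def U.act_closed \<tau>s)
    have c: "?t \<in> {..<n} \<rightarrow> carrier ?C"
      using xc fc gc w(2,3) by (auto simp: t U.act_closed p.M.act_closed \<tau>s)
    have "fst (\<Oplus>\<^bsub>?C\<^esub>i\<in>{..<n}. ?t i) = (\<Oplus>\<^bsub>P\<^esub>i\<in>{..<n}. fst (?t i))"
      by (intro additive_finsum c C.abelian_group_axioms p.M.abelian_group_axioms) auto
    also have "\<dots> = (\<Oplus>\<^bsub>P\<^esub>i\<in>{..<n}. x i \<bullet>\<^bsub>P\<^esub> f i w)"
      using xc fc w(2,3) by (intro p.M.finsum_cong') (auto simp: t p.M.act_closed)
    also have "\<dots> = w" using dbD(4) w by simp
    finally have 1: "fst (\<Oplus>\<^bsub>?C\<^esub>i\<in>{..<n}. ?t i) = w" .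
    have "snd (\<Oplus>\<^bsub>?C\<^esub>i\<in>{..<n}. ?t i) = (\<Oplus>\<^bsub>U\<^esub>i\<in>{..<n}. snd (?t i))"
      by (intro additive_finsum c C.abelian_group_axioms U.abelian_group_axioms) auto
    also have "\<dots> = (\<Oplus>\<^bsub>U\<^esub>i\<in>{..<n}. \<tau> (x i) \<bullet>\<^bsub>U\<^esub> g i w')"
      using xc gc w(2,3) by (intro U.finsum_cong') (auto simp: t U.act_closed \<tau>s)
    also have "\<dots> = w'" using dbUD(4) w by simp
    finally show "(\<Oplus>\<^bsub>?C\<^esub>i\<in>{..<n}. ?t i) = q" using 1 by (intro prod_eqI) (simp_all add: w(1))
  qed simp
  then have proj: "fg_projective \<Lambda> ?C" by (rule fg_projectiveI[OF C.right_module_axioms])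
  let ?c = "\<lambda>(q, u). p q"
  have c: "?c \<in> rmodule_hom \<Lambda> ?C ?Y" by (rule rmodule_homI) auto
  interpret c: rmod_hom \<Lambda> ?C ?Y ?c by (intro rmod_homI c C.right_module_axioms right_module_\<alpha> Y)
  have ker: "a_kernel ?C ?Y ?c = a_kernel P Y p \<times> carrier U"
    by (auto simp: c.kernel_eq p.kernel_eq)
  have "superfluous \<Lambda> (a_kernel ?C ?Y ?c) ?C"
  proof (rule superfluousI[OF c.rsub_kernel])
    fix N assume N: "rsubmodule \<Lambda> N ?C"
      and *: "\<And>q. q \<in> carrier ?C \<Longrightarrow> \<exists>n\<in>N. \<exists>k\<in>a_kernel ?C ?Y ?c. q = n \<oplus>\<^bsub>?C\<^esub> k"
    have NC: "q \<in> carrier P" "u \<in> carrier U" if "(q, u) \<in> N" for q u using rsub_in[OF N that] by auto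
    \<comment> \<open>Multiplication with the idempotent of \<open>A\<close> cuts off the second
      component.\<close>
    have idem: "(q, \<zero>\<^bsub>U\<^esub>) \<in> N" if "(q, u) \<in> N" for q u
      using rsub_act[OF N that, of "(\<one>\<^bsub>A\<^esub>, \<zero>\<^bsub>S\<^esub>, (\<zero>\<^bsub>S\<^esub>, \<zero>\<^bsub>S\<^esub>))"] NC[OF that]
      by (simp add: p.M.act_one \<tau>s)
    let ?N = "{q \<in> carrier P. (q, \<zero>\<^bsub>U\<^esub>) \<in> N}"
    have "rsubmodule A ?N P"
    proof (rule p.M.rsubmoduleI)
      show "x \<oplus>\<^bsub>P\<^esub> y \<in> ?N" if "x \<in> ?N" "y \<in> ?N" for x y
        using that rsub_add[OF N, of "(x, \<zero>\<^bsub>U\<^esub>)" "(y, \<zero>\<^bsub>U\<^esub>)"] by simp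
      show "x \<bullet>\<^bsub>P\<^esub> a \<in> ?N" if "x \<in> ?N" "a \<in> carrier A" for x a
        using that rsub_act[OF N, of "(x, \<zero>\<^bsub>U\<^esub>)" "(a, \<zero>\<^bsub>S\<^esub>, (\<zero>\<^bsub>S\<^esub>, \<zero>\<^bsub>S\<^esub>))"] by (simp add: p.M.act_closed \<tau>s)
    qed (use rsub_zero[OF N] in auto)
    then have "?N = carrier P"
    proof (rule p.M.superfluousD[OF cv(5)])
      fix q assume "q \<in> carrier P"
      then obtain q1 u1 q2 u2 where "(q1, u1) \<in> N" "q2 \<in> a_kernel P Y p" "(q, \<zero>\<^bsub>U\<^esub>) = (q1, u1) \<oplus>\<^bsub>?C\<^esub> (q2, u2)"
        using *[of "(q, \<zero>\<^bsub>U\<^esub>)"] unfolding ker by auto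
      then show "\<exists>n\<in>?N. \<exists>k\<in>a_kernel P Y p. q = n \<oplus>\<^bsub>P\<^esub> k"
        using idem NC by (intro bexI[of _ q1] bexI[of _ q2]) auto
    qed
    then have 1: "(q, \<zero>\<^bsub>U\<^esub>) \<in> N" if "q \<in> carrier P" for q using that by blast
    \<comment> \<open>The off-diagonal matrix unit sends \<open>(q, 0)\<close> to
      \<open>(0, \<tau> q)\<close>, and \<open>\<tau>\<close> is onto.\<close>
    have 2: "(\<zero>\<^bsub>P\<^esub>, u) \<in> N" if u: "u \<in> carrier U" for u
    proof -
      obtain q where q: "q \<in> carrier P" "u = \<tau> q" using onto u by blast
      show ?thesis
        using rsub_act[OF N 1[OF q(1)], of "(\<zero>\<^bsub>A\<^esub>, \<one>\<^bsub>S\<^esub>, (\<zero>\<^bsub>S\<^esub>, \<zero>\<^bsub>S\<^esub>))"] q by (simp add: U.act_one \<tau>s)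
    qed
    show "carrier ?C \<subseteq> N"
    proof
      fix z assume "z \<in> carrier ?C"
      then obtain q u where z: "z = (q, u)" "q \<in> carrier P" "u \<in> carrier U" by auto
      then show "z \<in> N" using rsub_add[OF N 1[OF z(2)] 2[OF z(3)]] by simp
    qed
  qed
  moreover have "?c ` carrier ?C = carrier ?Y"
  proof -
    have "?c ` (carrier P \<times> carrier U) = p ` carrier P" by force
    then show ?thesis using cv(4) by simp
  qed
  ultimately have "projective_cover \<Lambda> ?C ?c ?Y" using c proj by (simp add: projective_cover_def)
  moreover have "rmodule_iso \<Lambda> (restrict_module ?C (a_kernel ?C ?Y ?c))
      (rmodule_sum (restr_scalars \<alpha> (restrict_module P (a_kernel P Y p))) (restr_scalars \<beta> U))"
    unfolding ker
    by (rule rmodule_isoI[of "\<lambda>x. x" _ _ _ "\<lambda>x. x"])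
      (auto intro!: rmodule_homI simp: kill[OF cv(5)] U.act_closed)
  ultimately show ?thesis using that fg_projectiveI[OF U dbU] by blast
qed

end

section \<open>Deloopability\<close>

lemma deloopableD:
  fixes X :: "'a umodule"
  assumes "deloopable R X d" "right_module R X"
  obtains Y P M Z :: "'a umodule" where "syzygy R d X Y" "right_module R Y" "fg_projective R P"
    "fg_module R M" "syzygy R (Suc d) M Z" "right_module R Z" "retract R Y (rmodule_sum P Z)"
proof -
  obtain Y P M Z :: "'a umodule" where *: "syzygy R d X Y" "fg_projective R P" "fg_module R M"
    "syzygy R (Suc d) M Z" "iso_summand R Y (rmodule_sum P Z)"
    using assms(1) by (auto simp: deloopable_def)
  have Y: "right_module R Y" using syzygy_right_module[OF *(1) assms(2)] .
  have Z: "right_module R Z" using syzygy_right_module[OF *(4) fg_module_right_module[OF *(3)]] .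
  have "retract R Y (rmodule_sum P Z)"
    using *(5) iso_summand_iff_retract[OF Y right_module_sum[OF fg_projective_right_module[OF *(2)] Z]] by blast
  then show ?thesis using that * Y Z by blast
qed

lemma deloopableI:
  fixes X P :: "'a umodule"
  assumes "right_module R X" "syzygy R d X Y" "fg_projective R P" "fg_module R M" "syzygy R (Suc d) M Z"
    "retract R Y (rmodule_sum P Z)"
  shows "deloopable R X d"
proof -
  have Y: "right_module R Y" using syzygy_right_module assms(1,2) by blast
  have Z: "right_module R Z" using syzygy_right_module[OF assms(5) fg_module_right_module[OF assms(4)]] .
  have "iso_summand R Y (rmodule_sum P Z)"
    using assms(6) iso_summand_iff_retract[OF Y right_module_sum[OF fg_projective_right_module[OF assms(3)] Z]] by blast
  then show ?thesis using assms unfolding deloopable_def by blast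
qed

lemma deloopable_if_retract:
  fixes X :: "'a umodule"
  assumes "right_module R X" "syzygy R d X Y" "fg_module R M" "syzygy R (Suc d) M Z" "retract R Y Z"
  shows "deloopable R X d"
proof -
  have Z: "right_module R Z" using syzygy_right_module[OF assms(4) fg_module_right_module[OF assms(3)]] .
  interpret right_module R X by fact
  obtain P :: "'a umodule" where P: "fg_projective R P"
    by (rule fg_projective_umodule[OF fg_projective_free[OF R.ring_axioms]]) blast
  show ?thesis
    by (rule deloopableI[OF assms(1,2) P assms(3,4)
      retract_trans[OF assms(5) retract_sum_right[OF fg_projective_right_module[OF P] Z]]])
qed

lemma fg_module_of_cover:
  assumes "projective_cover R P p X" "right_module R X"
  shows "fg_module R X"
  using projective_coverD[OF assms(1)] fg_module_image[OF fg_projective_imp_fg _ _ _] assms(2) by blast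

text \<open>The zeroth syzygy of \<open>V\<close> is \<open>V\<close> itself, so it suffices to find
  \<open>V\<close> as a summand of the kernel of a single cover, whose target may have any carrier
  type.\<close>

lemma deloopable_0:
  fixes V :: "'a umodule" and X :: "('a, 'b) rmodule"
  assumes V: "right_module R V" and cov: "projective_cover R P p X" and X: "right_module R X"
    and "retract R V (restrict_module P (a_kernel P X p))"
  shows "deloopable R V 0"
proof -
  obtain X' :: "'a umodule" where X': "fg_module R X'" "rmodule_iso R X X'"
    using fg_module_iso_umodule[OF fg_module_of_cover[OF cov X]] by blast
  note X'm = fg_module_right_module[OF X'(1)]
  obtain Z where Z: "syzygy R (Suc 0) X' Z" "rmodule_iso R Z (restrict_module P (a_kernel P X p))"
    by (rule syzygy_step[OF syzygy_0 X'm X rmodule_iso_sym[OF X X'(2)] cov]) blast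
  have "retract R V Z"
    using retract_trans[OF assms(4) iso_imp_retract(2)[OF syzygy_right_module[OF Z(1) X'm] Z(2)]] .
  then show ?thesis by (rule deloopable_if_retract[OF V syzygy_0 X'(1) Z(1)])
qed

lemma del_module_mono:
  assumes "\<And>d. deloopable R V d \<Longrightarrow> deloopable R' T d"
  shows "del_module R' T \<le> del_module R V"
  unfolding del_module_def by (rule Inf_superset_mono) (use assms in blast)

lemma del_module_le: "deloopable R V d \<Longrightarrow> del_module R V \<le> enat d"
  unfolding del_module_def by (rule Inf_lower) blast

text \<open>If some \<open>d\<close> works then the infimum is attained; otherwise the right hand
  side is infinite.\<close>

lemma del_module_Suc:
  assumes "\<And>d. deloopable R T d \<Longrightarrow> deloopable R' V (Suc d)"
  shows "del_module R' V \<le> del_module R T + 1"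
proof (cases "\<exists>d. deloopable R T d")
  case True
  then obtain d0 where "enat d0 \<in> {enat d | d. deloopable R T d}" by blast
  then have "del_module R T \<in> {enat d | d. deloopable R T d}"
    unfolding del_module_def by (rule wellorder_InfI)
  then obtain d where d: "deloopable R T d" "del_module R T = enat d" by blast
  then show ?thesis using del_module_le[OF assms[OF d(1)]] by (simp add: one_enat_def)
next
  case False
  then have "del_module R T = \<infinity>" by (simp add: del_module_def top_enat_def)
  then show ?thesis by simp
qed

lemma del_module_le_del: "simple_module R V \<Longrightarrow> del_module R V \<le> del R"
  unfolding del_def by (rule Sup_upper) blast

lemma del_leI:
  fixes R :: "('a, 'c) ring_scheme"
  assumes "\<And>V :: 'a umodule. simple_module R V \<Longrightarrow> del_module R V \<le> c"
  shows "del R \<le> c"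
  unfolding del_def by (rule Sup_least) (use assms in blast)

text \<open>By the Noetherian property syzygies remain finitely generated, so that the next
  projective cover exists.\<close>

lemma (in artin_algebra) syzygy_fg:
  assumes "syzygy A d X Y" "fg_module A X"
  shows "fg_module A Y"
  using assms
proof (induction rule: syzygy.induct)
  case (syzygy_Suc d X Y P p)
  note cv = projective_coverD[OF syzygy_Suc(2)]
  interpret p: rmod_hom A P Y p
    using cv syzygy_Suc fg_module_right_module by (intro rmod_homI) auto
  show ?case by (rule fg_module_rsub[OF fg_projective_imp_fg[OF cv(1)] p.rsub_kernel])
qed

section \<open>Syzygies over the triangular matrix algebra\<close>

context triangular_extension
begin

text \<open>The pair (X, W) with zero structure map, the shape that the syzygies of (X, 0) keep up
  to isomorphism.\<close>

abbreviation inflate :: "('a, 'p) rmodule \<Rightarrow> ('s, 'q) rmodule \<Rightarrow> ('a \<times> 's \<times> ('s \<times> 's), 'p \<times> 'q) rmodule" where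
  "inflate X W \<equiv> rmodule_sum (restr_scalars \<alpha> X) (restr_scalars \<beta> W)"

lemma right_module_inflate:
  "right_module A X \<Longrightarrow> right_module S W \<Longrightarrow> right_module \<Lambda> (inflate X W)"
  by (intro right_module_sum right_module_\<alpha> right_module_\<beta>)

lemma \<alpha>_onto: "\<alpha> ` carrier \<Lambda> = carrier A"
proof
  show "carrier A \<subseteq> \<alpha> ` carrier \<Lambda>"
  proof
    fix a assume "a \<in> carrier A"
    then show "a \<in> \<alpha> ` carrier \<Lambda>"
      by (intro image_eqI[of _ _ "(a, \<zero>\<^bsub>S\<^esub>, (\<zero>\<^bsub>S\<^esub>, \<zero>\<^bsub>S\<^esub>))"]) auto
  qed
qed auto

lemma \<beta>_onto: "\<beta> ` carrier \<Lambda> = carrier S"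
proof
  show "carrier S \<subseteq> \<beta> ` carrier \<Lambda>"
  proof
    fix s assume "s \<in> carrier S"
    then show "s \<in> \<beta> ` carrier \<Lambda>"
      by (intro image_eqI[of _ _ "(\<zero>\<^bsub>A\<^esub>, \<zero>\<^bsub>S\<^esub>, (s, \<zero>\<^bsub>S\<^esub>))"]) auto
  qed
qed auto

text \<open>In each step the semisimple part grows by the top \<open>U\<close> of the cover over
  \<open>A\<close>, while the old part is reproduced by its cover \<open>double\<close>. That
  \<open>W\<close> stays a summand is recorded for the comparison of two syzygies with different
  semisimple parts.\<close>

lemma syzygy_inflate:
  fixes W :: "'s umodule"
  assumes "syzygy A d X Y" "right_module A X" "fg_projective S W"
    and X': "right_module \<Lambda> X'" "rmodule_iso \<Lambda> X' (inflate X W)"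
  shows "\<exists>Y' (W' :: 's umodule). syzygy \<Lambda> d X' Y' \<and> fg_projective S W' \<and> retract S W W' \<and>
    rmodule_iso \<Lambda> Y' (inflate Y W')"
  using assms
proof (induction rule: syzygy.induct)
  case (syzygy_0 X)
  then show ?case
    by (intro exI[of _ X'] exI[of _ W] conjI syzygy.syzygy_0 retract_refl)
next
  case (syzygy_Suc d X Y P p)
  obtain Y' and W' :: "'s umodule" where Y': "syzygy \<Lambda> d X' Y'" "fg_projective S W'" "retract S W W'"
    "rmodule_iso \<Lambda> Y' (inflate Y W')" using syzygy_Suc.IH[OF syzygy_Suc.prems] by blast
  note cov = \<open>projective_cover A P p Y\<close>
  have Y: "right_module A Y" by (rule syzygy_right_module[OF syzygy_Suc(1,4)])
  have W'm: "right_module S W'" by (rule fg_projective_right_module[OF Y'(2)])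
  obtain U :: "('s, nat \<Rightarrow> 's) rmodule" and \<tau> c where U: "fg_projective S U"
    and c: "projective_cover \<Lambda> (twisted P U \<tau>) c (restr_scalars \<alpha> Y)"
    and kerc: "rmodule_iso \<Lambda> (restrict_module (twisted P U \<tau>) (a_kernel (twisted P U \<tau>) (restr_scalars \<alpha> Y) c))
      (rmodule_sum (restr_scalars \<alpha> (restrict_module P (a_kernel P Y p))) (restr_scalars \<beta> U))"
    by (rule cover_twisted[OF cov Y]) blast
  let ?K = "restrict_module P (a_kernel P Y p)"
  let ?T = "twisted P U \<tau>" and ?D = "double W'"
  let ?q = "\<lambda>(x, y). (c x, fst y)"
  note sum = projective_cover_sum[OF c cover_double(1)[OF Y'(2)] right_module_\<alpha>[OF Y] right_module_\<beta>[OF W'm]]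
  obtain Z where Z: "syzygy \<Lambda> (Suc d) X' Z"
    "rmodule_iso \<Lambda> Z (restrict_module (rmodule_sum ?T ?D) (a_kernel (rmodule_sum ?T ?D) (inflate Y W') ?q))"
    by (rule syzygy_step[OF Y'(1) X'(1) right_module_inflate[OF Y W'm] Y'(4) sum(1)]) blast
  have Um: "right_module S U" by (rule fg_projective_right_module[OF U])
  have UW: "fg_projective S (rmodule_sum U W')" by (rule fg_projective_sum[OF U Y'(2)])
  obtain W2 :: "'s umodule" where W2: "fg_projective S W2" "rmodule_iso S (rmodule_sum U W') W2"
    by (rule fg_projective_umodule[OF UW]) blast
  have T: "right_module \<Lambda> (restrict_module ?T (a_kernel ?T (restr_scalars \<alpha> Y) c))"
  proof -
    interpret c: rmod_hom \<Lambda> ?T "restr_scalars \<alpha> Y" c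
      by (intro rmod_homI projective_coverD[OF c] right_module_\<alpha> Y)
    show ?thesis by (rule c.M.right_module_restrict[OF c.rsub_kernel])
  qed
  have D: "right_module \<Lambda> (restrict_module ?D (a_kernel ?D (restr_scalars \<beta> W') fst))"
  proof -
    interpret c: rmod_hom \<Lambda> ?D "restr_scalars \<beta> W'" fst
      by (intro rmod_homI projective_coverD[OF cover_double(1)[OF Y'(2)]] right_module_\<beta> W'm)
    show ?thesis by (rule c.M.right_module_restrict[OF c.rsub_kernel])
  qed
  have "rmodule_iso \<Lambda> Z (rmodule_sum (inflate ?K U) (restr_scalars \<beta> W'))"
    by (rule rmodule_iso_trans[OF Z(2) rmodule_iso_trans[OF sum(2)
      rmodule_iso_sum[OF T D kerc cover_double(2)[OF Y'(2)]]]])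
  moreover have "rmodule_iso \<Lambda> (rmodule_sum (inflate ?K U) (restr_scalars \<beta> W')) (inflate ?K (rmodule_sum U W'))"
    by (rule rmodule_isoI[of "\<lambda>((x, y), z). (x, (y, z))" _ _ _ "\<lambda>(x, (y, z)). ((x, y), z)"])
      (auto intro!: rmodule_homI)
  moreover have "rmodule_iso \<Lambda> (inflate ?K (rmodule_sum U W')) (inflate ?K W2)"
  proof (rule rmodule_iso_sum[OF _ _ rmodule_iso_refl rmodule_iso_restr_scalars[OF W2(2) \<beta>_hom]])
    interpret p: rmod_hom A P Y p by (intro rmod_homI projective_coverD[OF cov] Y)
    show "right_module \<Lambda> (restr_scalars \<alpha> ?K)"
      by (rule right_module_\<alpha>[OF p.M.right_module_restrict[OF p.rsub_kernel]])
    show "right_module \<Lambda> (restr_scalars \<beta> (rmodule_sum U W'))"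
      by (rule right_module_\<beta>[OF fg_projective_right_module[OF UW]])
  qed
  ultimately have "rmodule_iso \<Lambda> Z (inflate ?K W2)" by (rule rmodule_iso_trans[OF _ rmodule_iso_trans])
  moreover have "retract S W W2"
    using retract_trans[OF retract_trans[OF Y'(3) retract_sum_right[OF Um W'm]]
      iso_imp_retract(1)[OF fg_projective_right_module[OF UW] W2(2)]] .
  ultimately show ?case using Z(1) W2(1) by blast
qed

text \<open>After one more syzygy over \<open>A\<close>, \<open>Y1\<close> is a summand of
  \<open>Z1\<close> alone, without \<open>P\<close>. Over \<Lambda> the syzygy of \<open>V\<close>
  has in addition the semisimple part \<open>W1\<close>. It is determined before the delooping
  module \<open>M'\<close> is formed, so \<open>M'\<close> can be taken as a copy of (M,
  W1).\<close>

lemma deloopable_inflate_Suc: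
  fixes T :: "'a umodule"
  assumes T: "fg_module A T" and del: "deloopable A T d"
    and V: "right_module \<Lambda> V" "rmodule_iso \<Lambda> V (restr_scalars \<alpha> T)"
  shows "deloopable \<Lambda> V (Suc d)"
proof -
  note Tm = fg_module_right_module[OF T]
  obtain Y P M Z :: "'a umodule" where Y: "syzygy A d T Y" "right_module A Y" and P: "fg_projective A P"
    and M: "fg_module A M" and Z: "syzygy A (Suc d) M Z" "right_module A Z"
    and r: "retract A Y (rmodule_sum P Z)"
    by (rule deloopableD[OF del Tm]) blast
  note Mm = fg_module_right_module[OF M]
  obtain P1 :: "('a, nat \<Rightarrow> 'a) rmodule" and p1 where p1: "projective_cover A P1 p1 Y"
    by (rule projective_cover_exists[OF syzygy_fg[OF Y(1) T]]) blast
  obtain Q :: "('a, nat \<Rightarrow> 'a) rmodule" and q where q: "projective_cover A Q q Z"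
    by (rule projective_cover_exists[OF syzygy_fg[OF Z(1) M]]) blast
  obtain Y1 where Y1: "syzygy A (Suc d) T Y1" "rmodule_iso A Y1 (restrict_module P1 (a_kernel P1 Y p1))"
    by (rule syzygy_step[OF Y(1) Tm Y(2) rmodule_iso_refl p1]) blast
  obtain Z1 where Z1: "syzygy A (Suc (Suc d)) M Z1" "rmodule_iso A Z1 (restrict_module Q (a_kernel Q Z q))"
    by (rule syzygy_step[OF Z(1) Mm Z(2) rmodule_iso_refl q]) blast
  have Y1m: "right_module A Y1" by (rule syzygy_right_module[OF Y1(1) Tm])
  have Z1m: "right_module A Z1" by (rule syzygy_right_module[OF Z1(1) Mm])
  have YZ: "retract A Y1 Z1"
    by (rule retract_trans[OF iso_imp_retract(1)[OF Y1m Y1(2)] retract_trans[OF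
      projective_cover_kernel_retract_sum[OF p1 q P Y(2) Z(2) r] iso_imp_retract(2)[OF Z1m Z1(2)]]])
  have F0: "fg_projective S (free_module S 0)" by (rule fg_projective_free[OF S.ring_axioms])
  \<comment> \<open>A zero module on the required carrier type, which gives (T, 0) the form handled
    by \<open>syzygy_inflate\<close>.\<close>
  obtain W0 :: "'s umodule" where W0: "fg_projective S W0" "rmodule_iso S (free_module S 0) W0"
    by (rule fg_projective_umodule[OF F0]) blast
  note W0m = fg_projective_right_module[OF W0(1)]
  interpret W0: right_module S W0 by (rule W0m)
  obtain f where "bij_betw f (carrier (free_module S 0)) (carrier W0)"
    using W0(2) unfolding rmodule_iso_def by blast
  then have "card (carrier W0) = 1" using bij_betw_same_card by fastforce
  then have W00: "carrier W0 = {\<zero>\<^bsub>W0\<^esub>}" using W0.zero_closed by (metis card_1_singletonE singletonD)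
  have "rmodule_iso \<Lambda> (restr_scalars \<alpha> T) (inflate T W0)"
    by (rule rmodule_isoI[of "\<lambda>x. (x, \<zero>\<^bsub>W0\<^esub>)" _ _ _ fst]) (auto intro!: rmodule_homI simp: W00)
  then have VT: "rmodule_iso \<Lambda> V (inflate T W0)" by (rule rmodule_iso_trans[OF V(2)])
  obtain V1 and W1 :: "'s umodule" where V1: "syzygy \<Lambda> (Suc d) V V1" "fg_projective S W1"
    "rmodule_iso \<Lambda> V1 (inflate Y1 W1)"
    using syzygy_inflate[OF Y1(1) Tm W0(1) V(1) VT] by blast
  note W1m = fg_projective_right_module[OF V1(2)]
  have "fg_module \<Lambda> (inflate M W1)"
    by (intro fg_module_sum fg_module_restr_scalars[OF ring_\<Lambda> \<alpha>_hom \<alpha>_onto M]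
      fg_module_restr_scalars[OF ring_\<Lambda> \<beta>_hom \<beta>_onto fg_projective_imp_fg[OF V1(2)]])
  then obtain M' :: "('a \<times> 's \<times> ('s \<times> 's)) umodule" where M': "fg_module \<Lambda> M'" "rmodule_iso \<Lambda> (inflate M W1) M'"
    using fg_module_iso_umodule by blast
  note M'm = fg_module_right_module[OF M'(1)]
  obtain N1 and W2 :: "'s umodule" where N1: "syzygy \<Lambda> (Suc (Suc d)) M' N1" "fg_projective S W2"
    "retract S W1 W2" "rmodule_iso \<Lambda> N1 (inflate Z1 W2)"
    using syzygy_inflate[OF Z1(1) Mm V1(2) M'm rmodule_iso_sym[OF right_module_inflate[OF Mm W1m] M'(2)]] by blast
  have "retract \<Lambda> V1 (inflate Y1 W1)"
    by (rule iso_imp_retract(1)[OF syzygy_right_module[OF V1(1) V(1)] V1(3)])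
  moreover have "retract \<Lambda> (inflate Y1 W1) (inflate Z1 W2)"
    by (rule retract_sum[OF retract_restr_scalars[OF YZ \<alpha>_hom] retract_restr_scalars[OF N1(3) \<beta>_hom]])
  moreover have "retract \<Lambda> (inflate Z1 W2) N1"
    by (rule iso_imp_retract(2)[OF syzygy_right_module[OF N1(1) M'm] N1(4)])
  ultimately have "retract \<Lambda> V1 N1" by (rule retract_trans[OF _ retract_trans])
  then show ?thesis by (rule deloopable_if_retract[OF V(1) V1(1) M'(1) N1(1)])
qed

section \<open>The corner of \<open>A\<close> in the matrix algebra and the lower bound\<close>

definition \<iota> :: "'a \<Rightarrow> 'a \<times> 's \<times> ('s \<times> 's)" where
  "\<iota> a = (a, \<zero>\<^bsub>S\<^esub>, (\<zero>\<^bsub>S\<^esub>, \<zero>\<^bsub>S\<^esub>))"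

abbreviation \<epsilon> :: "'a \<times> 's \<times> ('s \<times> 's)" where "\<epsilon> \<equiv> \<iota> \<one>\<^bsub>A\<^esub>"

lemma \<iota>_closed [simp]: "\<iota> a \<in> carrier \<Lambda> \<longleftrightarrow> a \<in> carrier A"
  by (simp add: \<iota>_def)

lemma \<iota>_add: "a \<in> carrier A \<Longrightarrow> b \<in> carrier A \<Longrightarrow> \<iota> (a \<oplus>\<^bsub>A\<^esub> b) = \<iota> a \<oplus>\<^bsub>\<Lambda>\<^esub> \<iota> b"
  by (simp add: \<iota>_def)

lemma \<iota>_mult: "a \<in> carrier A \<Longrightarrow> b \<in> carrier A \<Longrightarrow> \<iota> (a \<otimes>\<^bsub>A\<^esub> b) = \<iota> a \<otimes>\<^bsub>\<Lambda>\<^esub> \<iota> b"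
  by (simp add: \<iota>_def)

lemma \<alpha>_\<iota> [simp]: "\<alpha> (\<iota> a) = a"
  by (simp add: \<iota>_def)

lemma \<alpha>_closed [simp]: "x \<in> carrier \<Lambda> \<Longrightarrow> \<alpha> x \<in> carrier A"
  by (rule ring_hom_closed[OF \<alpha>_hom])

text \<open>The first column of an upper triangular matrix has a single entry, so
  \<Lambda>\<epsilon> is just a copy of \<open>A\<close>. This is why the corner functor takes
  projective modules to projective modules.\<close>

lemma mult_\<epsilon>: "x \<in> carrier \<Lambda> \<Longrightarrow> x \<otimes>\<^bsub>\<Lambda>\<^esub> \<epsilon> = \<iota> (\<alpha> x)"
  by (cases x) (auto simp: \<iota>_def)

lemma \<epsilon>_mult_\<iota>: "a \<in> carrier A \<Longrightarrow> \<epsilon> \<otimes>\<^bsub>\<Lambda>\<^esub> \<iota> a = \<iota> a"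
  by (simp add: \<iota>_def)

text \<open>The \<open>A\<close>-module \<open>V \<epsilon>\<close>, encoded by the fixed points of
  the idempotent, so that homomorphisms restrict to it as the same functions.\<close>

definition corner :: "('a \<times> 's \<times> ('s \<times> 's), 'v) rmodule \<Rightarrow> ('a, 'v) rmodule" where
  "corner V = \<lparr>carrier = {v \<in> carrier V. v \<bullet>\<^bsub>V\<^esub> \<epsilon> = v}, mult = undefined, one = undefined,
     zero = \<zero>\<^bsub>V\<^esub>, add = add V, act = (\<lambda>v a. v \<bullet>\<^bsub>V\<^esub> \<iota> a)\<rparr>"

lemma corner_simps [simp]:
  "carrier (corner V) = {v \<in> carrier V. v \<bullet>\<^bsub>V\<^esub> \<epsilon> = v}" "\<zero>\<^bsub>corner V\<^esub> = \<zero>\<^bsub>V\<^esub>"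
  "x \<oplus>\<^bsub>corner V\<^esub> y = x \<oplus>\<^bsub>V\<^esub> y" "x \<bullet>\<^bsub>corner V\<^esub> a = x \<bullet>\<^bsub>V\<^esub> \<iota> a"
  by (simp_all add: corner_def)

lemma act_\<epsilon>:
  assumes "right_module \<Lambda> V" "v \<in> carrier V" "x \<in> carrier \<Lambda>"
  shows "(v \<bullet>\<^bsub>V\<^esub> x) \<bullet>\<^bsub>V\<^esub> \<epsilon> = v \<bullet>\<^bsub>V\<^esub> \<iota> (\<alpha> x)" "(v \<bullet>\<^bsub>V\<^esub> \<epsilon>) \<bullet>\<^bsub>V\<^esub> \<iota> (\<alpha> x) = v \<bullet>\<^bsub>V\<^esub> \<iota> (\<alpha> x)"
    "(v \<bullet>\<^bsub>V\<^esub> \<iota> (\<alpha> x)) \<bullet>\<^bsub>V\<^esub> \<epsilon> = v \<bullet>\<^bsub>V\<^esub> \<iota> (\<alpha> x)"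
proof -
  interpret V: right_module \<Lambda> V by fact
  have e: "\<epsilon> \<in> carrier \<Lambda>" "\<iota> (\<alpha> x) \<in> carrier \<Lambda>" using assms(3) by (simp_all del: \<Lambda>_simps)
  show "(v \<bullet>\<^bsub>V\<^esub> x) \<bullet>\<^bsub>V\<^esub> \<epsilon> = v \<bullet>\<^bsub>V\<^esub> \<iota> (\<alpha> x)"
    using V.act_assoc[OF assms(2,3) e(1)] mult_\<epsilon>[OF assms(3)] by simp
  show "(v \<bullet>\<^bsub>V\<^esub> \<epsilon>) \<bullet>\<^bsub>V\<^esub> \<iota> (\<alpha> x) = v \<bullet>\<^bsub>V\<^esub> \<iota> (\<alpha> x)"
    using V.act_assoc[OF assms(2) e] \<epsilon>_mult_\<iota>[OF \<alpha>_closed[OF assms(3)]] by simp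
  show "(v \<bullet>\<^bsub>V\<^esub> \<iota> (\<alpha> x)) \<bullet>\<^bsub>V\<^esub> \<epsilon> = v \<bullet>\<^bsub>V\<^esub> \<iota> (\<alpha> x)"
    using V.act_assoc[OF assms(2) e(2,1)] mult_\<epsilon>[OF e(2)] by simp
qed

lemma \<epsilon>_in: "\<epsilon> \<in> carrier \<Lambda>" by (simp del: \<Lambda>_simps)

lemma act_\<iota>_in_corner:
  assumes "right_module \<Lambda> V" "v \<in> carrier V" "a \<in> carrier A"
  shows "v \<bullet>\<^bsub>V\<^esub> \<iota> a \<in> carrier (corner V)"
  using act_\<epsilon>(3)[OF assms(1,2), of "\<iota> a"] right_module.act_closed[OF assms(1,2), of "\<iota> a"] assms(3)
  by (simp del: \<Lambda>_simps)

lemma right_module_corner: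
  assumes "right_module \<Lambda> V"
  shows "right_module A (corner V)"
proof -
  interpret V: right_module \<Lambda> V by fact
  show ?thesis
  proof (rule right_moduleI)
    show "\<exists>y\<in>carrier (corner V). y \<oplus>\<^bsub>corner V\<^esub> x = \<zero>\<^bsub>corner V\<^esub>" if "x \<in> carrier (corner V)" for x
      using that \<epsilon>_in by (intro bexI[of _ "\<ominus>\<^bsub>V\<^esub> x"]) (auto simp: V.act_neg_left V.l_neg simp del: \<Lambda>_simps)
    show "x \<bullet>\<^bsub>corner V\<^esub> a \<in> carrier (corner V)" if "x \<in> carrier (corner V)" "a \<in> carrier A" for x a
      using act_\<iota>_in_corner[OF assms, of x a] that by simp
  qed (use \<epsilon>_in in \<open>auto simp: A.ring_axioms V.a_ac V.act_add_left V.act_add_right V.act_assoc \<iota>_add \<iota>_mult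
        simp del: \<Lambda>_simps\<close>)
qed

lemma hom_corner:
  assumes "f \<in> rmodule_hom \<Lambda> V W"
  shows "f \<in> rmodule_hom A (corner V) (corner W)"
proof (rule rmodule_homI)
  show "f x \<in> carrier (corner W)" if "x \<in> carrier (corner V)" for x
    using that hom_closed[OF assms, of x] hom_act[OF assms _ \<epsilon>_in, of x] by (simp del: \<Lambda>_simps)
  show "f (x \<oplus>\<^bsub>corner V\<^esub> y) = f x \<oplus>\<^bsub>corner W\<^esub> f y"
    if "x \<in> carrier (corner V)" "y \<in> carrier (corner V)" for x y
    using that hom_add[OF assms, of x y] by simp
  show "f (x \<bullet>\<^bsub>corner V\<^esub> a) = f x \<bullet>\<^bsub>corner W\<^esub> a"
    if "x \<in> carrier (corner V)" "a \<in> carrier A" for x a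
    using that hom_act[OF assms, of x "\<iota> a"] by (simp del: \<Lambda>_simps)
qed

lemma hom_corner_onto:
  assumes V: "right_module \<Lambda> V" and f: "f \<in> rmodule_hom \<Lambda> V W" "f ` carrier V = carrier W"
  shows "f ` carrier (corner V) = carrier (corner W)"
proof
  show "f ` carrier (corner V) \<subseteq> carrier (corner W)" using hom_closed[OF hom_corner[OF f(1)]] by auto
  show "carrier (corner W) \<subseteq> f ` carrier (corner V)"
  proof
    fix w assume w: "w \<in> carrier (corner W)"
    then obtain v where v: "v \<in> carrier V" "w = f v" using f(2) by auto
    have "f (v \<bullet>\<^bsub>V\<^esub> \<epsilon>) = w" using hom_act[OF f(1) v(1) \<epsilon>_in] w v(2) by simp
    then show "w \<in> f ` carrier (corner V)"
      using act_\<iota>_in_corner[OF V v(1), of "\<one>\<^bsub>A\<^esub>"] by (metis A.one_closed image_eqI)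
  qed
qed

lemma retract_corner:
  assumes "retract \<Lambda> V W"
  shows "retract A (corner V) (corner W)"
proof -
  obtain i r where *: "i \<in> rmodule_hom \<Lambda> V W" "r \<in> rmodule_hom \<Lambda> W V" "\<And>x. x \<in> carrier V \<Longrightarrow> r (i x) = x"
    using assms by (rule retractE) blast
  show ?thesis by (rule retractI[OF hom_corner[OF *(1)] hom_corner[OF *(2)]]) (simp add: *(3))
qed

lemma rmodule_iso_corner:
  assumes "right_module \<Lambda> V" "rmodule_iso \<Lambda> V W"
  shows "rmodule_iso A (corner V) (corner W)"
proof -
  obtain f g where *: "f \<in> rmodule_hom \<Lambda> V W" "g \<in> rmodule_hom \<Lambda> W V"
    "\<And>x. x \<in> carrier V \<Longrightarrow> g (f x) = x" "\<And>y. y \<in> carrier W \<Longrightarrow> f (g y) = y"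
    by (rule rmodule_isoE[OF assms]) blast
  show ?thesis
    by (rule rmodule_isoI[OF hom_corner[OF *(1)] hom_closed[OF hom_corner[OF *(2)]]]) (auto simp: *(3,4))
qed

lemma retract_corner_free: "retract A (corner (free_module \<Lambda> n)) (free_module A n)"
proof (rule retractI[of "\<lambda>v. \<lambda>i\<in>{..<n}. \<alpha> (v i)" _ _ _ "\<lambda>w. \<lambda>i\<in>{..<n}. \<iota> (w i)"])
  note \<alpha> = ring_hom_add[OF \<alpha>_hom] ring_hom_mult[OF \<alpha>_hom] \<alpha>_closed
  show "(\<lambda>v. \<lambda>i\<in>{..<n}. \<alpha> (v i)) \<in> rmodule_hom A (corner (free_module \<Lambda> n)) (free_module A n)"
    by (rule rmodule_homI) (auto simp: \<alpha> PiE_iff fun_eq_iff simp del: \<Lambda>_simps)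
  show "(\<lambda>w. \<lambda>i\<in>{..<n}. \<iota> (w i)) \<in> rmodule_hom A (free_module A n) (corner (free_module \<Lambda> n))"
    by (rule rmodule_homI) (auto simp: mult_\<epsilon> \<iota>_add \<iota>_mult PiE_iff fun_eq_iff simp del: \<Lambda>_simps)
  show "(\<lambda>i\<in>{..<n}. \<iota> ((\<lambda>i\<in>{..<n}. \<alpha> (v i)) i)) = v" if v: "v \<in> carrier (corner (free_module \<Lambda> n))" for v
  proof -
    have vF: "v \<in> {..<n} \<rightarrow>\<^sub>E carrier \<Lambda>" and ve: "(\<lambda>i\<in>{..<n}. v i \<otimes>\<^bsub>\<Lambda>\<^esub> \<epsilon>) = v"
      using v by (simp_all del: \<Lambda>_simps)
    have "(\<lambda>i\<in>{..<n}. \<iota> ((\<lambda>i\<in>{..<n}. \<alpha> (v i)) i)) = (\<lambda>i\<in>{..<n}. v i \<otimes>\<^bsub>\<Lambda>\<^esub> \<epsilon>)"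
      using vF by (intro ext) (auto simp: mult_\<epsilon> PiE_iff simp del: \<Lambda>_simps)
    then show ?thesis using ve by simp
  qed
qed

lemma fg_projective_corner:
  assumes "fg_projective \<Lambda> P"
  shows "fg_projective A (corner P)"
proof -
  have P: "right_module \<Lambda> P" by (rule fg_projective_right_module[OF assms])
  obtain n where "retract \<Lambda> P (free_module \<Lambda> n)" using assms by (auto simp: fg_projective_iff_retract)
  then have "retract A (corner P) (free_module A n)"
    by (rule retract_trans[OF retract_corner retract_corner_free])
  then show ?thesis using right_module_corner[OF P] by (auto simp: fg_projective_iff_retract)
qed

lemma fg_module_corner:
  assumes "fg_module \<Lambda> M"
  shows "fg_module A (corner M)"
proof -
  have M: "right_module \<Lambda> M" by (rule fg_module_right_module[OF assms])
  obtain n h where h: "h \<in> rmodule_hom \<Lambda> (free_module \<Lambda> n) M" "h ` carrier (free_module \<Lambda> n) = carrier M"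
    using assms fg_module_iff_free_image[OF M] by blast
  show ?thesis
    by (rule fg_module_image[OF fg_projective_imp_fg[OF fg_projective_corner[OF fg_projective_free[OF ring_\<Lambda>]]]
        right_module_corner[OF M] hom_corner[OF h(1)] hom_corner_onto[OF \<Lambda>.right_module_free h]])
qed

text \<open>A submodule \<open>N\<close> of the corner is enlarged to all \<open>v\<close> with
  \<open>v \<epsilon>\<close> in \<open>N\<close>. This is a \<Lambda>-submodule because
  \<open>(v l) \<epsilon>\<close> depends only on \<open>v \<epsilon>\<close> and \<open>l\<close>,
  and it spans \<open>P\<close> with the full kernel whenever \<open>N\<close> spans the corner with
  the kernel there.\<close>

lemma projective_cover_corner:
  assumes cov: "projective_cover \<Lambda> P p Y" and Y: "right_module \<Lambda> Y"
  shows "projective_cover A (corner P) p (corner Y)"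
    and "rmodule_iso A (restrict_module (corner P) (a_kernel (corner P) (corner Y) p))
      (corner (restrict_module P (a_kernel P Y p)))"
proof -
  note cv = projective_coverD[OF cov]
  interpret p: rmod_hom \<Lambda> P Y p by (intro rmod_homI cv Y)
  interpret pc: rmod_hom A "corner P" "corner Y" p
    by (intro rmod_homI right_module_corner hom_corner cv Y)
  have ker: "a_kernel (corner P) (corner Y) p = {v \<in> a_kernel P Y p. v \<bullet>\<^bsub>P\<^esub> \<epsilon> = v}"
    by (auto simp: pc.kernel_eq p.kernel_eq)
  have K: "rsubmodule \<Lambda> (a_kernel P Y p) P" by (rule p.rsub_kernel)
  have "superfluous A (a_kernel (corner P) (corner Y) p) (corner P)"
  proof (rule superfluousI[OF pc.rsub_kernel])
    fix N assume N: "rsubmodule A N (corner P)"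
      and *: "\<And>q. q \<in> carrier (corner P) \<Longrightarrow> \<exists>n\<in>N. \<exists>k\<in>a_kernel (corner P) (corner Y) p. q = n \<oplus>\<^bsub>corner P\<^esub> k"
    have NP: "n \<in> carrier P" "n \<bullet>\<^bsub>P\<^esub> \<epsilon> = n" if "n \<in> N" for n using rsub_in[OF N that] by auto
    let ?N = "{v \<in> carrier P. v \<bullet>\<^bsub>P\<^esub> \<epsilon> \<in> N}"
    have "rsubmodule \<Lambda> ?N P"
    proof (rule p.M.rsubmoduleI)
      show "\<zero>\<^bsub>P\<^esub> \<in> ?N" using rsub_zero[OF N] \<epsilon>_in by (simp del: \<Lambda>_simps)
      show "x \<oplus>\<^bsub>P\<^esub> y \<in> ?N" if "x \<in> ?N" "y \<in> ?N" for x y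
        using that rsub_add[OF N, of "x \<bullet>\<^bsub>P\<^esub> \<epsilon>" "y \<bullet>\<^bsub>P\<^esub> \<epsilon>"] \<epsilon>_in by (simp add: p.M.act_add_left del: \<Lambda>_simps)
      show "x \<bullet>\<^bsub>P\<^esub> l \<in> ?N" if xl: "x \<in> ?N" "l \<in> carrier \<Lambda>" for x l
      proof -
        have "(x \<bullet>\<^bsub>P\<^esub> \<epsilon>) \<bullet>\<^bsub>P\<^esub> \<iota> (\<alpha> l) \<in> N" using rsub_act[OF N, of "x \<bullet>\<^bsub>P\<^esub> \<epsilon>" "\<alpha> l"] xl by (simp del: \<Lambda>_simps)
        then show ?thesis using act_\<epsilon>(1,2)[OF cv(2) _ xl(2), of x] xl p.M.act_closed by (simp del: \<Lambda>_simps)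
      qed
    qed auto
    then have "?N = carrier P"
    proof (rule p.M.superfluousD[OF cv(5)])
      fix v assume v: "v \<in> carrier P"
      note * [OF act_\<iota>_in_corner[OF cv(2) v A.one_closed]]
      then obtain n k where nk: "n \<in> N" "k \<in> a_kernel P Y p" "k \<bullet>\<^bsub>P\<^esub> \<epsilon> = k" "v \<bullet>\<^bsub>P\<^esub> \<epsilon> = n \<oplus>\<^bsub>P\<^esub> k"
        unfolding ker by auto
      have k: "k \<in> carrier P" and n: "n \<in> carrier P" using rsub_in[OF K nk(2)] NP(1)[OF nk(1)] .
      have "(v \<ominus>\<^bsub>P\<^esub> k) \<bullet>\<^bsub>P\<^esub> \<epsilon> = n"
        using v k n \<epsilon>_in nk(3,4) by (simp add: a_minus_def p.M.act_add_left p.M.act_neg_left p.M.a_assoc p.M.r_neg del: \<Lambda>_simps)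
      moreover have "v = (v \<ominus>\<^bsub>P\<^esub> k) \<oplus>\<^bsub>P\<^esub> k" using v k by (simp add: a_minus_def p.M.a_assoc p.M.l_neg)
      ultimately show "\<exists>n\<in>?N. \<exists>k\<in>a_kernel P Y p. v = n \<oplus>\<^bsub>P\<^esub> k"
        using nk(1,2) v k by (intro bexI[of _ "v \<ominus>\<^bsub>P\<^esub> k"] bexI[of _ k]) auto
    qed
    then show "carrier (corner P) \<subseteq> N" by force
  qed
  then show "projective_cover A (corner P) p (corner Y)"
    unfolding projective_cover_def
    using fg_projective_corner[OF cv(1)] hom_corner[OF cv(3)] hom_corner_onto[OF cv(2-4)] by blast
  show "rmodule_iso A (restrict_module (corner P) (a_kernel (corner P) (corner Y) p))
      (corner (restrict_module P (a_kernel P Y p)))"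
    unfolding ker by (rule rmodule_isoI[of "\<lambda>x. x" _ _ _ "\<lambda>x. x"]) (auto intro!: rmodule_homI)
qed

lemma syzygy_corner:
  assumes "syzygy \<Lambda> d X Y" "right_module \<Lambda> X" "right_module A X'" "rmodule_iso A X' (corner X)"
  shows "\<exists>Y'. syzygy A d X' Y' \<and> rmodule_iso A Y' (corner Y)"
  using assms
proof (induction rule: syzygy.induct)
  case (syzygy_0 X)
  then show ?case by (intro exI[of _ X'] conjI syzygy.syzygy_0)
next
  case (syzygy_Suc d X Y P p)
  obtain Y' where Y': "syzygy A d X' Y'" "rmodule_iso A Y' (corner Y)"
    using syzygy_Suc.IH[OF syzygy_Suc.prems] by blast
  have Y: "right_module \<Lambda> Y" by (rule syzygy_right_module[OF syzygy_Suc(1,4)])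
  note cov = projective_cover_corner[OF syzygy_Suc(2) Y]
  obtain Z where Z: "syzygy A (Suc d) X' Z"
    "rmodule_iso A Z (restrict_module (corner P) (a_kernel (corner P) (corner Y) p))"
    by (rule syzygy_step[OF Y'(1) syzygy_Suc(5) right_module_corner[OF Y] Y'(2) cov(1)]) blast
  then show ?case using rmodule_iso_trans[OF Z(2) cov(2)] by blast
qed

text \<open>All data of the definition pass to the corner: covers, projective modules, sums and
  retracts. Hence there is no shift of \<open>d\<close>.\<close>

lemma deloopable_corner:
  fixes T :: "'a umodule"
  assumes del: "deloopable \<Lambda> V d" and V: "right_module \<Lambda> V" and T: "right_module A T" "rmodule_iso A T (corner V)"
  shows "deloopable A T d"
proof -
  obtain Y P M Z :: "('a \<times> 's \<times> ('s \<times> 's)) umodule" where Y: "syzygy \<Lambda> d V Y" "right_module \<Lambda> Y" and P: "fg_projective \<Lambda> P"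
    and M: "fg_module \<Lambda> M" and Z: "syzygy \<Lambda> (Suc d) M Z" "right_module \<Lambda> Z"
    and r: "retract \<Lambda> Y (rmodule_sum P Z)"
    by (rule deloopableD[OF del V]) blast
  note Mm = fg_module_right_module[OF M]
  obtain Y' where Y': "syzygy A d T Y'" "rmodule_iso A Y' (corner Y)"
    using syzygy_corner[OF Y(1) V T] by blast
  obtain M' :: "'a umodule" where M': "fg_module A M'" "rmodule_iso A (corner M) M'"
    using fg_module_iso_umodule[OF fg_module_corner[OF M]] by blast
  note M'm = fg_module_right_module[OF M'(1)]
  obtain Z' where Z': "syzygy A (Suc d) M' Z'" "rmodule_iso A Z' (corner Z)"
    using syzygy_corner[OF Z(1) Mm M'm rmodule_iso_sym[OF right_module_corner[OF Mm] M'(2)]] by blast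
  obtain P' :: "'a umodule" where P': "fg_projective A P'" "rmodule_iso A (corner P) P'"
    by (rule fg_projective_umodule[OF fg_projective_corner[OF P]]) blast
  have "retract A Y' (corner Y)" by (rule iso_imp_retract(1)[OF syzygy_right_module[OF Y'(1) T(1)] Y'(2)])
  moreover have "retract A (corner Y) (corner (rmodule_sum P Z))" by (rule retract_corner[OF r])
  moreover have "retract A (corner (rmodule_sum P Z)) (rmodule_sum (corner P) (corner Z))"
    by (rule retractI[of "\<lambda>x. x" _ _ _ "\<lambda>x. x"]) (auto intro!: rmodule_homI)
  moreover have "retract A (rmodule_sum (corner P) (corner Z)) (rmodule_sum P' Z')"
    by (rule retract_sum[OF
      iso_imp_retract(1)[OF right_module_corner[OF fg_projective_right_module[OF P]] P'(2)]
      iso_imp_retract(2)[OF syzygy_right_module[OF Z'(1) M'm] Z'(2)]])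
  ultimately have "retract A Y' (rmodule_sum P' Z')"
    by (rule retract_trans[OF _ retract_trans[OF _ retract_trans]])
  then show ?thesis by (rule deloopableI[OF T(1) Y'(1) P'(1) M'(1) Z'(1)])
qed

lemma rmodule_iso_corner_restr_scalars:
  assumes "right_module A T"
  shows "rmodule_iso A T (corner (restr_scalars \<alpha> T))"
proof -
  interpret T: right_module A T by fact
  show ?thesis
    by (rule rmodule_isoI[of "\<lambda>x. x" _ _ _ "\<lambda>x. x"]) (auto intro!: rmodule_homI simp: T.act_one)
qed

text \<open>A simple \<open>A\<close>-module stays simple over \<Lambda>, and its corner gives it
  back.\<close>

lemma del_le_del_\<Lambda>: "del A \<le> del \<Lambda>"
proof (rule del_leI)
  fix T :: "'a umodule" assume T: "simple_module A T"
  have Tm: "right_module A T" using T by (simp add: simple_module_def)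
  obtain V :: "('a \<times> 's \<times> ('s \<times> 's)) umodule" where V: "fg_module \<Lambda> V" "rmodule_iso \<Lambda> (restr_scalars \<alpha> T) V"
    using fg_module_iso_umodule[OF fg_module_restr_scalars[OF ring_\<Lambda> \<alpha>_hom \<alpha>_onto simple_module_fg[OF T]]] by blast
  note Vm = fg_module_right_module[OF V(1)]
  have "simple_module \<Lambda> V"
    by (rule simple_module_iso[OF simple_module_restr_scalars[OF ring_\<Lambda> \<alpha>_hom \<alpha>_onto T] Vm V(2)])
  moreover have "rmodule_iso A T (corner V)"
    by (rule rmodule_iso_trans[OF rmodule_iso_corner_restr_scalars[OF Tm]
      rmodule_iso_corner[OF right_module_\<alpha>[OF Tm] V(2)]])
  then have "del_module A T \<le> del_module \<Lambda> V"
    by (intro del_module_mono deloopable_corner[OF _ Vm Tm])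
  ultimately show "del_module A T \<le> del \<Lambda>" using del_module_le_del order_trans by blast
qed

section \<open>Simple modules over the matrix algebra and the upper bound\<close>

lemma act_\<beta>_kernel:
  assumes V: "right_module \<Lambda> V" and v: "v \<in> carrier V" "v \<bullet>\<^bsub>V\<^esub> \<epsilon> = \<zero>\<^bsub>V\<^esub>"
    "v \<bullet>\<^bsub>V\<^esub> (\<zero>\<^bsub>A\<^esub>, \<zero>\<^bsub>S\<^esub>, (\<zero>\<^bsub>S\<^esub>, \<one>\<^bsub>S\<^esub>)) = \<zero>\<^bsub>V\<^esub>"
    and r: "r \<in> carrier \<Lambda>" "\<beta> r = \<zero>\<^bsub>S\<^esub>"
  shows "v \<bullet>\<^bsub>V\<^esub> r = \<zero>\<^bsub>V\<^esub>"
proof -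
  interpret V: right_module \<Lambda> V by fact
  let ?x = "(\<zero>\<^bsub>A\<^esub>, \<zero>\<^bsub>S\<^esub>, (\<zero>\<^bsub>S\<^esub>, \<one>\<^bsub>S\<^esub>))"
  obtain a m t where r': "r = (a, m, (\<zero>\<^bsub>S\<^esub>, t))" "a \<in> carrier A" "m \<in> carrier S" "t \<in> carrier S"
    using r by auto
  let ?p = "(a, m, (\<zero>\<^bsub>S\<^esub>, \<zero>\<^bsub>S\<^esub>))" and ?q = "(\<zero>\<^bsub>A\<^esub>, \<zero>\<^bsub>S\<^esub>, (t, \<zero>\<^bsub>S\<^esub>))"
  \<comment> \<open>The kernel of \<open>\<beta>\<close> is generated, as a right ideal, by
    \<epsilon> and the square-zero element.\<close>
  have "r = \<epsilon> \<otimes>\<^bsub>\<Lambda>\<^esub> ?p \<oplus>\<^bsub>\<Lambda>\<^esub> ?x \<otimes>\<^bsub>\<Lambda>\<^esub> ?q" using r' by (simp add: \<iota>_def)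
  moreover have c: "\<epsilon> \<in> carrier \<Lambda>" "?p \<in> carrier \<Lambda>" "?x \<in> carrier \<Lambda>" "?q \<in> carrier \<Lambda>"
    using r' \<epsilon>_in by simp_all
  ultimately have "v \<bullet>\<^bsub>V\<^esub> r = (v \<bullet>\<^bsub>V\<^esub> \<epsilon>) \<bullet>\<^bsub>V\<^esub> ?p \<oplus>\<^bsub>V\<^esub> (v \<bullet>\<^bsub>V\<^esub> ?x) \<bullet>\<^bsub>V\<^esub> ?q"
    using v(1) by (simp only: V.act_add_right \<Lambda>.m_closed V.act_assoc)
  then show ?thesis using v c by (simp del: \<Lambda>_simps)
qed

lemma fg_projective_reg_S: "fg_projective S (reg_module S)"
  by (rule fg_projective_reg[OF S.ring_axioms])

text \<open>The idempotent \<epsilon> kills \<open>V\<close> or acts injectively, and then as the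
  identity. In the first case \<open>V\<close> is an \<open>S\<close>-module and a summand of
  \<open>S\<close>, the kernel of its own cover; in the second it is inflated from a simple
  \<open>A\<close>-module.\<close>

lemma del_module_\<Lambda>_le:
  fixes V :: "('a \<times> 's \<times> ('s \<times> 's)) umodule"
  assumes V: "simple_module \<Lambda> V"
  shows "del_module \<Lambda> V \<le> del A + 1"
proof -
  interpret V: right_module \<Lambda> V using V by (simp add: simple_module_def)
  have comm: "\<exists>r'\<in>carrier \<Lambda>. r \<otimes>\<^bsub>\<Lambda>\<^esub> \<epsilon> = \<epsilon> \<otimes>\<^bsub>\<Lambda>\<^esub> r'" if "r \<in> carrier \<Lambda>" for r
    using that mult_\<epsilon>[OF that] \<epsilon>_mult_\<iota>[of "\<alpha> r"] by (intro bexI[of _ "\<iota> (\<alpha> r)"]) (simp_all del: \<Lambda>_simps)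
  consider "\<forall>v\<in>carrier V. v \<bullet>\<^bsub>V\<^esub> \<epsilon> = \<zero>\<^bsub>V\<^esub>" | "\<forall>v\<in>carrier V. v \<bullet>\<^bsub>V\<^esub> \<epsilon> = \<zero>\<^bsub>V\<^esub> \<longrightarrow> v = \<zero>\<^bsub>V\<^esub>"
    using simple_module_kernel[OF V \<epsilon>_in comm] by blast
  then show ?thesis
  proof cases
    case 1
    have x: "v \<bullet>\<^bsub>V\<^esub> (\<zero>\<^bsub>A\<^esub>, \<zero>\<^bsub>S\<^esub>, (\<zero>\<^bsub>S\<^esub>, \<one>\<^bsub>S\<^esub>)) = \<zero>\<^bsub>V\<^esub>" if "v \<in> carrier V" for v
    proof (rule simple_module_square_zero[OF V _ _ _ that])
      fix r assume "r \<in> carrier \<Lambda>"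
      then obtain a m s t where "r = (a, m, (s, t))" "a \<in> carrier A" "m \<in> carrier S" "s \<in> carrier S" "t \<in> carrier S"
        by auto
      then show "\<exists>r'\<in>carrier \<Lambda>. r \<otimes>\<^bsub>\<Lambda>\<^esub> (\<zero>\<^bsub>A\<^esub>, \<zero>\<^bsub>S\<^esub>, (\<zero>\<^bsub>S\<^esub>, \<one>\<^bsub>S\<^esub>)) = (\<zero>\<^bsub>A\<^esub>, \<zero>\<^bsub>S\<^esub>, (\<zero>\<^bsub>S\<^esub>, \<one>\<^bsub>S\<^esub>)) \<otimes>\<^bsub>\<Lambda>\<^esub> r'"
        by (intro bexI[of _ "(\<zero>\<^bsub>A\<^esub>, \<zero>\<^bsub>S\<^esub>, (s, \<zero>\<^bsub>S\<^esub>))"]) auto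
    qed auto
    have "retract \<Lambda> V (restr_scalars \<beta> (reg_module S))"
    proof (rule simple_module_retract[OF V semisimple_quotient \<beta>_hom \<beta>_onto ring_\<Lambda>])
      fix v r assume "v \<in> carrier V" "r \<in> carrier \<Lambda>" "\<beta> r = \<zero>\<^bsub>S\<^esub>"
      then show "v \<bullet>\<^bsub>V\<^esub> r = \<zero>\<^bsub>V\<^esub>" using act_\<beta>_kernel[OF V.right_module_axioms _ _ x] 1 by blast
    qed
    then have "retract \<Lambda> V (restrict_module (double (reg_module S))
        (a_kernel (double (reg_module S)) (restr_scalars \<beta> (reg_module S)) fst))"
    proof (rule retract_trans)
      interpret c: rmod_hom \<Lambda> "double (reg_module S)" "restr_scalars \<beta> (reg_module S)" fst
        by (intro rmod_homI projective_coverD[OF cover_double(1)[OF fg_projective_reg_S]]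
          right_module_\<beta> S.right_module_reg)
      show "retract \<Lambda> (restr_scalars \<beta> (reg_module S)) (restrict_module (double (reg_module S))
          (a_kernel (double (reg_module S)) (restr_scalars \<beta> (reg_module S)) fst))"
        by (rule iso_imp_retract(2)[OF c.M.right_module_restrict[OF c.rsub_kernel]
          cover_double(2)[OF fg_projective_reg_S]])
    qed
    then have "deloopable \<Lambda> V 0"
      by (rule deloopable_0[OF V.right_module_axioms cover_double(1)[OF fg_projective_reg_S]
        right_module_\<beta>[OF S.right_module_reg]])
    then show ?thesis using del_module_le by (metis enat_0 le_zero_eq zero_le)
  next
    case 2
    have fix_\<epsilon>: "v \<bullet>\<^bsub>V\<^esub> \<epsilon> = v" if v: "v \<in> carrier V" for v
    proof -
      have ve: "v \<bullet>\<^bsub>V\<^esub> \<epsilon> \<in> carrier V" by (rule V.act_closed[OF v \<epsilon>_in])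
      have "(v \<bullet>\<^bsub>V\<^esub> \<epsilon>) \<bullet>\<^bsub>V\<^esub> \<epsilon> = v \<bullet>\<^bsub>V\<^esub> \<epsilon>" using act_\<epsilon>(1)[OF V.right_module_axioms v \<epsilon>_in] by simp
      \<comment> \<open>The element \<open>v - v \<epsilon>\<close> is killed by \<epsilon>, hence
        zero by injectivity.\<close>
      then have "(v \<ominus>\<^bsub>V\<^esub> v \<bullet>\<^bsub>V\<^esub> \<epsilon>) \<bullet>\<^bsub>V\<^esub> \<epsilon> = \<zero>\<^bsub>V\<^esub>"
        using v ve \<epsilon>_in by (simp add: a_minus_def V.act_add_left V.act_neg_left V.r_neg del: \<Lambda>_simps)
      then show ?thesis using 2 v ve V.diff_eq_zero_iff[OF v ve] V.minus_closed[OF v ve] by metis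
    qed
    have act: "v \<bullet>\<^bsub>V\<^esub> r = v \<bullet>\<^bsub>V\<^esub> \<iota> (\<alpha> r)" if "v \<in> carrier V" "r \<in> carrier \<Lambda>" for v r
      using act_\<epsilon>(1)[OF V.right_module_axioms that] fix_\<epsilon>[OF V.act_closed[OF that]] by simp
    have C: "right_module A (corner V)" by (rule right_module_corner[OF V.right_module_axioms])
    have "simple_module A (corner V)"
      unfolding simple_module_def
    proof (intro conjI C allI impI)
      show "carrier (corner V) \<noteq> {\<zero>\<^bsub>corner V\<^esub>}"
        using V fix_\<epsilon> by (simp add: simple_module_def set_eq_iff) blast
      fix N assume N: "rsubmodule A N (corner V)"
      have "rsubmodule \<Lambda> N V"
      proof (rule V.rsubmoduleI)
        show "x \<bullet>\<^bsub>V\<^esub> r \<in> N" if "x \<in> N" "r \<in> carrier \<Lambda>" for x r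
          using act[of x r] rsub_act[OF N, of x "\<alpha> r"] rsub_in[OF N, of x] that by (simp del: \<Lambda>_simps)
      qed (use rsub_in[OF N] rsub_zero[OF N] rsub_add[OF N] in auto)
      then show "N = {\<zero>\<^bsub>corner V\<^esub>} \<or> N = carrier (corner V)"
        using V fix_\<epsilon> by (auto simp: simple_module_def)
    qed
    note sC = this
    obtain T :: "'a umodule" where T: "fg_module A T" "rmodule_iso A (corner V) T"
      using fg_module_iso_umodule[OF simple_module_fg[OF sC]] by blast
    have sT: "simple_module A T" by (rule simple_module_iso[OF sC fg_module_right_module[OF T(1)] T(2)])
    have "rmodule_iso \<Lambda> V (restr_scalars \<alpha> (corner V))"
      by (rule rmodule_isoI[of "\<lambda>x. x" _ _ _ "\<lambda>x. x"])
        (simp_all add: rmodule_hom_def fix_\<epsilon> del: \<Lambda>_simps flip: act)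
    then have VT: "rmodule_iso \<Lambda> V (restr_scalars \<alpha> T)"
      by (rule rmodule_iso_trans[OF _ rmodule_iso_restr_scalars[OF T(2) \<alpha>_hom]])
    have "del_module \<Lambda> V \<le> del_module A T + 1"
      by (rule del_module_Suc[OF deloopable_inflate_Suc[OF T(1) _ V.right_module_axioms VT]])
    also have "\<dots> \<le> del A + 1" using del_module_le_del[OF sT] by (rule add_right_mono)
    finally show ?thesis .
  qed
qed

lemma del_\<Lambda>_le: "del \<Lambda> \<le> del A + 1"
  by (rule del_leI[OF del_module_\<Lambda>_le])

section \<open>The opposite algebra\<close>

abbreviation \<Lambda>' :: "('a \<times> 's \<times> ('s \<times> 's)) ring" where "\<Lambda>' \<equiv> opposite_ring \<Lambda>"
abbreviation S' :: "('s, 'e) ring_scheme" where "S' \<equiv> opposite_ring S"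

lemma ring_\<Lambda>': "ring \<Lambda>'" by (rule \<Lambda>.ring_opposite)
lemma ring_S': "ring S'" by (rule S.ring_opposite)

text \<open>Left modules appear as right modules over the opposite ring. The simple left modules of
  \<open>A\<close> are reached through \<open>\<gamma>\<close>, those of B through
  \<open>\<beta>\<close>.\<close>

definition \<gamma> :: "'a \<times> 's \<times> ('s \<times> 's) \<Rightarrow> 's" where "\<gamma> r = \<rho> (\<alpha> r)"

lemma \<gamma>_simp [simp]: "\<gamma> (a, m, (s, t)) = \<rho> a" by (simp add: \<gamma>_def)

lemma \<gamma>_hom: "\<gamma> \<in> ring_hom \<Lambda>' S'" by (rule ring_hom_memI) auto
lemma \<beta>_hom': "\<beta> \<in> ring_hom \<Lambda>' S'" by (rule ring_hom_memI) auto

lemma \<gamma>_onto: "\<gamma> ` carrier \<Lambda>' = carrier S'"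
proof -
  have "\<gamma> ` carrier \<Lambda>' = \<rho> ` \<alpha> ` carrier \<Lambda>" by (simp add: image_image \<gamma>_def del: \<Lambda>_simps)
  then show ?thesis by (simp add: \<alpha>_onto \<rho>_onto del: \<Lambda>_simps)
qed

text \<open>The left \<open>\<Lambda>\<close>-module \<open>\<Lambda> e\<close> for the idempotent \<open>e\<close> of \<open>B\<close>, i.e. the second column of \<open>\<Lambda>\<close>.\<close>

definition column :: "('a \<times> 's \<times> ('s \<times> 's), 's \<times> ('s \<times> 's)) rmodule" where
  "column = \<lparr>carrier = carrier S \<times> (carrier S \<times> carrier S), mult = undefined, one = undefined,
     zero = (\<zero>\<^bsub>S\<^esub>, (\<zero>\<^bsub>S\<^esub>, \<zero>\<^bsub>S\<^esub>)),
     add = (\<lambda>(m, (s, t)) (m', (s', t')). (m \<oplus>\<^bsub>S\<^esub> m', (s \<oplus>\<^bsub>S\<^esub> s', t \<oplus>\<^bsub>S\<^esub> t'))),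
     act = (\<lambda>(m', (s', t')) (a, m, (s, t)). (\<rho> a \<otimes>\<^bsub>S\<^esub> m' \<oplus>\<^bsub>S\<^esub> m \<otimes>\<^bsub>S\<^esub> s',
       (s \<otimes>\<^bsub>S\<^esub> s', s \<otimes>\<^bsub>S\<^esub> t' \<oplus>\<^bsub>S\<^esub> t \<otimes>\<^bsub>S\<^esub> s')))\<rparr>"

lemma column_simps [simp]:
  "carrier column = carrier S \<times> (carrier S \<times> carrier S)" "\<zero>\<^bsub>column\<^esub> = (\<zero>\<^bsub>S\<^esub>, (\<zero>\<^bsub>S\<^esub>, \<zero>\<^bsub>S\<^esub>))"
  "(m, (s, t)) \<oplus>\<^bsub>column\<^esub> (m', (s', t')) = (m \<oplus>\<^bsub>S\<^esub> m', (s \<oplus>\<^bsub>S\<^esub> s', t \<oplus>\<^bsub>S\<^esub> t'))"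
  "(m', (s', t')) \<bullet>\<^bsub>column\<^esub> (a, m, (s, t)) = (\<rho> a \<otimes>\<^bsub>S\<^esub> m' \<oplus>\<^bsub>S\<^esub> m \<otimes>\<^bsub>S\<^esub> s',
       (s \<otimes>\<^bsub>S\<^esub> s', s \<otimes>\<^bsub>S\<^esub> t' \<oplus>\<^bsub>S\<^esub> t \<otimes>\<^bsub>S\<^esub> s'))"
  by (simp_all add: column_def)

lemma right_module_column: "right_module \<Lambda>' column"
proof (rule right_moduleI)
  show "\<exists>y\<in>carrier column. y \<oplus>\<^bsub>column\<^esub> x = \<zero>\<^bsub>column\<^esub>" if "x \<in> carrier column" for x
  proof -
    obtain m s t where "x = (m, (s, t))" by (metis prod.exhaust)
    then show ?thesis using that
      by (intro bexI[of _ "(\<ominus>\<^bsub>S\<^esub> m, (\<ominus>\<^bsub>S\<^esub> s, \<ominus>\<^bsub>S\<^esub> t))"]) (auto simp: S.l_neg)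
  qed
qed (auto simp: ring_\<Lambda>' S.a_ac S.l_distr S.r_distr S.m_assoc)

lemma fg_projective_column: "fg_projective \<Lambda>' column"
proof (rule fg_projective_retract[OF fg_projective_reg[OF ring_\<Lambda>'] right_module_column])
  show "retract \<Lambda>' column (reg_module \<Lambda>')"
    by (rule retractI[of "\<lambda>q. (\<zero>\<^bsub>A\<^esub>, q)" _ _ _ snd]) (auto intro!: rmodule_homI)
qed

abbreviation semisimple_summand :: "('a \<times> 's \<times> ('s \<times> 's), 's) rmodule" where
  "semisimple_summand \<equiv> restr_scalars \<beta> (reg_module S')"

lemma right_module_opposite_restr:
  "right_module \<Lambda>' (restr_scalars \<gamma> (reg_module S'))" "right_module \<Lambda>' semisimple_summand"
  using right_module_restr_scalars[OF ring_\<Lambda>' _ ring.right_module_reg[OF ring_S']] \<gamma>_hom \<beta>_hom' by auto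

text \<open>A submodule that spans the column together with the kernel contains some
  \<open>(m, (1, t))\<close>, and such an element generates the column. On the kernel the middle
  component is zero, so the entries \<open>m\<close> and \<open>t\<close> of a matrix act trivially
  and the kernel splits into its two outer components.\<close>

lemma cover_column:
  shows "projective_cover \<Lambda>' column (\<lambda>q. fst (snd q)) semisimple_summand"
    and "retract \<Lambda>' (restr_scalars \<gamma> (reg_module S')) (restrict_module column
      (a_kernel column semisimple_summand (\<lambda>q. fst (snd q))))"
    and "retract \<Lambda>' semisimple_summand (restrict_module column
      (a_kernel column semisimple_summand (\<lambda>q. fst (snd q))))"
proof -
  let ?c = "\<lambda>q. fst (snd q)"
  have c: "?c \<in> rmodule_hom \<Lambda>' column semisimple_summand" by (rule rmodule_homI) auto
  interpret c: rmod_hom \<Lambda>' column semisimple_summand ?c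
    by (intro rmod_homI c right_module_column right_module_opposite_restr)
  have ker: "a_kernel column semisimple_summand ?c = carrier S \<times> ({\<zero>\<^bsub>S\<^esub>} \<times> carrier S)"
    by (auto simp: c.kernel_eq)
  have "superfluous \<Lambda>' (a_kernel column semisimple_summand ?c) column"
  proof (rule superfluousI[OF c.rsub_kernel])
    fix N assume N: "rsubmodule \<Lambda>' N column"
      and *: "\<And>p. p \<in> carrier column \<Longrightarrow>
        \<exists>n\<in>N. \<exists>k\<in>a_kernel column semisimple_summand ?c. p = n \<oplus>\<^bsub>column\<^esub> k"
    have NC: "m \<in> carrier S" "s \<in> carrier S" "t \<in> carrier S" if "(m, (s, t)) \<in> N" for m s t
      using rsub_in[OF N that] by auto
    obtain m s t k where n: "(m, (s, t)) \<in> N" "k \<in> carrier S \<times> ({\<zero>\<^bsub>S\<^esub>} \<times> carrier S)"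
      "(\<zero>\<^bsub>S\<^esub>, (\<one>\<^bsub>S\<^esub>, \<zero>\<^bsub>S\<^esub>)) = (m, (s, t)) \<oplus>\<^bsub>column\<^esub> k"
      using *[of "(\<zero>\<^bsub>S\<^esub>, (\<one>\<^bsub>S\<^esub>, \<zero>\<^bsub>S\<^esub>))"] unfolding ker by auto
    then have "s = \<one>\<^bsub>S\<^esub>" using NC[OF n(1)] by auto
    then have n1: "(m, (\<one>\<^bsub>S\<^esub>, t)) \<in> N" using n(1) by simp
    show "carrier column \<subseteq> N"
    proof
      fix q assume "q \<in> carrier column"
      then obtain m' s' t' where q: "q = (m', (s', t'))" "m' \<in> carrier S" "s' \<in> carrier S" "t' \<in> carrier S"
        by auto
      \<comment> \<open>The last entry solves for \<open>t'\<close>: the product has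
        \<open>s' t\<close> plus this entry as its third component.\<close>
      have "(m, (\<one>\<^bsub>S\<^esub>, t)) \<bullet>\<^bsub>column\<^esub> (\<zero>\<^bsub>A\<^esub>, m', (s', \<ominus>\<^bsub>S\<^esub> (s' \<otimes>\<^bsub>S\<^esub> t) \<oplus>\<^bsub>S\<^esub> t')) \<in> N"
        by (rule rsub_act[OF N n1]) (use q NC[OF n1] in simp)
      then show "q \<in> N" using q NC[OF n1] by (simp add: S.r_neg2)
    qed
  qed
  moreover have "?c ` carrier column = carrier semisimple_summand" by force
  ultimately show "projective_cover \<Lambda>' column ?c semisimple_summand"
    using c fg_projective_column by (simp add: projective_cover_def)
  show "retract \<Lambda>' (restr_scalars \<gamma> (reg_module S')) (restrict_module column
      (a_kernel column semisimple_summand ?c))"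
    unfolding ker by (rule retractI[of "\<lambda>m. (m, (\<zero>\<^bsub>S\<^esub>, \<zero>\<^bsub>S\<^esub>))" _ _ _ fst]) (auto intro!: rmodule_homI)
  show "retract \<Lambda>' semisimple_summand (restrict_module column (a_kernel column semisimple_summand ?c))"
    unfolding ker by (rule retractI[of "\<lambda>t. (\<zero>\<^bsub>S\<^esub>, (\<zero>\<^bsub>S\<^esub>, t))" _ _ _ "\<lambda>q. snd (snd q)"])
      (auto intro!: rmodule_homI)
qed

text \<open>The idempotent of B kills \<open>V\<close> or acts injectively. In the first case only
  \<open>A\<close> acts, its radical trivially, and \<open>V\<close> is a summand of
  \<open>S\<close> through \<open>\<gamma>\<close>; in the second case the action factors through
  \<open>\<beta>\<close>.\<close>

lemma simple_opposite_retract: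
  assumes V: "simple_module \<Lambda>' V"
  shows "retract \<Lambda>' V (restr_scalars \<gamma> (reg_module S')) \<or> retract \<Lambda>' V semisimple_summand"
proof -
  interpret V: right_module \<Lambda>' V using V by (simp add: simple_module_def)
  let ?e = "(\<zero>\<^bsub>A\<^esub>, \<zero>\<^bsub>S\<^esub>, (\<one>\<^bsub>S\<^esub>, \<zero>\<^bsub>S\<^esub>))" and ?x = "(\<zero>\<^bsub>A\<^esub>, \<zero>\<^bsub>S\<^esub>, (\<zero>\<^bsub>S\<^esub>, \<one>\<^bsub>S\<^esub>))"
  have e: "?e \<in> carrier \<Lambda>'" by simp
  have split: thesis
    if "r \<in> carrier \<Lambda>'" "\<And>a m s t. r = (a, m, (s, t)) \<Longrightarrow> a \<in> carrier A \<Longrightarrow> m \<in> carrier S \<Longrightarrow>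
      s \<in> carrier S \<Longrightarrow> t \<in> carrier S \<Longrightarrow> thesis" for r thesis
    using that by auto
  \<comment> \<open>In \<Lambda> this says that \<open>e \<Lambda>\<close> is contained in
    \<open>\<Lambda> e\<close>, since the second row of a matrix has zero in the first
    column.\<close>
  have comm: "\<exists>r'\<in>carrier \<Lambda>'. r \<otimes>\<^bsub>\<Lambda>'\<^esub> ?e = ?e \<otimes>\<^bsub>\<Lambda>'\<^esub> r'" if r: "r \<in> carrier \<Lambda>'" for r
  proof (rule split[OF r])
    fix a m s t assume "r = (a, m, (s, t))" "a \<in> carrier A" "m \<in> carrier S" "s \<in> carrier S" "t \<in> carrier S"
    then show ?thesis by (intro bexI[of _ "(\<zero>\<^bsub>A\<^esub>, \<zero>\<^bsub>S\<^esub>, (s, t))"]) auto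
  qed
  consider "\<forall>v\<in>carrier V. v \<bullet>\<^bsub>V\<^esub> ?e = \<zero>\<^bsub>V\<^esub>" | "\<forall>v\<in>carrier V. v \<bullet>\<^bsub>V\<^esub> ?e = \<zero>\<^bsub>V\<^esub> \<longrightarrow> v = \<zero>\<^bsub>V\<^esub>"
    using simple_module_kernel[OF V e comm] by blast
  then show ?thesis
  proof cases
    case 1
    have act: "v \<bullet>\<^bsub>V\<^esub> (a, m, (s, t)) = v \<bullet>\<^bsub>V\<^esub> \<iota> a"
      if v: "v \<in> carrier V" and c: "a \<in> carrier A" "m \<in> carrier S" "s \<in> carrier S" "t \<in> carrier S" for v a m s t
    proof -
      \<comment> \<open>The rest of the matrix is a left multiple of \<open>?e\<close> in \<Lambda>,
        and so it acts by zero.\<close>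
      have "(a, m, (s, t)) = \<iota> a \<oplus>\<^bsub>\<Lambda>'\<^esub> ?e \<otimes>\<^bsub>\<Lambda>'\<^esub> (\<zero>\<^bsub>A\<^esub>, m, (s, t))" using c by (simp add: \<iota>_def)
      moreover have "\<iota> a \<in> carrier \<Lambda>'" "(\<zero>\<^bsub>A\<^esub>, m, (s, t)) \<in> carrier \<Lambda>'" using c by (simp_all add: \<iota>_def)
      ultimately have "v \<bullet>\<^bsub>V\<^esub> (a, m, (s, t)) = v \<bullet>\<^bsub>V\<^esub> \<iota> a \<oplus>\<^bsub>V\<^esub> (v \<bullet>\<^bsub>V\<^esub> ?e) \<bullet>\<^bsub>V\<^esub> (\<zero>\<^bsub>A\<^esub>, m, (s, t))"
        using v e by (simp only: V.act_add_right V.R.m_closed V.act_assoc)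
      then show ?thesis using 1 v c V.act_closed[OF v, of "\<iota> a"] by (simp add: \<iota>_def)
    qed
    have "retract \<Lambda>' V (restr_scalars \<gamma> (reg_module S'))"
    proof (rule simple_module_retract[OF V semisimple_quotient_opposite \<gamma>_hom \<gamma>_onto ring_\<Lambda>'])
      fix v r assume v: "v \<in> carrier V" and r: "r \<in> carrier \<Lambda>'" "\<gamma> r = \<zero>\<^bsub>S'\<^esub>"
      obtain a m s t where r': "r = (a, m, (s, t))" "a \<in> carrier A" "m \<in> carrier S" "s \<in> carrier S" "t \<in> carrier S"
        by (rule split[OF r(1)])
      have a: "a \<in> jacobson_radical A" using r(2) r'(1,2) \<rho>_kernel by simp
      show "v \<bullet>\<^bsub>V\<^esub> r = \<zero>\<^bsub>V\<^esub>"
      proof (rule ccontr)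
        assume nz: "v \<bullet>\<^bsub>V\<^esub> r \<noteq> \<zero>\<^bsub>V\<^esub>"
        have ia: "\<iota> a \<in> carrier \<Lambda>'" using r'(2) by (simp add: \<iota>_def)
        have va: "v \<bullet>\<^bsub>V\<^esub> r = v \<bullet>\<^bsub>V\<^esub> \<iota> a" using act[OF v r'(2-5)] r'(1) by simp
        \<comment> \<open>Nakayama's argument: the nonzero \<open>v r\<close> generates
          \<open>V\<close>, so \<open>v\<close> equals \<open>v\<close> times an element
          \<open>j\<close> of the radical, and \<open>1 - j\<close> has an inverse; this forces
          \<open>v\<close> to be zero.\<close>
        obtain l where l: "l \<in> carrier \<Lambda>'" "v = (v \<bullet>\<^bsub>V\<^esub> \<iota> a) \<bullet>\<^bsub>V\<^esub> l"
          by (rule simple_module_cyclic[OF V V.act_closed[OF v r(1)] nz v, unfolded va])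
        obtain b m s t where l': "l = (b, m, (s, t))" "b \<in> carrier A" "m \<in> carrier S" "s \<in> carrier S" "t \<in> carrier S"
          by (rule split[OF l(1)])
        define j where "j = b \<otimes>\<^bsub>A\<^esub> a"
        have j: "j \<in> jacobson_radical A" unfolding j_def by (rule A.jacobson_radical_mult_left[OF a l'(2)])
        have jA: "j \<in> carrier A" using r'(2) l'(2) by (simp add: j_def)
        have "\<iota> a \<otimes>\<^bsub>\<Lambda>'\<^esub> l = (j, \<zero>\<^bsub>S\<^esub>, (\<zero>\<^bsub>S\<^esub>, \<zero>\<^bsub>S\<^esub>))" using l' r'(2) by (simp add: \<iota>_def j_def)
        then have vj: "v \<bullet>\<^bsub>V\<^esub> \<iota> j = v" using l V.act_assoc[OF v ia l(1)] by (simp add: \<iota>_def)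
        have v1: "v \<bullet>\<^bsub>V\<^esub> \<epsilon> = v" using act[OF v, of "\<one>\<^bsub>A\<^esub>" "\<zero>\<^bsub>S\<^esub>" "\<one>\<^bsub>S\<^esub>" "\<zero>\<^bsub>S\<^esub>"] V.act_one[OF v] by simp
        obtain c where c: "c \<in> carrier A" "c \<otimes>\<^bsub>A\<^esub> (\<one>\<^bsub>A\<^esub> \<ominus>\<^bsub>A\<^esub> j) = \<one>\<^bsub>A\<^esub>"
          using A.one_minus_jacobson_radical_unit[OF j] by blast
        define u where "u = \<one>\<^bsub>A\<^esub> \<ominus>\<^bsub>A\<^esub> j"
        have uA: "u \<in> carrier A" using jA by (simp add: u_def)
        have in\<Lambda>': "\<iota> x \<in> carrier \<Lambda>'" if "x \<in> carrier A" for x using that by (simp add: \<iota>_def)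
        have "\<iota> u \<oplus>\<^bsub>\<Lambda>'\<^esub> \<iota> j = \<epsilon>" using jA by (simp add: \<iota>_def u_def a_minus_def A.a_assoc A.l_neg)
        then have "v \<bullet>\<^bsub>V\<^esub> \<iota> u \<oplus>\<^bsub>V\<^esub> v = v"
          using V.act_add_right[OF v in\<Lambda>'[OF uA] in\<Lambda>'[OF jA]] v1 vj by simp
        then have vu: "v \<bullet>\<^bsub>V\<^esub> \<iota> u = \<zero>\<^bsub>V\<^esub>"
          using v V.act_closed[OF v in\<Lambda>'[OF uA]] by (metis V.a_comm V.add.r_cancel_one')
        have "\<iota> u \<otimes>\<^bsub>\<Lambda>'\<^esub> \<iota> c = \<epsilon>" using uA c by (simp add: u_def flip: \<iota>_mult)
        then have "v = (v \<bullet>\<^bsub>V\<^esub> \<iota> u) \<bullet>\<^bsub>V\<^esub> \<iota> c"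
          using V.act_assoc[OF v in\<Lambda>'[OF uA] in\<Lambda>'[OF c(1)]] v1 by simp
        then have "v = \<zero>\<^bsub>V\<^esub>" using vu in\<Lambda>'[OF c(1)] by simp
        then show False using nz r(1) by simp
      qed
    qed
    then show ?thesis ..
  next
    case 2
    have x: "v \<bullet>\<^bsub>V\<^esub> ?x = \<zero>\<^bsub>V\<^esub>" if "v \<in> carrier V" for v
    proof (rule simple_module_square_zero[OF V _ _ _ that])
      fix r assume r: "r \<in> carrier \<Lambda>'"
      show "\<exists>r'\<in>carrier \<Lambda>'. r \<otimes>\<^bsub>\<Lambda>'\<^esub> ?x = ?x \<otimes>\<^bsub>\<Lambda>'\<^esub> r'"
      proof (rule split[OF r])
        fix a m s t assume "r = (a, m, (s, t))" "a \<in> carrier A" "m \<in> carrier S" "s \<in> carrier S" "t \<in> carrier S"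
        then show ?thesis by (intro bexI[of _ "(\<zero>\<^bsub>A\<^esub>, \<zero>\<^bsub>S\<^esub>, (s, \<zero>\<^bsub>S\<^esub>))"]) auto
      qed
    qed auto
    have "retract \<Lambda>' V semisimple_summand"
    proof (rule simple_module_retract[OF V semisimple_quotient_opposite \<beta>_hom' _ ring_\<Lambda>'])
      show "\<beta> ` carrier \<Lambda>' = carrier S'" using \<beta>_onto by simp
      fix v r assume v: "v \<in> carrier V" and r: "r \<in> carrier \<Lambda>'" "\<beta> r = \<zero>\<^bsub>S'\<^esub>"
      obtain a m s t where r': "r = (a, m, (s, t))" "a \<in> carrier A" "m \<in> carrier S" "s \<in> carrier S" "t \<in> carrier S"
        by (rule split[OF r(1)])
      have s: "s = \<zero>\<^bsub>S\<^esub>" using r(2) r'(1) by simp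
      let ?t = "(\<zero>\<^bsub>A\<^esub>, \<zero>\<^bsub>S\<^esub>, (t, \<zero>\<^bsub>S\<^esub>))"
      have c: "?x \<in> carrier \<Lambda>'" "?t \<in> carrier \<Lambda>'" using r' by simp_all
      \<comment> \<open>As \<open>?e\<close> acts injectively, it is enough to treat the product
        with \<open>?e\<close>. What remains of \<open>r\<close> is a multiple of \<open>?x\<close>,
        which acts by zero.\<close>
      have "r \<otimes>\<^bsub>\<Lambda>'\<^esub> ?e = ?x \<otimes>\<^bsub>\<Lambda>'\<^esub> ?t" using r' s by simp
      then have "(v \<bullet>\<^bsub>V\<^esub> r) \<bullet>\<^bsub>V\<^esub> ?e = (v \<bullet>\<^bsub>V\<^esub> ?x) \<bullet>\<^bsub>V\<^esub> ?t"
        using V.act_assoc[OF v r(1) e] V.act_assoc[OF v c] by simp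
      then have "(v \<bullet>\<^bsub>V\<^esub> r) \<bullet>\<^bsub>V\<^esub> ?e = \<zero>\<^bsub>V\<^esub>" using x[OF v] V.zero_act[OF c(2)] by simp
      then show "v \<bullet>\<^bsub>V\<^esub> r = \<zero>\<^bsub>V\<^esub>" using 2 V.act_closed[OF v r(1)] by blast
    qed
    then show ?thesis ..
  qed
qed

lemma del_opposite: "del \<Lambda>' = 0"
proof -
  have "del \<Lambda>' \<le> 0"
  proof (rule del_leI)
    fix V :: "('a \<times> 's \<times> ('s \<times> 's)) umodule" assume V: "simple_module \<Lambda>' V"
    have "retract \<Lambda>' V (restrict_module column (a_kernel column semisimple_summand (\<lambda>q. fst (snd q))))"
      using simple_opposite_retract[OF V] retract_trans[OF _ cover_column(2)] retract_trans[OF _ cover_column(3)]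
      by blast
    then have "deloopable \<Lambda>' V 0"
      using V by (intro deloopable_0[OF _ cover_column(1) right_module_opposite_restr(2)]) (simp add: simple_module_def)
    then show "del_module \<Lambda>' V \<le> 0" using del_module_le by (simp flip: enat_0)
  qed
  then show ?thesis by simp
qed

end

section \<open>The concrete factor ring by the radical, and the conclusion\<close>

lemma radical_quotient_FactRing:
  assumes "artin_algebra k \<phi> A"
  shows "radical_quotient k \<phi> A (A Quot jacobson_radical A) (\<lambda>a. jacobson_radical A +>\<^bsub>A\<^esub> a)"
proof -
  interpret artin_algebra k \<phi> A by fact
  interpret J: ideal "jacobson_radical A" A by (rule A.jacobson_radical_ideal)
  interpret Q: ring "A Quot jacobson_radical A" by (rule J.quotient_is_ring)
  show ?thesis
  proof
    show "(+>\<^bsub>A\<^esub>) (jacobson_radical A) \<in> ring_hom A (A Quot jacobson_radical A)"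
      by (rule J.rcos_ring_hom)
    show "(+>\<^bsub>A\<^esub>) (jacobson_radical A) ` carrier A = carrier (A Quot jacobson_radical A)"
      by (auto simp: FactRing_def A_RCOSETS_def')
    fix a assume a: "a \<in> carrier A"
    show "jacobson_radical A +>\<^bsub>A\<^esub> a = \<zero>\<^bsub>A Quot jacobson_radical A\<^esub> \<longleftrightarrow> a \<in> jacobson_radical A"
      using a J.a_rcos_const J.a_rcos_self[OF a] by (auto simp: FactRing_def)
  qed
qed

theorem theorem1p1:
  fixes k :: "('k, 'c) ring_scheme" and \<phi> :: "'k \<Rightarrow> 'a" and A :: "('a, 'd) ring_scheme"
    and Abar :: "'a set ring" and B :: "('a set \<times> 'a set) ring"
    and \<Lambda> :: "('a \<times> 'a set \<times> ('a set \<times> 'a set)) ring"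
  assumes "artin_algebra k \<phi> A"
    and "Abar = A Quot jacobson_radical A"
    and "B = trivial_extension Abar"
    and "\<Lambda> = triangular_matrix_ring A Abar
           (\<lambda>a m. (jacobson_radical A +>\<^bsub>A\<^esub> a) \<otimes>\<^bsub>Abar\<^esub> m)
           (\<lambda>m b. m \<otimes>\<^bsub>Abar\<^esub> canonical_epi b) B"
  shows "del A \<le> del \<Lambda> \<and> del \<Lambda> \<le> del A + 1 \<and> del (opposite_ring \<Lambda>) = 0"
proof -
  interpret radical_quotient k \<phi> A Abar "\<lambda>a. jacobson_radical A +>\<^bsub>A\<^esub> a"
    using radical_quotient_FactRing[OF assms(1)] assms(2) by simp
  interpret triangular_extension k \<phi> A Abar "\<lambda>a. jacobson_radical A +>\<^bsub>A\<^esub> a" \<Lambda>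
    by unfold_locales (simp add: assms(3,4))
  show ?thesis using del_le_del_\<Lambda> del_\<Lambda>_le del_opposite by blast
qed

end
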